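(* Let $V$ be a complex vector space with $\dim V=k$. (1) A basis for $\mathbb{C}[V^{*p}\oplus V^q]^{\mathrm{SL}(V)}_d$ is given by the graphs of total degree $d$ obtained from $(p,q)$-bipartite arc diagrams in which no strict nesting contains more than $k$ arcs, by adjoining (zero or more) pairwise comparable hyperedges of size $k$ to either the starred or the unstarred side of the graph, such that the hyperedge rule (see context) is satisfied. (2) The $\mathrm{SL}(V)$-invariant corresponding to such a graph is the product of all arcs and hyperedges, where each arc $(i^*,j)$ contributes the contraction $f_{ij}$, each hyperedge $I$ on the starred vertices contributes $\det_{I^*}$, and each hyperedge $J$ on the unstarred vertices contributes $\det_J$. (3) The graphs with $m$ hyperedges on the starred side furnish a basis for $\mathbb{C}[V^{*p}\oplus V^q]^{\mathrm{GL}(V),\,\det^m}$. (4) The graphs with $m$ hyperedges on the unstarred side furnish a basis for $\mathbb{C}[V^{*p}\oplus V^q]^{\mathrm{GL}(V),\,\det^{-m}}$.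
   Context: $\mathbb{C}[W]_d$ denotes homogeneous polynomial functions of degree $d$. For a character $\chi$ of $H$, $\mathbb{C}[W]^{H,\chi}$ is the space of $f\in\mathbb{C}[W]$ with $h\cdot f=\chi(h)f$ for all $h\in H$, where $(h\cdot f)(w)=f(h^{-1}w)$. On $V^{*p}\oplus V^q\ni(v_1^*,\dots,v_p^*,v_1,\dots,v_q)$ define $f_{ij}=v_i^*(v_j)$, $\det_{I^*}=\det(v^*_{i_1},\dots,v^*_{i_k})$ for $I=(i_1<\dots<i_k)\in\mathcal C^p_k$, and $\det_J=\det(v_{j_1},\dots,v_{j_k})$ for $J=(j_1<\dots<j_k)\in\mathcal C^q_k$ (with respect to a fixed basis of $V$ and its dual basis). Here $\mathcal C^n_k$ is the set of strictly increasing sequences of length $k$ in $\{1,\dots,n\}$, ordered componentwise. A $(p,q)$-bipartite arc diagram is a bipartite multigraph (multiple edges allowed) on vertices $1^*,\dots,p^*$ (starred side), $1,\dots,q$ (unstarred side), whose edges (arcs) join a starred vertex $i^*$ to an unstarred vertex $j$. A strict nesting is a set of arcs such that for any two of them $(i^*,j)$, $(i'^*,j')$ either $i<i'$ and $j>j'$, or $i>i'$ and $j<j'$. A hyperedge on the starred (resp. unstarred) side is an element $I\in\mathcal C^p_k$ (resp. $J\in\mathcal C^q_k$), regarded as an edge incident to the $k$ vertices it lists. A graph carries a finite multiset of hyperedges, all on one side, forming a chain $I_1\le\dots\le I_m$ (repetitions allowed); $I_m$ is the topmost hyperedge. The total degree is the sum of the vertex degrees: each arc contributes 2 and each hyperedge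 contributes $k$. Chain decompositions. Let $M$ be the multiset of arcs, written as pairs $(i,j)$. Let $C_1^*(M)$ be the sub-multiset of those $(i,j)\in M$ for which there is no $(i',j')\in M$ with $i'<i$ and $j'>j$, and $C_{\ell+1}^*=C_1^*(M\setminus\bigcup_{s\le\ell}C_s^* )$. Let $C_1(M)$ be the sub-multiset of those $(i,j)\in M$ for which there is no $(i',j')\in M$ with $i'>i$ and $j'<j$, and $C_{\ell+1}=C_1(M\setminus\bigcup_{s\le\ell}C_s)$. The process stops when $M$ is exhausted. Hyperedge rule. If the hyperedges are on the starred side, with topmost hyperedge $(i_1<\dots<i_k)$, then the $\ell$th vertex of the topmost hyperedge must lie weakly outside all arcs in $C^*_\ell$: $i_\ell\le i$ for every $(i,j)\in C^*_\ell$. If the hyperedges are on the unstarred side, with topmost hyperedge $(j_1<\dots<j_k)$, then the $\ell$th vertex of the topmost hyperedge must lie weakly inside all arcs in $C_\ell$: $j_\ell\le j$ for every $(i,j)\in C_\ell$. The condition is vacuous for those $\ell$ for which $C^*_\ell$ (resp. $C_\ell$) does not exist, and when there are no hyperedges. *)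

theory Defs
  imports
    "Jordan_Normal_Form.Determinant"
    "HOL-Library.Function_Algebras"
    "HOL-Library.Multiset"
    "HOL-Library.FuncSet"
    Complex_Main
begin

text \<open>
  The space \<open>V\<close> is the type \<open>'v\<close> with scalar multiplication \<open>scale\<close>; it carries an
  ordered basis \<open>b 0, \<dots>, b (k - 1)\<close>.  A point of \<open>V\<^sup>*\<^sup>p \<oplus> V\<^sup>q\<close> is a pair of families indexed by
  \<open>{1..p}\<close> and \<open>{1..q}\<close>.
\<close>

type_synonym 'v point = "(nat \<Rightarrow> 'v \<Rightarrow> complex) \<times> (nat \<Rightarrow> 'v)"

definition dual_space :: "(complex \<Rightarrow> 'v::ab_group_add \<Rightarrow> 'v) \<Rightarrow> ('v \<Rightarrow> complex) set" where
  "dual_space scale = {\<phi>. Vector_Spaces.linear scale (*) \<phi>}"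

definition config_space ::
  "(complex \<Rightarrow> 'v::ab_group_add \<Rightarrow> 'v) \<Rightarrow> nat \<Rightarrow> nat \<Rightarrow> 'v point set" where
  "config_space scale p q = ({1..p} \<rightarrow>\<^sub>E dual_space scale) \<times> ({1..q} \<rightarrow>\<^sub>E UNIV)"

definition dual_basis ::
  "(complex \<Rightarrow> 'v::ab_group_add \<Rightarrow> 'v) \<Rightarrow> (nat \<Rightarrow> 'v) \<Rightarrow> nat \<Rightarrow> nat \<Rightarrow> 'v \<Rightarrow> complex" where
  "dual_basis scale b k r v = Modules.module.representation scale (b ` {..<k}) v (b r)"

text \<open>
  A function on a set \<open>W\<close> is represented by its extension by zero to the whole type, so that
  the functions on \<open>W\<close> form a linear subspace under the pointwise operations.
\<close>

definition on_set :: "'w set \<Rightarrow> ('w \<Rightarrow> complex) \<Rightarrow> 'w \<Rightarrow> complex" where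
  "on_set W f = (\<lambda>w. if w \<in> W then f w else 0)"

definition fun_scale :: "complex \<Rightarrow> ('w \<Rightarrow> complex) \<Rightarrow> 'w \<Rightarrow> complex" where
  "fun_scale c f = (\<lambda>w. c * f w)"

interpretation fun_space: vector_space "fun_scale :: complex \<Rightarrow> ('w \<Rightarrow> complex) \<Rightarrow> 'w \<Rightarrow> complex"
  by unfold_locales (auto simp: fun_scale_def fun_eq_iff algebra_simps)

text \<open>
  The coordinate functions: \<open>Inl (i, r)\<close> stands for the \<open>r\<close>-th coordinate of the covector with
  number \<open>i\<close> in the dual basis, \<open>Inr (j, r)\<close> for the \<open>r\<close>-th coordinate of the vector with
  number \<open>j\<close>.
\<close>

type_synonym coord_index = "nat \<times> nat + nat \<times> nat"

definition coord_indices :: "nat \<Rightarrow> nat \<Rightarrow> nat \<Rightarrow> coord_index set" where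
  "coord_indices k p q = ({1..p} \<times> {..<k}) <+> ({1..q} \<times> {..<k})"

fun coord_fun ::
  "(complex \<Rightarrow> 'v::ab_group_add \<Rightarrow> 'v) \<Rightarrow> (nat \<Rightarrow> 'v) \<Rightarrow> nat \<Rightarrow> coord_index \<Rightarrow> 'v point \<Rightarrow> complex"
where
  "coord_fun scale b k (Inl (i, r)) w = fst w i (b r)"
| "coord_fun scale b k (Inr (j, r)) w = dual_basis scale b k r (snd w j)"

definition monomial_fun ::
  "(complex \<Rightarrow> 'v::ab_group_add \<Rightarrow> 'v) \<Rightarrow> (nat \<Rightarrow> 'v) \<Rightarrow> nat \<Rightarrow> nat \<Rightarrow> nat \<Rightarrow>
    coord_index multiset \<Rightarrow> 'v point \<Rightarrow> complex" where
  "monomial_fun scale b k p q N =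
    on_set (config_space scale p q) (\<lambda>w. \<Prod>x\<in>#N. coord_fun scale b k x w)"

definition poly_funs ::
  "(complex \<Rightarrow> 'v::ab_group_add \<Rightarrow> 'v) \<Rightarrow> (nat \<Rightarrow> 'v) \<Rightarrow> nat \<Rightarrow> nat \<Rightarrow> nat \<Rightarrow>
    ('v point \<Rightarrow> complex) set" where
  "poly_funs scale b k p q =
    fun_space.span {monomial_fun scale b k p q N | N. set_mset N \<subseteq> coord_indices k p q}"

definition hom_poly_funs ::
  "(complex \<Rightarrow> 'v::ab_group_add \<Rightarrow> 'v) \<Rightarrow> (nat \<Rightarrow> 'v) \<Rightarrow> nat \<Rightarrow> nat \<Rightarrow> nat \<Rightarrow> nat \<Rightarrow>
    ('v point \<Rightarrow> complex) set" where
  "hom_poly_funs scale b k p q d =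
    fun_space.span {monomial_fun scale b k p q N | N.
      set_mset N \<subseteq> coord_indices k p q \<and> size N = d}"

definition lin_det ::
  "(complex \<Rightarrow> 'v::ab_group_add \<Rightarrow> 'v) \<Rightarrow> (nat \<Rightarrow> 'v) \<Rightarrow> nat \<Rightarrow> ('v \<Rightarrow> 'v) \<Rightarrow> complex" where
  "lin_det scale b k g = Determinant.det (mat k k (\<lambda>(r, c). dual_basis scale b k r (g (b c))))"

definition GL_group :: "(complex \<Rightarrow> 'v::ab_group_add \<Rightarrow> 'v) \<Rightarrow> ('v \<Rightarrow> 'v) set" where
  "GL_group scale = {g. Vector_Spaces.linear scale scale g \<and> bij g}"

definition SL_group ::
  "(complex \<Rightarrow> 'v::ab_group_add \<Rightarrow> 'v) \<Rightarrow> (nat \<Rightarrow> 'v) \<Rightarrow> nat \<Rightarrow> ('v \<Rightarrow> 'v) set" where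
  "SL_group scale b k = {g \<in> GL_group scale. lin_det scale b k g = 1}"

definition act :: "nat \<Rightarrow> nat \<Rightarrow> ('v \<Rightarrow> 'v) \<Rightarrow> 'v point \<Rightarrow> 'v point" where
  "act p q g w = ((\<lambda>i\<in>{1..p}. fst w i \<circ> inv_into UNIV g), (\<lambda>j\<in>{1..q}. g (snd w j)))"

definition fun_act ::
  "nat \<Rightarrow> nat \<Rightarrow> ('v \<Rightarrow> 'v) \<Rightarrow> ('v point \<Rightarrow> complex) \<Rightarrow> 'v point \<Rightarrow> complex" where
  "fun_act p q h f = (\<lambda>w. f (act p q (inv_into UNIV h) w))"

text \<open>
  The equation is imposed only on the configuration space: off it, \<open>f\<close> vanishes but
  \<open>fun_act p q h f\<close> need not.
\<close>

definition semi_invariants ::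
  "(complex \<Rightarrow> 'v::ab_group_add \<Rightarrow> 'v) \<Rightarrow> nat \<Rightarrow> nat \<Rightarrow> ('v point \<Rightarrow> complex) set \<Rightarrow>
    ('v \<Rightarrow> 'v) set \<Rightarrow> (('v \<Rightarrow> 'v) \<Rightarrow> complex) \<Rightarrow> ('v point \<Rightarrow> complex) set" where
  "semi_invariants scale p q R H \<chi> =
    {f \<in> R. \<forall>h\<in>H. \<forall>w\<in>config_space scale p q. fun_act p q h f w = \<chi> h * f w}"

text \<open>An arc \<open>(i, j)\<close> joins the starred vertex \<open>i\<close> to the unstarred vertex \<open>j\<close>.\<close>

type_synonym arc = "nat \<times> nat"

datatype hypergraph =
  Hypergraph (arcs: "arc multiset")
    (starred: "nat list multiset") (unstarred: "nat list multiset")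

definition arc_diagram :: "nat \<Rightarrow> nat \<Rightarrow> arc multiset \<Rightarrow> bool" where
  "arc_diagram p q M \<longleftrightarrow> set_mset M \<subseteq> {1..p} \<times> {1..q}"

definition strict_nesting :: "arc set \<Rightarrow> bool" where
  "strict_nesting S \<longleftrightarrow>
    (\<forall>(i, j)\<in>S. \<forall>(i', j')\<in>S. (i, j) \<noteq> (i', j') \<longrightarrow> i < i' \<and> j > j' \<or> i > i' \<and> j < j')"

definition hyperedges :: "nat \<Rightarrow> nat \<Rightarrow> nat list set" where
  "hyperedges n k = {I. length I = k \<and> sorted_wrt (<) I \<and> set I \<subseteq> {1..n}}"

definition hyperedge_le :: "nat list \<Rightarrow> nat list \<Rightarrow> bool" where
  "hyperedge_le I J \<longleftrightarrow> list_all2 (\<le>) I J"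

definition hyperedge_chain :: "nat list multiset \<Rightarrow> bool" where
  "hyperedge_chain E \<longleftrightarrow> (\<forall>I\<in>#E. \<forall>J\<in>#E. hyperedge_le I J \<or> hyperedge_le J I)"

definition topmost :: "nat list multiset \<Rightarrow> nat list \<Rightarrow> bool" where
  "topmost E T \<longleftrightarrow> T \<in># E \<and> (\<forall>I\<in>#E. hyperedge_le I T)"

definition first_chain_starred :: "arc multiset \<Rightarrow> arc multiset" where
  "first_chain_starred M = filter_mset (\<lambda>(i, j). \<not> (\<exists>(i', j')\<in>#M. i' < i \<and> j' > j)) M"

definition first_chain_unstarred :: "arc multiset \<Rightarrow> arc multiset" where
  "first_chain_unstarred M = filter_mset (\<lambda>(i, j). \<not> (\<exists>(i', j')\<in>#M. i' > i \<and> j' < j)) M"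

text \<open>
  \<open>chain_rest C l M\<close> is what remains of \<open>M\<close> after the first \<open>l\<close> chains have been removed,
  so that \<open>nth_chain C l M\<close> with \<open>l \<ge> 1\<close> is the \<open>l\<close>-th chain; it is empty once \<open>M\<close> is
  exhausted.
\<close>

primrec chain_rest :: "(arc multiset \<Rightarrow> arc multiset) \<Rightarrow> nat \<Rightarrow> arc multiset \<Rightarrow> arc multiset" where
  "chain_rest C 0 M = M"
| "chain_rest C (Suc l) M = chain_rest C l M - C (chain_rest C l M)"

definition nth_chain :: "(arc multiset \<Rightarrow> arc multiset) \<Rightarrow> nat \<Rightarrow> arc multiset \<Rightarrow> arc multiset" where
  "nth_chain C l M = C (chain_rest C (l - 1) M)"

definition hyperedge_rule :: "nat \<Rightarrow> hypergraph \<Rightarrow> bool" where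
  "hyperedge_rule k G \<longleftrightarrow>
    (\<forall>T. topmost (starred G) T \<longrightarrow>
      (\<forall>l\<in>{1..k}. \<forall>(i, j)\<in>#nth_chain first_chain_starred l (arcs G). T ! (l - 1) \<le> i)) \<and>
    (\<forall>T. topmost (unstarred G) T \<longrightarrow>
      (\<forall>l\<in>{1..k}. \<forall>(i, j)\<in>#nth_chain first_chain_unstarred l (arcs G). T ! (l - 1) \<le> j))"

definition admissible_graphs :: "nat \<Rightarrow> nat \<Rightarrow> nat \<Rightarrow> hypergraph set" where
  "admissible_graphs k p q =
    {G. arc_diagram p q (arcs G) \<and>
        (\<forall>S. S \<subseteq> set_mset (arcs G) \<and> strict_nesting S \<longrightarrow> card S \<le> k) \<and>
        set_mset (starred G) \<subseteq> hyperedges p k \<and> hyperedge_chain (starred G) \<and>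
        set_mset (unstarred G) \<subseteq> hyperedges q k \<and> hyperedge_chain (unstarred G) \<and>
        (starred G = {#} \<or> unstarred G = {#}) \<and>
        hyperedge_rule k G}"

definition total_degree :: "nat \<Rightarrow> hypergraph \<Rightarrow> nat" where
  "total_degree k G = 2 * size (arcs G) + k * (size (starred G) + size (unstarred G))"

definition contraction :: "nat \<Rightarrow> nat \<Rightarrow> 'v point \<Rightarrow> complex" where
  "contraction i j w = fst w i (snd w j)"

definition det_starred :: "(nat \<Rightarrow> 'v) \<Rightarrow> nat \<Rightarrow> nat list \<Rightarrow> 'v point \<Rightarrow> complex" where
  "det_starred b k I w = Determinant.det (mat k k (\<lambda>(r, c). fst w (I ! c) (b r)))"

definition det_unstarred ::
  "(complex \<Rightarrow> 'v::ab_group_add \<Rightarrow> 'v) \<Rightarrow> (nat \<Rightarrow> 'v) \<Rightarrow> nat \<Rightarrow> nat list \<Rightarrow> 'v point \<Rightarrow> complex"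
where
  "det_unstarred scale b k J w =
    Determinant.det (mat k k (\<lambda>(r, c). dual_basis scale b k r (snd w (J ! c))))"

definition graph_fun ::
  "(complex \<Rightarrow> 'v::ab_group_add \<Rightarrow> 'v) \<Rightarrow> (nat \<Rightarrow> 'v) \<Rightarrow> nat \<Rightarrow> nat \<Rightarrow> nat \<Rightarrow>
    hypergraph \<Rightarrow> 'v point \<Rightarrow> complex" where
  "graph_fun scale b k p q G = on_set (config_space scale p q) (\<lambda>w.
    (\<Prod>(i, j)\<in>#arcs G. contraction i j w) *
    (\<Prod>I\<in>#starred G. det_starred b k I w) *
    (\<Prod>J\<in>#unstarred G. det_unstarred scale b k J w))"

definition is_basis_family ::
  "('g \<Rightarrow> 'w \<Rightarrow> complex) \<Rightarrow> 'g set \<Rightarrow> ('w \<Rightarrow> complex) set \<Rightarrow> bool" where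
  "is_basis_family F G U \<longleftrightarrow>
    inj_on F G \<and> fun_space.independent (F ` G) \<and> fun_space.span (F ` G) = U"

end

theory Submission
  imports Defs "HOL-Library.Poly_Mapping"
begin

text \<open>
  In coordinates a point is a function \<open>a\<close> on coordinate indices: the covectors form a
  \<open>p \<times> k\<close> matrix, the vectors a \<open>k \<times> q\<close> matrix, an arc is an entry of the product of the two
  matrices and a hyperedge is a maximal minor (\<open>bracket\<close>) of one of them.  Exchanging \<open>V\<close> and its
  dual exchanges the two sides of a graph, so almost everything is proved for graphs with starred
  hyperedges only.

  The independence rests on a monomial \<open>m(G)\<close> of an admissible graph \<open>G\<close> (\<open>leading_monomial\<close>): every
  arc of the \<open>l\<close>-th chain gets colour \<open>l\<close>, that is, it contributes the product of the \<open>l\<close>-th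
  coordinates of its covector and its vector, and the \<open>l\<close>-th vertex of a hyperedge gets colour \<open>l\<close>.
  A chain is a monotone matching of its starred with its unstarred vertices, and by the hyperedge
  rule it stays one if the hyperedge vertices of that colour are matched with extra unstarred
  vertices \<open>0\<close>.  If \<open>m(G)\<close> occurs in the invariant of \<open>G'\<close>, then \<open>G'\<close> matches, in every colour, the
  same vertices in some way.  The rearrangement inequality for \<open>\<Sum> i * j\<close> over the arcs
  \<open>(i, j)\<close> says that the monotone matching is the unique heaviest one.  A second application, to the
  vertices of the hyperedges and their colours, separates graphs with the same arcs.  So the
  coefficients of the monomials \<open>m(G)\<close> form a triangular matrix with nonzero diagonal
  (\<open>leading_triangular\<close>, \<open>admissible_coefficients_vanish\<close>).

  Straightening is possible because an expression that is multilinear and alternating in \<open>k + 1\<close> covectors vanishes.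
  If a graph has \<open>k + 1\<close> nested arcs, or \<open>l\<close> nested arcs whose innermost one starts before the \<open>l\<close>-th
  vertex of a hyperedge, or two incomparable hyperedges, then such a relation rewrites it through
  graphs that are larger in the lexicographic order of \<open>\<Sum> i * j\<close> and of the sum of the squared
  vertex sums of the hyperedges.  Hence all products of arcs and starred hyperedges lie in the span of the
  admissible ones (\<open>straightening\<close>).

  To see that the admissible graphs span, let \<open>p \<ge> k\<close> and let \<open>D\<close> be the bracket of the first \<open>k\<close> covectors.  Where \<open>D\<close> does not
  vanish, a group element moves these covectors to the dual basis; by Cramer's rule all other
  coordinates become arcs, or brackets divided by \<open>D\<close>.  So a power of \<open>D\<close> times a semi-invariant is
  in the span of the admissible graphs (\<open>localized_semi_invariant\<close>).  The denominators are removed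
  by \<open>saturation\<close>: if \<open>D h\<close> is in the span, then the admissible graphs without the minimal hyperedge
  \<open>1 < \<dots> < k\<close> cannot occur in it, because \<open>D\<close> vanishes on a coordinate subspace whose coordinate
  functions still include all variables of their monomials \<open>m(G)\<close>.  For \<open>p < k\<close> add covectors
  and set them to zero afterwards.

  Finally, an invariant of the special linear group splits by the degree in the covectors, and
  scalar matrices show that every part is zero or a semi-invariant of the general linear group.
\<close>

section \<open>The rearrangement inequality for matchings\<close>

definition arc_weight :: "arc multiset \<Rightarrow> nat" where
  "arc_weight M = (\<Sum>(i, j)\<in>#M. i * j)"

lemma arc_weight_simps [simp]:
  "arc_weight {#} = 0"
  "arc_weight (add_mset x M) = fst x * snd x + arc_weight M"
  "arc_weight (M + N) = arc_weight M + arc_weight N"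
  by (auto simp: arc_weight_def case_prod_beta)

definition monotone_matching :: "(nat \<times> nat) multiset \<Rightarrow> bool" where
  "monotone_matching R \<longleftrightarrow>
    (\<forall>x\<in>#R. \<forall>y\<in>#R. fst x \<le> fst y \<and> snd x \<le> snd y \<or> fst y \<le> fst x \<and> snd y \<le> snd x)"

lemma ex_has_greatest_nat_finite:
  fixes f :: "'a \<Rightarrow> nat"
  assumes "finite A" "A \<noteq> {}"
  obtains m where "m \<in> A" "\<And>x. x \<in> A \<Longrightarrow> f x \<le> f m"
proof -
  have "Max (f ` A) \<in> f ` A" using assms by simp
  then obtain m where "m \<in> A" "f m = Max (f ` A)" by auto
  then show ?thesis using that[of m] assms by simp
qed

text \<open>
  By induction on the size: the top element \<open>(x, y)\<close> of a monotone matching pairs the largest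
  first with the largest second component.  A competitor either contains it, or contains
  \<open>(x, y')\<close> and \<open>(x', y)\<close> with \<open>x' < x\<close> and \<open>y' < y\<close>, and then uncrossing these two increases its
  weight strictly.
\<close>

lemma rearrangement:
  assumes "monotone_matching R"
    and "image_mset fst R' = image_mset fst R" and "image_mset snd R' = image_mset snd R"
  shows "arc_weight R' \<le> arc_weight R \<and> (arc_weight R' = arc_weight R \<longrightarrow> R' = R)"
  using assms
proof (induction "size R" arbitrary: R R')
  case 0
  then show ?case by simp
next
  case (Suc n)
  then have "set_mset R \<noteq> {}" by auto
  then obtain m where m: "m \<in># R" and mmax: "\<And>x. x \<in># R \<Longrightarrow> fst x + snd x \<le> fst m + snd m"
    using ex_has_greatest_nat_finite[of "set_mset R" "\<lambda>x. fst x + snd x"] by auto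
  have top: "fst x \<le> fst m \<and> snd x \<le> snd m" if "x \<in># R" for x
    using Suc.prems(1) mmax[OF that] m that unfolding monotone_matching_def by fastforce
  have fst_R': "fst x \<le> fst m" if "x \<in># R'" for x
  proof -
    have "fst x \<in># image_mset fst R" using that by (simp flip: Suc.prems(2))
    then show ?thesis using top by auto
  qed
  have snd_R': "snd x \<le> snd m" if "x \<in># R'" for x
  proof -
    have "snd x \<in># image_mset snd R" using that by (simp flip: Suc.prems(3))
    then show ?thesis using top by auto
  qed
  obtain R0 where R0: "R = add_mset m R0" using m by (metis mset_add)
  have R0n: "n = size R0" "monotone_matching R0"
    using Suc.hyps(2) Suc.prems(1) by (auto simp: R0 monotone_matching_def)
  show ?case
  proof (cases "m \<in># R'")
    case True
    then obtain R1 where R1: "R' = add_mset m R1" by (metis mset_add)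
    have "arc_weight R1 \<le> arc_weight R0 \<and> (arc_weight R1 = arc_weight R0 \<longrightarrow> R1 = R0)"
      using Suc.prems R0n by (intro Suc.hyps(1)) (auto simp: R0 R1)
    then show ?thesis by (auto simp: R0 R1)
  next
    case False
    have "fst m \<in># image_mset fst R'" "snd m \<in># image_mset snd R'"
      unfolding Suc.prems(2,3) using m by auto
    then obtain x y where x: "x \<in># R'" "fst x = fst m" and y: "y \<in># R'" "snd y = snd m"
      by auto
    have lt: "snd x < snd m" "fst y < fst m"
      using snd_R'[OF x(1)] fst_R'[OF y(1)] x y False
      by (auto simp: le_less prod_eq_iff) (metis prod.collapse)+
    then have "x \<noteq> y" using y by auto
    then obtain R1 where R1: "R' = add_mset x (add_mset y R1)"
      using x(1) y(1) by (metis insert_noteq_member mset_add)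
    let ?z = "(fst y, snd x)"
    have "arc_weight (add_mset ?z R1) \<le> arc_weight R0"
    proof -
      have "arc_weight (add_mset ?z R1) \<le> arc_weight R0 \<and>
          (arc_weight (add_mset ?z R1) = arc_weight R0 \<longrightarrow> add_mset ?z R1 = R0)"
        using Suc.prems R0n x y
        by (intro Suc.hyps(1)) (auto simp: R0 R1 add_mset_commute)
      then show ?thesis ..
    qed
    moreover have "fst m * snd x + fst y * snd m < fst m * snd m + fst y * snd x"
    proof -
      obtain d e where "snd m = snd x + Suc d" "fst m = fst y + Suc e"
        using lt less_iff_Suc_add by (metis add_Suc_right)
      then show ?thesis by (simp add: algebra_simps)
    qed
    ultimately show ?thesis using x y by (simp add: R0 R1)
  qed
qed

text \<open>
  The mirror image: a matching that reverses the order is the lightest one.  Replacing \<open>y\<close> by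
  \<open>B - y\<close> for a large constant \<open>B\<close> turns it into a monotone one.
\<close>

lemma antitone_rearrangement:
  fixes u y :: "'s \<Rightarrow> nat"
  assumes S: "finite S" and u: "inj_on u S"
    and anti: "\<And>s t. s \<in> S \<Longrightarrow> t \<in> S \<Longrightarrow> u s < u t \<Longrightarrow> y t \<le> y s"
    and \<sigma>: "\<sigma> permutes S"
  shows "(\<Sum>s\<in>S. u s * y s) \<le> (\<Sum>s\<in>S. u (\<sigma> s) * y s)"
    and "(\<Sum>s\<in>S. u s * y s) = (\<Sum>s\<in>S. u (\<sigma> s) * y s) \<Longrightarrow> s \<in> S \<Longrightarrow> y (\<sigma> s) = y s"
proof -
  define B where "B = (\<Sum>s\<in>S. y s)"
  have B: "y s \<le> B" if "s \<in> S" for s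
    unfolding B_def by (rule member_le_sum) (use that S in auto)
  define R where "R = image_mset (\<lambda>s. (u s, B - y s)) (mset_set S)"
  define R' where "R' = image_mset (\<lambda>s. (u (\<sigma> s), B - y s)) (mset_set S)"
  have perm: "image_mset (\<lambda>s. f (\<sigma> s)) (mset_set S) = image_mset f (mset_set S)" for f :: "'s \<Rightarrow> 'c"
    using permutes_image_mset[OF \<sigma>] multiset.map_comp[of f \<sigma> "mset_set S"] by (simp add: comp_def)
  have mono: "monotone_matching R"
  proof -
    have "u s \<le> u t \<and> B - y s \<le> B - y t \<or> u t \<le> u s \<and> B - y t \<le> B - y s"
      if "s \<in> S" "t \<in> S" for s t
    proof (cases "u s = u t")
      case True
      then show ?thesis using that u by (auto dest: inj_onD)
    next
      case False
      then show ?thesis using anti[of s t] anti[of t s] that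
        by (metis diff_le_mono2 le_less linorder_neqE_nat)
    qed
    then show ?thesis using S by (auto simp: monotone_matching_def R_def)
  qed
  have w: "arc_weight (image_mset (\<lambda>s. (v s, B - y s)) (mset_set S)) + (\<Sum>s\<in>S. v s * y s)
      = B * (\<Sum>s\<in>S. v s)" for v :: "'s \<Rightarrow> nat"
  proof -
    have "arc_weight (image_mset (\<lambda>s. (v s, B - y s)) (mset_set S)) = (\<Sum>s\<in>S. v s * (B - y s))"
      by (simp add: arc_weight_def sum_unfold_sum_mset multiset.map_comp comp_def)
    moreover have "(\<Sum>s\<in>S. v s * (B - y s)) + (\<Sum>s\<in>S. v s * y s) = (\<Sum>s\<in>S. v s * B)"
      using B by (simp flip: sum.distrib add_mult_distrib2)
    ultimately show ?thesis by (simp add: sum_distrib_left mult.commute)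
  qed
  have sums: "(\<Sum>s\<in>S. u (\<sigma> s)) = (\<Sum>s\<in>S. u s)"
    using sum.permute[OF \<sigma>, of u] by (simp add: comp_def)
  have ra: "arc_weight R' \<le> arc_weight R \<and> (arc_weight R' = arc_weight R \<longrightarrow> R' = R)"
    by (rule rearrangement[OF mono])
      (simp_all add: R_def R'_def multiset.map_comp comp_def perm)
  show "(\<Sum>s\<in>S. u s * y s) \<le> (\<Sum>s\<in>S. u (\<sigma> s) * y s)"
    using ra w[of u] w[of "\<lambda>s. u (\<sigma> s)"] sums by (simp add: R_def R'_def)
  assume eq: "(\<Sum>s\<in>S. u s * y s) = (\<Sum>s\<in>S. u (\<sigma> s) * y s)" and s: "s \<in> S"
  have "R' = R" using ra w[of u] w[of "\<lambda>s. u (\<sigma> s)"] sums eq by (simp add: R_def R'_def)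
  then have "(u (\<sigma> s), B - y s) \<in># R" using s S by (auto simp: R'_def)
  then obtain t where t: "t \<in> S" "u (\<sigma> s) = u t" "B - y s = B - y t" using S by (auto simp: R_def)
  then have "\<sigma> s = t" using u s \<sigma> by (metis inj_onD permutes_in_image)
  then show "y (\<sigma> s) = y s" using t B[OF s] B[OF t(1)] by auto
qed

type_synonym coords = "coord_index \<Rightarrow> complex"

section \<open>Brackets and antisymmetrization\<close>

definition pairing :: "nat \<Rightarrow> nat \<Rightarrow> nat \<Rightarrow> coords \<Rightarrow> complex" where
  "pairing k i j a = (\<Sum>r<k. a (Inl (i, r)) * a (Inr (j, r)))"

text \<open>
  The column selection \<open>u\<close> is an arbitrary function, because exchange relations produce unsorted
  and repeated columns; a hyperedge \<open>I\<close> is the case \<open>u = (!) I\<close>.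
\<close>

definition bracket :: "nat \<Rightarrow> (nat \<Rightarrow> nat) \<Rightarrow> coords \<Rightarrow> complex" where
  "bracket k u a = Determinant.det (mat k k (\<lambda>(r, c). a (Inl (u c, r))))"

lemma bracket_leibniz:
  "bracket k u a = (\<Sum>\<pi> | \<pi> permutes {..<k}. of_int (sign \<pi>) * (\<Prod>c<k. a (Inl (u c, \<pi> c))))"
proof -
  have "bracket k u a = (\<Sum>\<pi> | \<pi> permutes {0..<k}. of_int (sign \<pi>) *
      (\<Prod>c<k. mat k k (\<lambda>(r, c). a (Inl (u c, r))) $$ (\<pi> c, c)))"
    unfolding bracket_def by (rule det_col) simp
  also have "\<dots> = (\<Sum>\<pi> | \<pi> permutes {..<k}. of_int (sign \<pi>) * (\<Prod>c<k. a (Inl (u c, \<pi> c))))"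
    unfolding atLeast0LessThan
    by (intro sum.cong refl arg_cong2[of _ _ _ _ "(*)"] prod.cong)
      (auto simp: permutes_in_image lessThan_iff[symmetric] simp del: lessThan_iff)
  finally show ?thesis .
qed

lemma bracket_leibniz_rows:
  "bracket k u a = (\<Sum>\<pi> | \<pi> permutes {..<k}. of_int (sign \<pi>) * (\<Prod>r<k. a (Inl (u (\<pi> r), r))))"
proof -
  have "bracket k u a = (\<Sum>\<pi> | \<pi> permutes {0..<k}. of_int (sign \<pi>) *
      (\<Prod>r=0..<k. mat k k (\<lambda>(r, c). a (Inl (u c, r))) $$ (r, \<pi> r)))"
    unfolding bracket_def by (rule det_def') simp
  also have "\<dots> = (\<Sum>\<pi> | \<pi> permutes {..<k}. of_int (sign \<pi>) * (\<Prod>r<k. a (Inl (u (\<pi> r), r))))"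
    unfolding atLeast0LessThan
    by (intro sum.cong refl arg_cong2[of _ _ _ _ "(*)"] prod.cong)
      (auto simp: permutes_in_image lessThan_iff[symmetric] simp del: lessThan_iff)
  finally show ?thesis .
qed

lemma bracket_cong: "(\<And>c. c < k \<Longrightarrow> u c = v c) \<Longrightarrow> bracket k u a = bracket k v a"
  unfolding bracket_leibniz by (intro sum.cong arg_cong2[of _ _ _ _ "(*)"] prod.cong) auto

lemma bracket_permute:
  assumes "\<tau> permutes {..<k}"
  shows "bracket k (u \<circ> \<tau>) a = of_int (sign \<tau>) * bracket k u a"
proof -
  let ?g = "\<lambda>\<pi>. of_int (sign \<pi>) * (\<Prod>r<k. a (Inl (u (\<pi> r), r))) :: complex"
  have "bracket k u a = (\<Sum>\<pi> | \<pi> permutes {..<k}. ?g (\<tau> \<circ> \<pi>))"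
    unfolding bracket_leibniz_rows by (rule setum_permutations_compose_left[OF assms])
  also have "\<dots> = (\<Sum>\<pi> | \<pi> permutes {..<k}. of_int (sign \<tau>) * (of_int (sign \<pi>) *
      (\<Prod>r<k. a (Inl ((u \<circ> \<tau>) (\<pi> r), r)))))"
    by (rule sum.cong[OF refl])
      (use assms in \<open>auto simp: sign_compose permutes_imp_permutation[OF finite_lessThan]\<close>)
  also have "\<dots> = of_int (sign \<tau>) * bracket k (u \<circ> \<tau>) a"
    unfolding bracket_leibniz_rows by (simp add: sum_distrib_left)
  finally show ?thesis
    by (metis (no_types, lifting) mult.assoc mult.left_neutral of_int_1 of_int_mult sign_idempotent)
qed

lemma bracket_repeated:
  assumes "\<not> inj_on u {..<k}"
  shows "bracket k u a = 0"
proof -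
  obtain c d where cd: "c < k" "d < k" "c \<noteq> d" "u c = u d"
    using assms by (auto simp: inj_on_def)
  have "u \<circ> transpose c d = u" using cd by (auto simp: fun_eq_iff transpose_def)
  then have "bracket k u a = - bracket k u a"
    using bracket_permute[OF permutes_swap_id[of c "{..<k}" d], of u a] cd by (simp add: sign_swap_id)
  then show ?thesis by simp
qed

lemma bracket_sort:
  assumes "u ` {..<k} \<subseteq> {1..p}"
  shows "(\<forall>a. bracket k u a = 0) \<or> (\<exists>L\<in>hyperedges p k. sum_list L = (\<Sum>c<k. u c) \<and>
    (\<exists>\<epsilon>. \<forall>a. bracket k u a = \<epsilon> * bracket k ((!) L) a))"
proof (cases "inj_on u {..<k}")
  case False
  then show ?thesis using bracket_repeated by blast
next
  case True
  define L where "L = sorted_list_of_set (u ` {..<k})"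
  have L: "length L = k" "set L = u ` {..<k}" "sorted_wrt (<) L"
    using True by (simp_all add: L_def card_image)
  have m: "mset (map u [0..<k]) = mset L"
    using True L by (metis (no_types, lifting) L_def atLeast0LessThan distinct_map distinct_sorted_list_of_set
        distinct_upt image_set mset_set_set set_upt)
  then obtain \<tau> where \<tau>: "\<tau> permutes {..<length L}" "permute_list \<tau> L = map u [0..<k]"
    by (metis mset_eq_permutation)
  have "bracket k u a = bracket k ((!) L \<circ> \<tau>) a" for a
  proof (rule bracket_cong)
    fix c assume "c < k"
    then show "u c = ((!) L \<circ> \<tau>) c"
      using permute_list_nth[OF \<tau>(1), of c] L(1) by (simp add: \<tau>(2))
  qed
  then have "bracket k u a = of_int (sign \<tau>) * bracket k ((!) L) a" for a
    using bracket_permute[of \<tau> k] \<tau>(1) L(1) by simp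
  moreover have "L \<in> hyperedges p k" using L assms by (auto simp: hyperedges_def)
  moreover have "sum_list L = (\<Sum>c<k. u c)"
  proof -
    have "sum_list L = sum_list (map u [0..<k])" using m by (metis sum_mset_sum_list)
    then show ?thesis by (simp add: interv_sum_list_conv_sum_set_nat atLeast0LessThan)
  qed
  ultimately show ?thesis by metis
qed

text \<open>
  More than \<open>k\<close> vectors in a \<open>k\<close>-dimensional space: after expanding the product, every choice \<open>\<rho>\<close>
  of coordinates uses some coordinate in two places, and transposing these two places cancels
  the terms in pairs.
\<close>

lemma antisymmetrization_vanishes:
  fixes x w :: "nat \<Rightarrow> nat \<Rightarrow> complex"
  assumes S: "finite S" and card: "k < card S"
  shows "(\<Sum>\<sigma> | \<sigma> permutes S. of_int (sign \<sigma>) * (\<Prod>s\<in>S. \<Sum>r<k. x (\<sigma> s) r * w s r)) = 0"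
proof -
  have "(\<Sum>\<sigma> | \<sigma> permutes S. of_int (sign \<sigma>) * (\<Prod>s\<in>S. \<Sum>r<k. x (\<sigma> s) r * w s r)) =
    (\<Sum>\<sigma> | \<sigma> permutes S. \<Sum>\<rho>\<in>S \<rightarrow>\<^sub>E {..<k}. of_int (sign \<sigma>) * (\<Prod>s\<in>S. x (\<sigma> s) (\<rho> s) * w s (\<rho> s)))"
    using S by (simp add: prod_sum_PiE sum_distrib_left)
  also have "\<dots> = (\<Sum>\<rho>\<in>S \<rightarrow>\<^sub>E {..<k}. \<Sum>\<sigma> | \<sigma> permutes S.
      of_int (sign \<sigma>) * (\<Prod>s\<in>S. x (\<sigma> s) (\<rho> s) * w s (\<rho> s)))"
    by (rule sum.swap)
  also have "\<dots> = 0"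
  proof (rule sum.neutral, rule ballI)
    fix \<rho> assume "\<rho> \<in> S \<rightarrow>\<^sub>E {..<k}"
    then have "\<not> inj_on \<rho> S"
      using card card_inj_on_le[of \<rho> S "{..<k}"] by (auto simp: PiE_def)
    then obtain c d where cd: "c \<in> S" "d \<in> S" "c \<noteq> d" "\<rho> c = \<rho> d" by (auto simp: inj_on_def)
    define T where "T = transpose c d"
    have T: "T permutes S" unfolding T_def using cd by (simp add: permutes_swap_id)
    have \<rho>T: "\<rho> (T s) = \<rho> s" for s using cd by (auto simp: T_def transpose_def)
    let ?g = "\<lambda>\<sigma>. of_int (sign \<sigma>) * (\<Prod>s\<in>S. x (\<sigma> s) (\<rho> s)) :: complex"
    have "sum ?g {\<sigma>. \<sigma> permutes S} = (\<Sum>\<sigma> | \<sigma> permutes S. ?g (\<sigma> \<circ> T))"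
      by (rule sum_permutations_compose_right[OF T])
    also have "\<dots> = (\<Sum>\<sigma> | \<sigma> permutes S. - ?g \<sigma>)"
    proof (rule sum.cong[OF refl])
      fix \<sigma> assume "\<sigma> \<in> {\<sigma>. \<sigma> permutes S}"
      then have "sign (\<sigma> \<circ> T) = - sign \<sigma>"
        using T S cd by (simp add: sign_compose permutes_imp_permutation T_def sign_swap_id)
      moreover have "(\<Prod>s\<in>S. x ((\<sigma> \<circ> T) s) (\<rho> s)) = (\<Prod>s\<in>S. x (\<sigma> s) (\<rho> s))"
        using prod.permute[OF T, of "\<lambda>s. x (\<sigma> s) (\<rho> s)"] by (simp add: comp_def \<rho>T)
      ultimately show "?g (\<sigma> \<circ> T) = - ?g \<sigma>" by simp
    qed
    finally have "sum ?g {\<sigma>. \<sigma> permutes S} = 0" by (simp add: sum_negf)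
    then show "(\<Sum>\<sigma> | \<sigma> permutes S. of_int (sign \<sigma>) * (\<Prod>s\<in>S. x (\<sigma> s) (\<rho> s) * w s (\<rho> s))) = 0"
      by (simp add: prod.distrib mult.assoc[symmetric] flip: sum_distrib_right)
  qed
  finally show ?thesis .
qed

text \<open>
  The exchange relation behind all straightening steps.  There are \<open>k + t + 1\<close> slots: the slots below
  \<open>k\<close> are the columns of a bracket, and the slots \<open>k, \<dots>, k + t\<close> are covectors that are paired with
  arbitrary vectors \<open>W s\<close>.  Antisymmetrizing over the \<open>k + 1\<close> slots \<open>t, \<dots>, k + t\<close> gives zero.
\<close>

lemma bracket_exchange:
  fixes W :: "nat \<Rightarrow> nat \<Rightarrow> complex"
  assumes t: "t < k"
  shows "(\<Sum>\<sigma> | \<sigma> permutes {t..k + t}. of_int (sign \<sigma>) * (bracket k (u \<circ> \<sigma>) a *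
    (\<Prod>s\<le>t. \<Sum>r<k. a (Inl (u (\<sigma> (k + s)), r)) * W s r))) = 0"
proof -
  let ?S = "{t..k + t}"
  \<comment> \<open>The Leibniz expansion of the bracket pairs the covector in column \<open>c\<close> with the unit vector
     \<open>\<pi> c\<close>, so each of its terms is an instance of the antisymmetrization lemma.\<close>
  define w where "w \<pi> s r = (if s < k then (if r = \<pi> s then 1 else 0) else W (s - k) r)"
    for \<pi> :: "nat \<Rightarrow> nat" and s r
  have *: "bracket k (u \<circ> \<sigma>) a * (\<Prod>s\<le>t. \<Sum>r<k. a (Inl (u (\<sigma> (k + s)), r)) * W s r) =
      (\<Sum>\<pi> | \<pi> permutes {..<k}. of_int (sign \<pi>) * (\<Prod>c<t. a (Inl (u c, \<pi> c))) *
        (\<Prod>s\<in>?S. \<Sum>r<k. a (Inl (u (\<sigma> s), r)) * w \<pi> s r))" if \<sigma>: "\<sigma> permutes ?S" for \<sigma>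
    unfolding bracket_leibniz sum_distrib_right
  proof (rule sum.cong[OF refl])
    fix \<pi> assume \<pi>: "\<pi> \<in> {\<pi>. \<pi> permutes {..<k}}"
    have S: "?S = {t..<k} \<union> (\<lambda>s. k + s) ` {..t}" 
    proof (intro Set.set_eqI iffI)
      fix x assume "x \<in> ?S"
      then show "x \<in> {t..<k} \<union> (\<lambda>s. k + s) ` {..t}"
        by (cases "x < k") (auto intro!: image_eqI[of x _ "x - k"])
    qed (use t in auto)
    have "(\<Prod>s\<in>?S. \<Sum>r<k. a (Inl (u (\<sigma> s), r)) * w \<pi> s r) =
      (\<Prod>s\<in>{t..<k}. \<Sum>r<k. a (Inl (u (\<sigma> s), r)) * w \<pi> s r) *
      (\<Prod>s\<in>(\<lambda>s. k + s) ` {..t}. \<Sum>r<k. a (Inl (u (\<sigma> s), r)) * w \<pi> s r)"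
      unfolding S by (rule prod.union_disjoint) auto
    also have "(\<Prod>s\<in>(\<lambda>s. k + s) ` {..t}. \<Sum>r<k. a (Inl (u (\<sigma> s), r)) * w \<pi> s r) =
      (\<Prod>s\<le>t. \<Sum>r<k. a (Inl (u (\<sigma> (k + s)), r)) * W s r)"
      by (subst prod.reindex) (auto simp: w_def)
    also have "(\<Prod>s\<in>{t..<k}. \<Sum>r<k. a (Inl (u (\<sigma> s), r)) * w \<pi> s r) =
        (\<Prod>c\<in>{t..<k}. a (Inl ((u \<circ> \<sigma>) c, \<pi> c)))"
    proof (rule prod.cong[OF refl])
      fix c assume c: "c \<in> {t..<k}"
      have "\<pi> c < k" using \<pi> permutes_in_image[of \<pi> "{..<k}" c] c by simp
      have "(\<Sum>r<k. a (Inl (u (\<sigma> c), r)) * w \<pi> c r) =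
          (\<Sum>r<k. if r = \<pi> c then a (Inl (u (\<sigma> c), r)) else 0)"
        by (rule sum.cong) (use c in \<open>auto simp: w_def\<close>)
      then show "(\<Sum>r<k. a (Inl (u (\<sigma> c), r)) * w \<pi> c r) = a (Inl ((u \<circ> \<sigma>) c, \<pi> c))"
        using \<open>\<pi> c < k\<close> by simp
    qed
    finally have e: "(\<Prod>s\<in>?S. \<Sum>r<k. a (Inl (u (\<sigma> s), r)) * w \<pi> s r) =
        (\<Prod>c\<in>{t..<k}. a (Inl ((u \<circ> \<sigma>) c, \<pi> c))) *
        (\<Prod>s\<le>t. \<Sum>r<k. a (Inl (u (\<sigma> (k + s)), r)) * W s r)" .
    have "(\<Prod>c<k. a (Inl ((u \<circ> \<sigma>) c, \<pi> c))) =
        (\<Prod>c<t. a (Inl ((u \<circ> \<sigma>) c, \<pi> c))) * (\<Prod>c\<in>{t..<k}. a (Inl ((u \<circ> \<sigma>) c, \<pi> c)))"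
      using t prod.atLeastLessThan_concat[of 0 t k "\<lambda>c. a (Inl ((u \<circ> \<sigma>) c, \<pi> c))"]
      by (simp add: atLeast0LessThan)
    also have "(\<Prod>c<t. a (Inl ((u \<circ> \<sigma>) c, \<pi> c))) = (\<Prod>c<t. a (Inl (u c, \<pi> c)))"
      using \<sigma> by (intro prod.cong) (auto simp: permutes_not_in)
    finally show "of_int (sign \<pi>) * (\<Prod>c<k. a (Inl ((u \<circ> \<sigma>) c, \<pi> c))) *
        (\<Prod>s\<le>t. \<Sum>r<k. a (Inl (u (\<sigma> (k + s)), r)) * W s r) =
        of_int (sign \<pi>) * (\<Prod>c<t. a (Inl (u c, \<pi> c))) *
        (\<Prod>s\<in>?S. \<Sum>r<k. a (Inl (u (\<sigma> s), r)) * w \<pi> s r)"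
      unfolding e by simp
  qed
  then have "(\<Sum>\<sigma> | \<sigma> permutes ?S. of_int (sign \<sigma>) * (bracket k (u \<circ> \<sigma>) a *
    (\<Prod>s\<le>t. \<Sum>r<k. a (Inl (u (\<sigma> (k + s)), r)) * W s r))) =
    (\<Sum>\<sigma> | \<sigma> permutes ?S. \<Sum>\<pi> | \<pi> permutes {..<k}. of_int (sign \<pi>) * (\<Prod>c<t. a (Inl (u c, \<pi> c))) *
        (of_int (sign \<sigma>) * (\<Prod>s\<in>?S. \<Sum>r<k. a (Inl (u (\<sigma> s), r)) * w \<pi> s r)))"
  proof (intro sum.cong refl)
    fix \<sigma> assume "\<sigma> \<in> {\<sigma>. \<sigma> permutes ?S}"
    with * have "bracket k (u \<circ> \<sigma>) a * (\<Prod>s\<le>t. \<Sum>r<k. a (Inl (u (\<sigma> (k + s)), r)) * W s r) =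
      (\<Sum>\<pi> | \<pi> permutes {..<k}. of_int (sign \<pi>) * (\<Prod>c<t. a (Inl (u c, \<pi> c))) *
        (\<Prod>s\<in>?S. \<Sum>r<k. a (Inl (u (\<sigma> s), r)) * w \<pi> s r))" by simp
    then show "of_int (sign \<sigma>) * (bracket k (u \<circ> \<sigma>) a *
        (\<Prod>s\<le>t. \<Sum>r<k. a (Inl (u (\<sigma> (k + s)), r)) * W s r)) =
      (\<Sum>\<pi> | \<pi> permutes {..<k}. of_int (sign \<pi>) * (\<Prod>c<t. a (Inl (u c, \<pi> c))) *
        (of_int (sign \<sigma>) * (\<Prod>s\<in>?S. \<Sum>r<k. a (Inl (u (\<sigma> s), r)) * w \<pi> s r)))"
      by (simp only: sum_distrib_left mult.left_commute)
  qed
  also have "\<dots> = (\<Sum>\<pi> | \<pi> permutes {..<k}. of_int (sign \<pi>) * (\<Prod>c<t. a (Inl (u c, \<pi> c))) *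
      (\<Sum>\<sigma> | \<sigma> permutes ?S. of_int (sign \<sigma>) * (\<Prod>s\<in>?S. \<Sum>r<k. a (Inl (u (\<sigma> s), r)) * w \<pi> s r)))"
    unfolding sum_distrib_left by (rule sum.swap)
  also have "\<dots> = 0"
    using antisymmetrization_vanishes[of ?S k "\<lambda>s r. a (Inl (u s, r))"] by simp
  finally show ?thesis .
qed

section \<open>Graphs and nested arcs\<close>

definition starred_fun :: "nat \<Rightarrow> arc multiset \<Rightarrow> nat list multiset \<Rightarrow> coords \<Rightarrow> complex" where
  "starred_fun k M E a = (\<Prod>(i, j)\<in>#M. pairing k i j a) * (\<Prod>I\<in>#E. bracket k ((!) I) a)"

lemma starred_fun_union: "starred_fun k (M + M') (E + E') a = starred_fun k M E a * starred_fun k M' E' a"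
  by (simp add: starred_fun_def)

definition starred_admissible :: "nat \<Rightarrow> nat \<Rightarrow> nat \<Rightarrow> arc multiset \<Rightarrow> nat list multiset \<Rightarrow> bool" where
  "starred_admissible k p q M E \<longleftrightarrow>
    arc_diagram p q M \<and> (\<forall>S. S \<subseteq> set_mset M \<and> strict_nesting S \<longrightarrow> card S \<le> k) \<and>
    set_mset E \<subseteq> hyperedges p k \<and> hyperedge_chain E \<and>
    (\<forall>T. topmost E T \<longrightarrow>
      (\<forall>l\<in>{1..k}. \<forall>(i, j)\<in>#nth_chain first_chain_starred l M. T ! (l - 1) \<le> i))"

definition admissible_span :: "nat \<Rightarrow> nat \<Rightarrow> nat \<Rightarrow> nat \<Rightarrow> nat \<Rightarrow> (coords \<Rightarrow> complex) set" where
  "admissible_span k p q n m = fun_space.span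
    {starred_fun k M E | M E. starred_admissible k p q M E \<and> size M = n \<and> size E = m}"

text \<open>
  Spreading two vertex sums apart while keeping their total increases the sum of squares; this measures
  the progress made by straightening two incomparable hyperedges.
\<close>

definition hyperedge_weight :: "nat list multiset \<Rightarrow> nat" where
  "hyperedge_weight E = (\<Sum>I\<in>#E. (sum_list I)\<^sup>2)"

definition heavier :: "nat \<Rightarrow> nat \<Rightarrow> nat \<Rightarrow> arc multiset \<Rightarrow> nat list multiset \<Rightarrow> (coords \<Rightarrow> complex) set" where
  "heavier k p q M E = {starred_fun k M' E' | M' E'.
     arc_diagram p q M' \<and> set_mset E' \<subseteq> hyperedges p k \<and> size M' = size M \<and> size E' = size E \<and>
     (arc_weight M < arc_weight M' \<or>
      arc_weight M = arc_weight M' \<and> hyperedge_weight E < hyperedge_weight E')}"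

text \<open>
  A linear relation in which the term of interest may occur several times, always with the same sign,
  while all other terms lie in a given span.
\<close>

lemma span_relation:
  fixes F :: "'i \<Rightarrow> 'w \<Rightarrow> complex"
  assumes A: "finite A" "i \<in> A" "\<And>a. c i * F i a = F0 a"
    and alt: "\<And>i. i \<in> A \<Longrightarrow> (\<forall>a. c i * F i a = F0 a) \<or> F i \<in> fun_space.span B"
    and rel: "\<And>a. (\<Sum>i\<in>A. c i * F i a) = 0"
  shows "F0 \<in> fun_space.span B"
proof -
  define A1 where "A1 = {i \<in> A. \<forall>a. c i * F i a = F0 a}"
  have A1: "finite A1" "i \<in> A1" "A1 \<subseteq> A" using A by (auto simp: A1_def)
  then have n: "card A1 > 0" by (auto simp: card_gt_0_iff)
  have "fun_scale (- 1 / of_nat (card A1)) (\<Sum>i\<in>A - A1. fun_scale (c i) (F i)) \<in> fun_space.span B"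
    by (intro fun_space.span_scale fun_space.span_sum) (use alt in \<open>auto simp: A1_def\<close>)
  also have "fun_scale (- 1 / of_nat (card A1)) (\<Sum>i\<in>A - A1. fun_scale (c i) (F i)) = F0"
  proof
    fix a
    have "0 = (\<Sum>i\<in>A1. c i * F i a) + (\<Sum>i\<in>A - A1. c i * F i a)"
      using rel[of a] sum.subset_diff[OF A1(3) A(1), of "\<lambda>i. c i * F i a"]
      by (simp add: add.commute)
    also have "(\<Sum>i\<in>A1. c i * F i a) = (\<Sum>i\<in>A1. F0 a)"
      by (rule sum.cong) (auto simp: A1_def)
    also have "\<dots> = of_nat (card A1) * F0 a" by simp
    finally have "(\<Sum>i\<in>A - A1. c i * F i a) = - of_nat (card A1) * F0 a"
      by (simp add: eq_neg_iff_add_eq_0 add.commute)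
    moreover have "(\<Sum>i\<in>A - A1. fun_scale (c i) (F i)) a = (\<Sum>i\<in>A - A1. c i * F i a)"
      by (induction rule: infinite_finite_induct) (auto simp: fun_scale_def)
    ultimately show "fun_scale (- 1 / of_nat (card A1)) (\<Sum>i\<in>A - A1. fun_scale (c i) (F i)) a = F0 a"
      using n by (simp add: fun_scale_def)
  qed
  finally show ?thesis .
qed

lemma diff_filter_mset: "M - filter_mset P M = filter_mset (\<lambda>x. \<not> P x) M"
  by (rule multiset_eqI) simp

lemma chain_rest_subset: "chain_rest C l M \<subseteq># M"
  by (induction l) (auto intro: subset_mset.order_trans[OF diff_subset_eq_self])

lemma not_in_first_chain:
  assumes "x \<in># M - first_chain_starred M"
  shows "x \<in># M" "\<exists>y\<in>#M. fst y < fst x \<and> snd y > snd x"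
proof -
  obtain i j where x: "x = (i, j)" by (cases x)
  have *: "x \<in># M \<and> (\<exists>(i', j')\<in>#M. i' < i \<and> j' > j)"
    using assms unfolding first_chain_starred_def diff_filter_mset by (simp add: x)
  then show "x \<in># M" ..
  obtain y where "y \<in># M" "fst y < i" "j < snd y" using * by auto
  then show "\<exists>y\<in>#M. fst y < fst x \<and> snd y > snd x" by (auto simp: x)
qed

text \<open>
  An arc survives a round of chain removal only because another surviving arc lies strictly outside
  it; following such witnesses outwards gives the nesting.
\<close>

lemma chain_rest_nesting:
  assumes "x \<in># chain_rest first_chain_starred l M"
  shows "\<exists>f. f l = x \<and> (\<forall>s\<le>l. f s \<in># M) \<and>
    (\<forall>s t. s < t \<and> t \<le> l \<longrightarrow> fst (f s) < fst (f t) \<and> snd (f t) < snd (f s))"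
  using assms
proof (induction l arbitrary: x)
  case 0
  then show ?case by (intro exI[of _ "\<lambda>_. x"]) auto
next
  case (Suc l)
  let ?R = "chain_rest first_chain_starred l M"
  have x: "x \<in># ?R" "\<exists>y\<in>#?R. fst y < fst x \<and> snd y > snd x"
    using Suc.prems not_in_first_chain[of x ?R] by simp_all
  then obtain y where y: "y \<in># ?R" "fst y < fst x" "snd y > snd x" by auto
  obtain f where f: "f l = y" "\<forall>s\<le>l. f s \<in># M"
    "\<forall>s t. s < t \<and> t \<le> l \<longrightarrow> fst (f s) < fst (f t) \<and> snd (f t) < snd (f s)"
    using Suc.IH[OF y(1)] by auto
  have le: "fst (f s) \<le> fst y \<and> snd y \<le> snd (f s)" if "s \<le> l" for s
    using f that by (metis le_less order_refl)
  have "x \<in># M" using x(1) chain_rest_subset mset_subset_eqD by metis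
  moreover have "fst ((f(Suc l := x)) s) < fst ((f(Suc l := x)) t) \<and>
      snd ((f(Suc l := x)) t) < snd ((f(Suc l := x)) s)" if "s < t" "t \<le> Suc l" for s t
  proof (cases "t = Suc l")
    case True
    then show ?thesis using that le[of s] y by fastforce
  next
    case False
    then show ?thesis using that f(3) by simp
  qed
  ultimately show ?case using f(2) by (intro exI[of _ "f(Suc l := x)"]) (simp add: le_Suc_eq)
qed

lemma nth_chain_nesting:
  assumes "x \<in># nth_chain first_chain_starred l M"
  shows "\<exists>f. f (l - 1) = x \<and> (\<forall>s\<le>l - 1. f s \<in># M) \<and>
    (\<forall>s t. s < t \<and> t \<le> l - 1 \<longrightarrow> fst (f s) < fst (f t) \<and> snd (f t) < snd (f s))"
  using assms by (intro chain_rest_nesting) (auto simp: nth_chain_def first_chain_starred_def)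

lemma strict_nestingD:
  assumes "strict_nesting S" "x \<in> S" "y \<in> S" "fst x < fst y \<or> x \<noteq> y \<and> fst x \<le> fst y"
  shows "fst x < fst y \<and> snd y < snd x"
  using assms unfolding strict_nesting_def by (cases x; cases y) fastforce

lemma strict_nesting_enumeration:
  assumes "strict_nesting S" "card S > k"
  shows "\<exists>f. (\<forall>s\<le>k. f s \<in> S) \<and>
    (\<forall>s t. s < t \<and> t \<le> k \<longrightarrow> fst (f s) < fst (f t) \<and> snd (f t) < snd (f s))"
proof -
  have fin: "finite S" using assms(2) by (intro card_ge_0_finite) simp
  have inj: "inj_on fst S"
  proof (rule inj_onI, rule ccontr)
    fix x y assume "x \<in> S" "y \<in> S" "fst x = fst y" "x \<noteq> y"
    then show False using strict_nestingD[OF assms(1), of x y] by auto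
  qed
  define L where "L = sorted_list_of_set (fst ` S)"
  have L: "length L = card S" "set L = fst ` S" "sorted_wrt (<) L"
    using fin by (simp_all add: L_def card_image[OF inj])
  define f where "f s = inv_into S fst (L ! s)" for s
  have Ls: "L ! s \<in> fst ` S" if "s \<le> k" for s
    using L(1) assms(2) that nth_mem[of s L] by (simp add: L(2))
  have f: "f s \<in> S" "fst (f s) = L ! s" if "s \<le> k" for s
    unfolding f_def using Ls[OF that] by (rule inv_into_into, rule f_inv_into_f)
  have "fst (f s) < fst (f t) \<and> snd (f t) < snd (f s)" if "s < t" "t \<le> k" for s t
  proof -
    have "fst (f s) < fst (f t)"
      using that f L assms(2) by (simp add: sorted_wrt_nth_less)
    then show ?thesis using strict_nestingD[OF assms(1) f(1)[of s] f(1)[of t]] that by simp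
  qed
  then show ?thesis using f(1) by (intro exI[of _ f]) auto
qed

lemma nesting_multiset:
  fixes f :: "nat \<Rightarrow> arc"
  assumes "\<forall>s\<le>t. f s \<in># M"
    and "\<forall>s s'. s < s' \<and> s' \<le> t \<longrightarrow> fst (f s) < fst (f s') \<and> snd (f s') < snd (f s)"
  shows "\<exists>M0. M = M0 + image_mset f (mset_set {..t})"
proof -
  have inj: "inj_on f {..t}"
  proof (rule inj_onI, rule ccontr)
    fix s s' assume "s \<in> {..t}" "s' \<in> {..t}" "f s = f s'" "s \<noteq> s'"
    then show False using assms(2)[rule_format, of s s'] assms(2)[rule_format, of s' s]
      by (cases s s' rule: linorder_cases) auto
  qed
  have "image_mset f (mset_set {..t}) = mset_set (f ` {..t})"
    by (rule image_mset_mset_set[OF inj])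
  also have "\<dots> \<subseteq># M"
  proof -
    have "mset_set (f ` {..t}) \<subseteq># mset_set (set_mset M)"
      using assms(1) by (intro subset_imp_msubset_mset_set) auto
    then show ?thesis
      using mset_set_set_mset_msubset[of M] by (rule subset_mset.order_trans)
  qed
  finally show ?thesis by (metis subset_mset.le_iff_add add.commute)
qed

lemma arc_weight_image:
  "finite A \<Longrightarrow> arc_weight (image_mset (\<lambda>s. (u s, y s)) (mset_set A)) = (\<Sum>s\<in>A. u s * y s)"
  by (simp add: arc_weight_def sum_unfold_sum_mset multiset.map_comp comp_def)

lemma starred_fun_image:
  "finite A \<Longrightarrow> starred_fun k (image_mset (\<lambda>s. (u s, y s)) (mset_set A)) {#} a
    = (\<Prod>s\<in>A. pairing k (u s) (y s) a)"
  by (simp add: starred_fun_def prod_unfold_prod_mset multiset.map_comp comp_def)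

section \<open>Straightening\<close>

text \<open>
  The nested arcs match their end points in the reverse order, so all other terms of the
  antisymmetrization over their \<open>k + 1\<close> covectors are strictly heavier.
\<close>

lemma straighten_nesting:
  assumes M: "arc_diagram p q M" and E: "set_mset E \<subseteq> hyperedges p k"
    and f: "\<forall>s\<le>k. f s \<in># M"
      "\<forall>s t. s < t \<and> t \<le> k \<longrightarrow> fst (f s) < fst (f t) \<and> snd (f t) < snd (f s)"
  shows "starred_fun k M E \<in> fun_space.span (heavier k p q M E)"
proof -
  obtain M0 where M0: "M = M0 + image_mset f (mset_set {..k})"
    using nesting_multiset[OF f] by auto
  define N where "N \<sigma> = image_mset (\<lambda>s. (fst (f (\<sigma> s)), snd (f s))) (mset_set {..k})" for \<sigma>
  have M_id: "M = M0 + N id" by (simp add: M0 N_def)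
  have inj: "inj_on (\<lambda>s. fst (f s)) {..k}"
  proof (rule inj_onI)
    fix s t assume "s \<in> {..k}" "t \<in> {..k}" "fst (f s) = fst (f t)"
    then show "s = t" using f(2)[rule_format, of s t] f(2)[rule_format, of t s]
      by (cases s t rule: linorder_cases) auto
  qed
  have inj': "inj_on (\<lambda>s. snd (f s)) {..k}"
  proof (rule inj_onI)
    fix s t assume "s \<in> {..k}" "t \<in> {..k}" "snd (f s) = snd (f t)"
    then show "s = t" using f(2)[rule_format, of s t] f(2)[rule_format, of t s]
      by (cases s t rule: linorder_cases) auto
  qed
  show ?thesis
  proof (rule span_relation[where A = "{\<sigma>. \<sigma> permutes {..k}}" and i = id
        and c = "\<lambda>\<sigma>. of_int (sign \<sigma>)" and F = "\<lambda>\<sigma>. starred_fun k (M0 + N \<sigma>) E"])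
    show "of_int (sign id) * starred_fun k (M0 + N id) E a = starred_fun k M E a" for a
      by (simp add: M_id)
  next
    fix \<sigma> assume \<sigma>: "\<sigma> \<in> {\<sigma>. \<sigma> permutes {..k}}"
    show "(\<forall>a. of_int (sign \<sigma>) * starred_fun k (M0 + N \<sigma>) E a = starred_fun k M E a) \<or>
        starred_fun k (M0 + N \<sigma>) E \<in> fun_space.span (heavier k p q M E)"
    proof (cases "\<sigma> = id")
      case True
      then show ?thesis by (simp add: M_id)
    next
      case False
      have anti: "snd (f t) \<le> snd (f s)" if "s \<in> {..k}" "t \<in> {..k}" "fst (f s) < fst (f t)" for s t
      proof (cases "s < t")
        case True
        then show ?thesis using f(2) that by (simp add: less_imp_le)
      next
        case False
        then have "t < s" using that by (metis less_irrefl linorder_neqE_nat)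
        then show ?thesis using f(2) that by (metis atMost_iff less_asym)
      qed
      note ar = antitone_rearrangement[of "{..k}" "\<lambda>s. fst (f s)" "\<lambda>s. snd (f s)" \<sigma>, OF _ inj anti]
      have "(\<Sum>s\<le>k. fst (f s) * snd (f s)) \<noteq> (\<Sum>s\<le>k. fst (f (\<sigma> s)) * snd (f s))"
      proof
        assume "(\<Sum>s\<le>k. fst (f s) * snd (f s)) = (\<Sum>s\<le>k. fst (f (\<sigma> s)) * snd (f s))"
        then have "snd (f (\<sigma> s)) = snd (f s)" if "s \<le> k" for s using ar(2) \<sigma> that by simp
        then have "\<sigma> s = s" if "s \<le> k" for s
          using inj' \<sigma> that permutes_in_image[of \<sigma> "{..k}" s] by (auto dest: inj_onD)
        then have "\<sigma> = id" using \<sigma> permutes_not_in[of \<sigma> "{..k}"] by (fastforce simp: fun_eq_iff)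
        then show False using False by simp
      qed
      then have less: "arc_weight M < arc_weight (M0 + N \<sigma>)"
        using ar(1) \<sigma> unfolding M_id N_def by (simp only: arc_weight_simps arc_weight_image id_apply finite_atMost) simp
      have "fst (f (\<sigma> s)) \<in> {1..p} \<and> snd (f s) \<in> {1..q}" if "s \<le> k" for s
      proof -
        have "\<sigma> s \<le> k" using \<sigma> that permutes_in_image[of \<sigma> "{..k}" s] by simp
        then have "f (\<sigma> s) \<in> {1..p} \<times> {1..q}" "f s \<in> {1..p} \<times> {1..q}"
          using f(1) M that unfolding arc_diagram_def by auto
        then show ?thesis by (auto simp: mem_Times_iff)
      qed
      then have "arc_diagram p q (M0 + N \<sigma>)" using M by (auto simp: arc_diagram_def M0 N_def)
      then have "starred_fun k (M0 + N \<sigma>) E \<in> heavier k p q M E"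
        using less E unfolding heavier_def by (intro CollectI exI[of _ "M0 + N \<sigma>"] exI[of _ E]) (auto simp: M_id N_def)
      then show ?thesis by (simp add: fun_space.span_base)
    qed
  next
    fix a
    have "starred_fun k (M0 + N \<sigma>) E a = (\<Prod>s\<le>k. \<Sum>r<k. a (Inl (fst (f (\<sigma> s)), r)) * a (Inr (snd (f s), r))) *
        starred_fun k M0 E a" for \<sigma>
      using starred_fun_union[of k M0 "N \<sigma>" E "{#}" a] by (simp add: N_def starred_fun_image pairing_def mult.commute)
    then have "(\<Sum>\<sigma> | \<sigma> permutes {..k}. of_int (sign \<sigma>) * starred_fun k (M0 + N \<sigma>) E a) =
      (\<Sum>\<sigma> | \<sigma> permutes {..k}. of_int (sign \<sigma>) *
        (\<Prod>s\<le>k. \<Sum>r<k. a (Inl (fst (f (\<sigma> s)), r)) * a (Inr (snd (f s), r)))) * starred_fun k M0 E a"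
      by (simp add: sum_distrib_right mult.assoc)
    then show "(\<Sum>\<sigma> | \<sigma> permutes {..k}. of_int (sign \<sigma>) * starred_fun k (M0 + N \<sigma>) E a) = 0"
      using antisymmetrization_vanishes[of "{..k}" k "\<lambda>s r. a (Inl (fst (f s), r))" "\<lambda>s r. a (Inr (snd (f s), r))"]
      by simp
  qed (auto simp: finite_permutations permutes_id)
qed

lemma bracket_permute_shifted:
  assumes \<sigma>: "\<sigma> permutes {k..k + t}" and t: "t < k"
  shows "bracket k (\<lambda>c. u (\<sigma> (k + c))) a = of_int (sign \<sigma>) * bracket k (\<lambda>c. u (k + c)) a"
  using finite_atLeastAtMost \<sigma>
proof (induction \<sigma> rule: permutes_rev_induct)
  case id
  then show ?case by simp
next
  case (swap b c \<sigma>)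
  have "permutation \<sigma>" using swap by (auto intro: permutes_imp_permutation)
  then have sgn: "sign (\<sigma> \<circ> transpose b c) = - sign \<sigma>"
    using swap by (simp add: sign_compose permutation_swap_id sign_swap_id)
  have "bracket k (\<lambda>d. u ((\<sigma> \<circ> transpose b c) (k + d))) a =
      bracket k ((\<lambda>d. u (\<sigma> (k + d))) \<circ> transpose (b - k) (c - k)) a"
    using swap by (intro bracket_cong) (auto simp: transpose_def)
  also have "\<dots> = - bracket k (\<lambda>d. u (\<sigma> (k + d))) a"
    using swap t by (subst bracket_permute) (auto simp: sign_swap_id intro!: permutes_swap_id)
  finally show ?case unfolding sgn swap by simp
qed

lemma permutes_split:
  assumes \<sigma>: "\<sigma> permutes A \<union> B" and "A \<inter> B = {}" and B: "\<And>s. s \<in> B \<Longrightarrow> \<sigma> s \<in> B" and fin: "finite A" "finite B"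
  shows "\<exists>\<sigma>1 \<sigma>2. \<sigma>1 permutes A \<and> \<sigma>2 permutes B \<and> \<sigma> = \<sigma>1 \<circ> \<sigma>2 \<and> sign \<sigma> = sign \<sigma>1 * sign \<sigma>2"
proof -
  define \<sigma>1 where "\<sigma>1 s = (if s \<in> A then \<sigma> s else s)" for s
  define \<sigma>2 where "\<sigma>2 s = (if s \<in> B then \<sigma> s else s)" for s
  have inj: "inj \<sigma>" using \<sigma> by (rule permutes_inj)
  have imB: "\<sigma> ` B = B" using B fin(2) inj by (intro endo_inj_surj) (auto intro: inj_on_subset)
  have A: "\<sigma> s \<in> A" if "s \<in> A" for s
  proof -
    have "\<sigma> s \<in> A \<union> B" using \<sigma> that permutes_in_image[OF \<sigma>, of s] by simp
    moreover have "\<sigma> s \<notin> B" using imB that assms(2) inj by (metis IntI empty_iff imageE injD)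
    ultimately show ?thesis by simp
  qed
  have 1: "\<sigma>1 permutes A"
    using A fin inj by (intro inj_imp_permutes) (auto simp: \<sigma>1_def inj_on_def dest: injD)
  have 2: "\<sigma>2 permutes B"
    using B fin inj by (intro inj_imp_permutes) (auto simp: \<sigma>2_def inj_on_def dest: injD)
  have c: "\<sigma> = \<sigma>1 \<circ> \<sigma>2"
  proof
    fix s show "\<sigma> s = (\<sigma>1 \<circ> \<sigma>2) s"
      using B[of s] assms(2) permutes_not_in[OF \<sigma>, of s] by (auto simp: \<sigma>1_def \<sigma>2_def)
  qed
  have "sign \<sigma> = sign \<sigma>1 * sign \<sigma>2"
    unfolding c using 1 2 fin by (intro sign_compose) (auto intro: permutes_imp_permutation)
  then show ?thesis using 1 2 c by blast
qed

lemma hyperedges_nth: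
  assumes "I \<in> hyperedges p k"
  shows "length I = k" "\<And>c. c < k \<Longrightarrow> I ! c \<in> {1..p}" "\<And>c d. c < d \<Longrightarrow> d < k \<Longrightarrow> I ! c < I ! d"
    "\<And>c d. c \<le> d \<Longrightarrow> d < k \<Longrightarrow> I ! c \<le> I ! d" "\<And>c. c < k \<Longrightarrow> Suc c \<le> I ! c"
proof -
  show len: "length I = k" using assms by (simp add: hyperedges_def)
  show rng: "\<And>c. c < k \<Longrightarrow> I ! c \<in> {1..p}" using assms nth_mem unfolding hyperedges_def by blast
  show less: "\<And>c d. c < d \<Longrightarrow> d < k \<Longrightarrow> I ! c < I ! d"
    using assms by (auto simp: hyperedges_def sorted_wrt_nth_less)
  show "\<And>c d. c \<le> d \<Longrightarrow> d < k \<Longrightarrow> I ! c \<le> I ! d" using less by (auto simp: le_less)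
  show "Suc c \<le> I ! c" if "c < k" for c
    using that
  proof (induction c)
    case 0
    then show ?case using rng[of 0] by auto
  next
    case (Suc c)
    then show ?case using less[of c "Suc c"] by auto
  qed
qed

lemma sum_list_nth: "length I = k \<Longrightarrow> sum_list I = (\<Sum>c<k. I ! c)"
  by (auto simp: sum_list_sum_nth atLeast0LessThan)

lemma starred_fun_add_bracket:
  "starred_fun k M (add_mset I E) a = bracket k ((!) I) a * starred_fun k M E a"
  by (simp add: starred_fun_def)

lemma exchange_slots: "t < k \<Longrightarrow> {t..k + t} = {t..<k} \<union> {k..k + t::nat}"
  by auto

lemma sum_exchange_slots:
  assumes "t < (k::nat)"
  shows "(\<Sum>s\<in>{t..k + t}. if s < k then 0 else g s) = (\<Sum>s\<le>t. g (k + s) :: nat)"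
proof -
  have "(\<Sum>s\<in>{t..k + t}. if s < k then 0 else g s) = (\<Sum>s\<in>{k..k + t}. g s)"
    using assms by (intro sum.mono_neutral_cong_right) auto
  also have "\<dots> = (\<Sum>s\<in>{0..t}. g (k + s))"
    using sum.shift_bounds_cl_nat_ivl[of g 0 k t] by (simp add: add.commute)
  finally show ?thesis by (simp add: atLeast0AtMost)
qed

text \<open>
  The covectors of the nested arcs \<open>f 0, \<dots>, f t\<close> come before the vertices of \<open>T\<close> from position \<open>t\<close> on,
  and together these are \<open>k + 1\<close> covectors.  Counting the columns of the bracket as matched with \<open>0\<close>,
  the slots are matched in reverse order.  A term of the same weight must therefore keep all
  arcs and only permute the columns, which reproduces the original function with sign \<open>+\<close>.
\<close>

lemma straighten_hyperedge_rule:
  assumes M: "arc_diagram p q M" and E: "set_mset E \<subseteq> hyperedges p k"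
    and T: "T \<in># E" and t: "t < k" and i: "fst (f t) < T ! t"
    and f: "\<forall>s\<le>t. f s \<in># M"
      "\<forall>s s'. s < s' \<and> s' \<le> t \<longrightarrow> fst (f s) < fst (f s') \<and> snd (f s') < snd (f s)"
  shows "starred_fun k M E \<in> fun_space.span (heavier k p q M E)"
proof -
  obtain M0 where M0: "M = M0 + image_mset f (mset_set {..t})"
    using nesting_multiset[OF f] by auto
  obtain E0 where E0: "E = add_mset T E0" using T by (metis mset_add)
  have TH: "T \<in> hyperedges p k" using T E by auto
  note Tn = hyperedges_nth[OF TH]
  define u where "u c = (if c < k then T ! c else fst (f (c - k)))" for c
  define y where "y c = (if c < k then 0 else snd (f (c - k)))" for c
  let ?S = "{t..k + t}"
  have fM: "f s \<in> {1..p} \<times> {1..q}" if "s \<le> t" for s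
    using f(1) M that unfolding arc_diagram_def by auto
  have u_arc: "u s \<le> fst (f t)" if "k \<le> s" "s \<le> k + t" for s
  proof (cases "s = k + t")
    case False
    then have "s - k < t" using that by simp
    then show ?thesis using f(2)[rule_format, of "s - k" t] that by (simp add: u_def)
  qed (simp add: u_def)
  have u_edge: "fst (f t) < u s" if "t \<le> s" "s < k" for s
    using i Tn(4)[of t s] that by (simp add: u_def)
  have u_range: "u s \<in> {1..p}" if "s \<le> k + t" for s
    using Tn(2) fM[of "s - k"] that by (auto simp: u_def mem_Times_iff)
  have inj: "inj_on u ?S"
  proof (rule inj_onI)
    fix s s' assume s: "s \<in> ?S" "s' \<in> ?S" "u s = u s'"
    consider "s < k" "s' < k" | "s < k" "k \<le> s'" | "k \<le> s" "s' < k" | "k \<le> s" "k \<le> s'" by linarith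
    then show "s = s'"
    proof cases
      case 1
      then show ?thesis using s Tn(3)[of s s'] Tn(3)[of s' s]
        by (cases s s' rule: linorder_cases) (auto simp: u_def)
    next
      case 2
      then show ?thesis using u_edge[of s] u_arc[of s'] s by simp
    next
      case 3
      then show ?thesis using u_edge[of s'] u_arc[of s] s by simp
    next
      case 4
      then obtain d e where "s = k + d" "s' = k + e" by (metis le_iff_add)
      then show ?thesis
        using s f(2)[rule_format, of d e] f(2)[rule_format, of e d]
        by (cases d e rule: linorder_cases) (auto simp: u_def)
    qed
  qed
  have anti: "y s' \<le> y s" if s: "s \<in> ?S" "s' \<in> ?S" "u s < u s'" for s s'
  proof -
    consider "s' < k" | "s < k" "k \<le> s'" | "k \<le> s" "k \<le> s'" by linarith
    then show ?thesis
    proof cases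
      case 1
      then show ?thesis by (simp add: y_def)
    next
      case 2
      then show ?thesis using u_edge[of s] u_arc[of s'] s by simp
    next
      case 3
      then obtain d e where "s = k + d" "s' = k + e" by (metis le_iff_add)
      then show ?thesis
        using s f(2)[rule_format, of d e] f(2)[rule_format, of e d]
        by (cases d e rule: linorder_cases) (auto simp: u_def y_def)
    qed
  qed
  define N where "N \<sigma> = image_mset (\<lambda>s. (u (\<sigma> (k + s)), snd (f s))) (mset_set {..t})" for \<sigma>
  have M_id: "M = M0 + N id" by (simp add: M0 N_def u_def)
  define F where "F \<sigma> a = bracket k (u \<circ> \<sigma>) a * starred_fun k (M0 + N \<sigma>) E0 a" for \<sigma> a
  have F_id: "F id a = starred_fun k M E a" for a
  proof -
    have "bracket k u a = bracket k ((!) T) a" by (rule bracket_cong) (simp add: u_def)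
    then show ?thesis by (simp add: F_def M_id E0 starred_fun_add_bracket)
  qed
  have weight: "(\<Sum>s\<in>?S. u (\<sigma> s) * y s) = arc_weight (N \<sigma>)" for \<sigma>
  proof -
    have "(\<Sum>s\<in>?S. u (\<sigma> s) * y s) = (\<Sum>s\<in>?S. if s < k then 0 else u (\<sigma> s) * y s)"
      by (rule sum.cong) (auto simp: y_def)
    then show ?thesis unfolding sum_exchange_slots[OF t] by (simp add: N_def arc_weight_image y_def)
  qed
  show ?thesis
  proof (rule span_relation[where A = "{\<sigma>. \<sigma> permutes ?S}" and i = id
        and c = "\<lambda>\<sigma>. of_int (sign \<sigma>)" and F = F])
    show "of_int (sign id) * F id a = starred_fun k M E a" for a by (simp add: F_id)
  next
    fix \<sigma> assume "\<sigma> \<in> {\<sigma>. \<sigma> permutes ?S}"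
    then have \<sigma>: "\<sigma> permutes ?S" by simp
    have \<sigma>S: "\<sigma> s \<le> k + t" if "s \<le> k + t" for s
      using permutes_in_image[OF \<sigma>, of s] permutes_not_in[OF \<sigma>, of s] that by (cases "s \<in> ?S") auto
    note ar = antitone_rearrangement[of ?S u y \<sigma>, OF _ inj anti \<sigma>]
    show "(\<forall>a. of_int (sign \<sigma>) * F \<sigma> a = starred_fun k M E a) \<or>
        F \<sigma> \<in> fun_space.span (heavier k p q M E)"
    proof (cases "(\<Sum>s\<in>?S. u s * y s) = (\<Sum>s\<in>?S. u (\<sigma> s) * y s)")
      case True
      have fixed: "\<sigma> (k + s) = k + s" if "s \<le> t" for s
      proof -
        have ys: "y (\<sigma> (k + s)) = snd (f s)" using ar(2)[of "k + s"] True that t by (auto simp: y_def)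
        then have "k \<le> \<sigma> (k + s)" using fM[OF that] by (auto simp: y_def mem_Times_iff split: if_splits)
        moreover have "\<sigma> (k + s) \<le> k + t" using \<sigma>S[of "k + s"] that by simp
        ultimately obtain s' where s': "\<sigma> (k + s) = k + s'" "s' \<le> t"
          by (metis add_le_cancel_left le_iff_add)
        then have "snd (f s') = snd (f s)" using ys by (simp add: y_def)
        then have "s' = s" using f(2)[rule_format, of s s'] f(2)[rule_format, of s' s] s' that
          by (cases s s' rule: linorder_cases) auto
        then show ?thesis using s' by simp
      qed
      have "\<sigma> permutes {..<k}"
      proof (rule permutes_superset[OF \<sigma>])
        fix s assume "s \<in> ?S - {..<k}"
        then show "\<sigma> s = s" using fixed[of "s - k"] by auto
      qed
      then have "bracket k (u \<circ> \<sigma>) a = of_int (sign \<sigma>) * bracket k u a" for a by (rule bracket_permute)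
      moreover have "N \<sigma> = N id"
        unfolding N_def by (rule image_mset_cong) (simp add: fixed)
      ultimately have "of_int (sign \<sigma>) * F \<sigma> a = F id a" for a
        by (simp add: F_def mult.assoc[symmetric] flip: of_int_mult)
      then show ?thesis by (simp add: F_id)
    next
      case False
      then have less: "arc_weight (N id) < arc_weight (N \<sigma>)"
        using ar(1) weight[of id] weight[of \<sigma>] by simp
      have "(u \<circ> \<sigma>) ` {..<k} \<subseteq> {1..p}" using u_range \<sigma>S by auto
      from bracket_sort[OF this] consider "\<forall>a. bracket k (u \<circ> \<sigma>) a = 0" |
        L \<epsilon> where "L \<in> hyperedges p k" "\<forall>a. bracket k (u \<circ> \<sigma>) a = \<epsilon> * bracket k ((!) L) a" by auto
      then have "F \<sigma> \<in> fun_space.span (heavier k p q M E)"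
      proof cases
        case 1
        then have "F \<sigma> = 0" by (simp add: F_def fun_eq_iff)
        then show ?thesis by (simp add: fun_space.span_zero)
      next
        case (2 L \<epsilon>)
        have "(u (\<sigma> (k + s)), snd (f s)) \<in> {1..p} \<times> {1..q}" if "s \<le> t" for s
          using u_range[OF \<sigma>S[of "k + s"]] fM[OF that] that by (auto simp: mem_Times_iff)
        then have "arc_diagram p q (M0 + N \<sigma>)" using M by (auto simp: arc_diagram_def M0 N_def)
        then have "starred_fun k (M0 + N \<sigma>) (add_mset L E0) \<in> heavier k p q M E"
          using less E 2(1) unfolding heavier_def
          by (intro CollectI exI[of _ "M0 + N \<sigma>"] exI[of _ "add_mset L E0"]) (auto simp: M_id E0 N_def)
        then have "fun_scale \<epsilon> (starred_fun k (M0 + N \<sigma>) (add_mset L E0)) \<in> fun_space.span (heavier k p q M E)"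
          by (intro fun_space.span_scale fun_space.span_base)
        moreover have "F \<sigma> = fun_scale \<epsilon> (starred_fun k (M0 + N \<sigma>) (add_mset L E0))"
          using 2(2) by (simp add: F_def fun_eq_iff fun_scale_def starred_fun_add_bracket)
        ultimately show ?thesis by simp
      qed
      then show ?thesis ..
    qed
  next
    fix a
    have "F \<sigma> a = bracket k (u \<circ> \<sigma>) a *
        (\<Prod>s\<le>t. \<Sum>r<k. a (Inl (u (\<sigma> (k + s)), r)) * a (Inr (snd (f s), r))) * starred_fun k M0 E0 a" for \<sigma>
      using starred_fun_union[of k M0 "N \<sigma>" E0 "{#}" a]
      by (simp add: F_def N_def starred_fun_image pairing_def mult.commute)
    then have "(\<Sum>\<sigma> | \<sigma> permutes ?S. of_int (sign \<sigma>) * F \<sigma> a) =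
      (\<Sum>\<sigma> | \<sigma> permutes ?S. of_int (sign \<sigma>) * (bracket k (u \<circ> \<sigma>) a *
        (\<Prod>s\<le>t. \<Sum>r<k. a (Inl (u (\<sigma> (k + s)), r)) * a (Inr (snd (f s), r))))) * starred_fun k M0 E0 a"
      by (simp only: sum_distrib_right mult.assoc)
    then show "(\<Sum>\<sigma> | \<sigma> permutes ?S. of_int (sign \<sigma>) * F \<sigma> a) = 0"
      using bracket_exchange[OF t, of u a "\<lambda>s r. a (Inr (snd (f s), r))"] by simp
  qed (auto simp: finite_permutations permutes_id)
qed

lemma sum_lessThan_add: "(\<Sum>s<k + n. g s) = (\<Sum>c<k. g c) + (\<Sum>c<n. g (k + c :: nat) :: nat)"
  by (induction n) simp_all

lemma sum_squares_spread:
  fixes x y x' y' :: nat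
  assumes "x + y = x' + y'" "x \<le> y" "y < y'"
  shows "x\<^sup>2 + y\<^sup>2 < x'\<^sup>2 + y'\<^sup>2"
proof -
  obtain d where d: "y' = y + Suc d" using assms(3) less_iff_Suc_add by (metis add_Suc_right)
  then have x: "x = x' + Suc d" using assms(1) by simp
  \<comment> \<open>\<open>(x - e)\<^sup>2 + (y + e)\<^sup>2 = x\<^sup>2 + y\<^sup>2 + 2 e (y - x) + 2 e\<^sup>2\<close> with \<open>e = Suc d\<close>, without subtraction\<close>
  have "x'\<^sup>2 + y'\<^sup>2 + 2 * x * Suc d = x\<^sup>2 + y\<^sup>2 + 2 * y * Suc d + 2 * (Suc d)\<^sup>2"
    unfolding d x by (simp add: power2_eq_square algebra_simps)
  moreover have "2 * x * Suc d \<le> 2 * y * Suc d" using assms(2) by (intro mult_mono) auto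
  moreover have "0 < 2 * (Suc d)\<^sup>2" by simp
  ultimately show ?thesis by linarith
qed

text \<open>
  The Pluecker relation.  The vertices of \<open>I'\<close> in the positions \<open>0, \<dots>, t\<close> are smaller than those of \<open>I\<close>
  from position \<open>t\<close> on.  A permutation that does not preserve these two groups moves vertices with a
  larger sum into \<open>I'\<close>; since the sum of \<open>I'\<close> was at least that of \<open>I\<close>, the squares increase.  Taking
  \<open>y\<close> as the indicator of the slots of \<open>I'\<close> makes this an instance of the antitone rearrangement
  inequality.
\<close>

lemma straighten_incomparable:
  assumes M: "arc_diagram p q M" and E: "set_mset E \<subseteq> hyperedges p k"
    and E0: "E = add_mset I (add_mset I' E0)" and le: "sum_list I \<le> sum_list I'"
    and t: "t < k" "I' ! t < I ! t"
  shows "starred_fun k M E \<in> fun_space.span (heavier k p q M E)"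
proof -
  have IH: "I \<in> hyperedges p k" "I' \<in> hyperedges p k" using E by (auto simp: E0)
  note In = hyperedges_nth[OF IH(1)] and In' = hyperedges_nth[OF IH(2)]
  define u where "u c = (if c < k then I ! c else I' ! (c - k))" for c
  define y :: "nat \<Rightarrow> nat" where "y c = (if c < k then 0 else 1)" for c
  let ?S = "{t..k + t}"
  have small: "u s \<le> I' ! t" if "k \<le> s" "s \<le> k + t" for s
    using In'(4)[of "s - k" t] that t by (simp add: u_def)
  have large: "I' ! t < u s" if "t \<le> s" "s < k" for s
    using t In(4)[of t s] that by (simp add: u_def)
  have u_range: "u s \<in> {1..p}" if "s < k + k" for s
    using In(2)[of s] In'(2)[of "s - k"] that by (auto simp: u_def)
  have inj: "inj_on u ?S"
  proof (rule inj_onI)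
    fix s s' assume s: "s \<in> ?S" "s' \<in> ?S" "u s = u s'"
    consider "s < k" "s' < k" | "s < k" "k \<le> s'" | "k \<le> s" "s' < k" | "k \<le> s" "k \<le> s'" by linarith
    then show "s = s'"
    proof cases
      case 1
      then show ?thesis using s In(3)[of s s'] In(3)[of s' s]
        by (cases s s' rule: linorder_cases) (auto simp: u_def)
    next
      case 2
      then show ?thesis using large[of s] small[of s'] s by simp
    next
      case 3
      then show ?thesis using large[of s'] small[of s] s by simp
    next
      case 4
      then obtain d e where "s = k + d" "s' = k + e" by (metis le_iff_add)
      then show ?thesis
        using s t In'(3)[of d e] In'(3)[of e d]
        by (cases d e rule: linorder_cases) (auto simp: u_def)
    qed
  qed
  have anti: "y s' \<le> y s" if s: "s \<in> ?S" "s' \<in> ?S" "u s < u s'" for s s'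
    using large[of s] small[of s'] s by (auto simp: y_def)
  define F where "F \<sigma> a = bracket k (u \<circ> \<sigma>) a * bracket k (\<lambda>c. u (\<sigma> (k + c))) a *
    starred_fun k M E0 a" for \<sigma> a
  have F_id: "F id a = starred_fun k M E a" for a
  proof -
    have "bracket k u a = bracket k ((!) I) a" "bracket k (\<lambda>c. u (k + c)) a = bracket k ((!) I') a"
      by (rule bracket_cong, simp add: u_def)+
    then show ?thesis by (simp add: F_def E0 starred_fun_add_bracket mult.assoc)
  qed
  have weight: "(\<Sum>s\<in>?S. u (\<sigma> s) * y s) = (\<Sum>s\<le>t. u (\<sigma> (k + s)))" for \<sigma>
  proof -
    have "(\<Sum>s\<in>?S. u (\<sigma> s) * y s) = (\<Sum>s\<in>?S. if s < k then 0 else u (\<sigma> s))"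
      by (rule sum.cong) (auto simp: y_def)
    then show ?thesis unfolding sum_exchange_slots[OF t(1)] .
  qed
  show ?thesis
  proof (rule span_relation[where A = "{\<sigma>. \<sigma> permutes ?S}" and i = id
        and c = "\<lambda>\<sigma>. of_int (sign \<sigma>)" and F = F])
    show "of_int (sign id) * F id a = starred_fun k M E a" for a by (simp add: F_id)
  next
    fix \<sigma> assume "\<sigma> \<in> {\<sigma>. \<sigma> permutes ?S}"
    then have \<sigma>: "\<sigma> permutes ?S" by simp
    have \<sigma>2k: "\<sigma> permutes {..<k + k}" by (rule permutes_subset[OF \<sigma>]) (use t in auto)
    note ar = antitone_rearrangement[of ?S u y \<sigma>, OF _ inj anti \<sigma>]
    show "(\<forall>a. of_int (sign \<sigma>) * F \<sigma> a = starred_fun k M E a) \<or>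
        F \<sigma> \<in> fun_space.span (heavier k p q M E)"
    proof (cases "(\<Sum>s\<in>?S. u s * y s) = (\<Sum>s\<in>?S. u (\<sigma> s) * y s)")
      case True
      have B: "\<sigma> s \<in> {k..k + t}" if "s \<in> {k..k + t}" for s
      proof -
        have s: "s \<in> ?S" using that t by auto
        then have "y (\<sigma> s) = y s" using ar(2) True by simp
        then have "k \<le> \<sigma> s" using that by (auto simp: y_def split: if_splits)
        then show ?thesis using permutes_in_image[OF \<sigma>, of s] s by simp
      qed
      have un: "\<sigma> permutes {t..<k} \<union> {k..k + t}" using \<sigma> exchange_slots[OF t(1)] by simp
      have dj: "{t..<k} \<inter> {k..k + t} = {}" by auto
      have "\<exists>\<sigma>1 \<sigma>2. \<sigma>1 permutes {t..<k} \<and> \<sigma>2 permutes {k..k + t} \<and> \<sigma> = \<sigma>1 \<circ> \<sigma>2 \<and>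
          sign \<sigma> = sign \<sigma>1 * sign \<sigma>2"
        by (rule permutes_split[OF un dj B]) simp_all
      then obtain \<sigma>1 \<sigma>2 where
        s1: "\<sigma>1 permutes {t..<k}" and s2: "\<sigma>2 permutes {k..k + t}" and
        s12: "\<sigma> = \<sigma>1 \<circ> \<sigma>2" "sign \<sigma> = sign \<sigma>1 * sign \<sigma>2" by blast
      have "bracket k (u \<circ> \<sigma>) a = bracket k (u \<circ> \<sigma>1) a" for a
        by (rule bracket_cong) (simp add: s12(1) permutes_not_in[OF s2])
      moreover have "\<sigma>1 permutes {..<k}" by (rule permutes_subset[OF s1]) auto
      ultimately have 1: "bracket k (u \<circ> \<sigma>) a = of_int (sign \<sigma>1) * bracket k u a" for a
        by (simp add: bracket_permute)
      have "\<sigma> (k + c) = \<sigma>2 (k + c)" for c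
      proof -
        have "k \<le> \<sigma>2 (k + c)"
          using permutes_in_image[OF s2, of "k + c"] permutes_not_in[OF s2, of "k + c"]
          by (cases "k + c \<in> {k..k + t}") auto
        then show ?thesis using permutes_not_in[OF s1, of "\<sigma>2 (k + c)"] by (simp add: s12(1))
      qed
      then have 2: "bracket k (\<lambda>c. u (\<sigma> (k + c))) a = of_int (sign \<sigma>2) * bracket k (\<lambda>c. u (k + c)) a" for a
        using bracket_permute_shifted[OF s2 t(1), of u a] by simp
      have "of_int (sign \<sigma>) * F \<sigma> a = F id a" for a
      proof -
        have "of_int (sign \<sigma>) * F \<sigma> a =
            of_int ((sign \<sigma>1 * sign \<sigma>1) * (sign \<sigma>2 * sign \<sigma>2)) * F id a"
          by (simp only: F_def 1 2 s12(2) of_int_mult) (simp add: mult_ac)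
        then show ?thesis by simp
      qed
      then show ?thesis by (simp add: F_id)
    next
      case False
      then have less: "(\<Sum>s\<le>t. u (k + s)) < (\<Sum>s\<le>t. u (\<sigma> (k + s)))"
        using ar(1) weight[of id] weight[of \<sigma>] by simp
      have split: "(\<Sum>c<k. g c) = (\<Sum>c\<le>t. g c) + (\<Sum>c\<in>{t<..<k}. g c)" for g :: "nat \<Rightarrow> nat"
      proof -
        have "sum g ({..t} \<union> {t<..<k}) = (\<Sum>c\<le>t. g c) + (\<Sum>c\<in>{t<..<k}. g c)"
          by (rule sum.union_disjoint) auto
        moreover have "{..t} \<union> {t<..<k} = {..<k}" using t by auto
        ultimately show ?thesis by simp
      qed
      have "(\<Sum>c\<in>{t<..<k}. u (\<sigma> (k + c))) = (\<Sum>c\<in>{t<..<k}. u (k + c))"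
        by (rule sum.cong) (auto simp: permutes_not_in[OF \<sigma>])
      then have less': "(\<Sum>c<k. u (k + c)) < (\<Sum>c<k. u (\<sigma> (k + c)))"
        using less by (simp add: split)
      have total: "(\<Sum>c<k. (u \<circ> \<sigma>) c) + (\<Sum>c<k. u (\<sigma> (k + c))) = (\<Sum>c<k. u c) + (\<Sum>c<k. u (k + c))"
        using sum.permute[OF \<sigma>2k, of u] by (simp add: sum_lessThan_add comp_def)
      have sums: "(\<Sum>c<k. u c) = sum_list I" "(\<Sum>c<k. u (k + c)) = sum_list I'"
        by (simp_all add: sum_list_nth[OF In(1)] sum_list_nth[OF In'(1)] u_def)
      have \<sigma>S: "\<sigma> s < k + k" if "s < k + k" for s
        using permutes_in_image[OF \<sigma>2k, of s] that by simp
      have "(u \<circ> \<sigma>) ` {..<k} \<subseteq> {1..p}" "(\<lambda>c. u (\<sigma> (k + c))) ` {..<k} \<subseteq> {1..p}"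
        using u_range \<sigma>S by auto
      from this[THEN bracket_sort] consider "\<forall>a. bracket k (u \<circ> \<sigma>) a = 0"
        | "\<forall>a. bracket k (\<lambda>c. u (\<sigma> (k + c))) a = 0"
        | L \<epsilon> L' \<epsilon>' where "L \<in> hyperedges p k" "L' \<in> hyperedges p k"
          "sum_list L = (\<Sum>c<k. (u \<circ> \<sigma>) c)" "sum_list L' = (\<Sum>c<k. u (\<sigma> (k + c)))"
          "\<forall>a. bracket k (u \<circ> \<sigma>) a = \<epsilon> * bracket k ((!) L) a"
          "\<forall>a. bracket k (\<lambda>c. u (\<sigma> (k + c))) a = \<epsilon>' * bracket k ((!) L') a" by auto
      then have "F \<sigma> \<in> fun_space.span (heavier k p q M E)"
      proof cases
        case 1
        then have "F \<sigma> = 0" by (simp add: F_def fun_eq_iff)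
        then show ?thesis by (simp add: fun_space.span_zero)
      next
        case 2
        then have "F \<sigma> = 0" by (simp add: F_def fun_eq_iff)
        then show ?thesis by (simp add: fun_space.span_zero)
      next
        case (3 L \<epsilon> L' \<epsilon>')
        let ?E = "add_mset L (add_mset L' E0)"
        have "hyperedge_weight E < hyperedge_weight ?E"
          using sum_squares_spread[of "sum_list I" "sum_list I'" "sum_list L" "sum_list L'"]
            le less' total sums 3(3,4) by (simp add: hyperedge_weight_def E0)
        then have "starred_fun k M ?E \<in> heavier k p q M E"
          using E M 3(1,2) unfolding heavier_def
          by (intro CollectI exI[of _ M] exI[of _ ?E]) (auto simp: E0)
        then have "fun_scale (\<epsilon> * \<epsilon>') (starred_fun k M ?E) \<in> fun_space.span (heavier k p q M E)"
          by (intro fun_space.span_scale fun_space.span_base)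
        moreover have "F \<sigma> = fun_scale (\<epsilon> * \<epsilon>') (starred_fun k M ?E)"
          using 3(5,6) by (simp add: F_def fun_eq_iff fun_scale_def starred_fun_add_bracket)
        ultimately show ?thesis by simp
      qed
      then show ?thesis ..
    qed
  next
    fix a :: coords
    define W where "W \<pi> s r = (if r = \<pi> s then 1 else 0 :: complex)" for \<pi> :: "nat \<Rightarrow> nat" and s r
    define C where "C \<pi> = (\<Prod>c\<in>{t<..<k}. a (Inl (u (k + c), \<pi> c)))" for \<pi>
    have second: "bracket k (\<lambda>c. u (\<sigma> (k + c))) a = (\<Sum>\<pi> | \<pi> permutes {..<k}. of_int (sign \<pi>) * C \<pi> *
        (\<Prod>s\<le>t. \<Sum>r<k. a (Inl (u (\<sigma> (k + s)), r)) * W \<pi> s r))" if \<sigma>: "\<sigma> permutes ?S" for \<sigma>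
      unfolding bracket_leibniz
    proof (rule sum.cong[OF refl])
      fix \<pi> assume "\<pi> \<in> {\<pi>. \<pi> permutes {..<k}}"
      then have \<pi>: "\<pi> c < k" if "c < k" for c using permutes_in_image[of \<pi> "{..<k}" c] that by simp
      have k: "{..<k} = {..t} \<union> {t<..<k}" using t by auto
      have "(\<Prod>c<k. a (Inl (u (\<sigma> (k + c)), \<pi> c))) =
          (\<Prod>c\<le>t. a (Inl (u (\<sigma> (k + c)), \<pi> c))) * (\<Prod>c\<in>{t<..<k}. a (Inl (u (\<sigma> (k + c)), \<pi> c)))"
        unfolding k by (rule prod.union_disjoint) auto
      also have "(\<Prod>c\<in>{t<..<k}. a (Inl (u (\<sigma> (k + c)), \<pi> c))) = C \<pi>"
        unfolding C_def by (rule prod.cong) (auto simp: permutes_not_in[OF \<sigma>])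
      also have "(\<Prod>c\<le>t. a (Inl (u (\<sigma> (k + c)), \<pi> c))) =
          (\<Prod>s\<le>t. \<Sum>r<k. a (Inl (u (\<sigma> (k + s)), r)) * W \<pi> s r)"
      proof (rule prod.cong[OF refl])
        fix s assume "s \<in> {..t}"
        then have "\<pi> s < k" using \<pi> t by simp
        have "(\<Sum>r<k. a (Inl (u (\<sigma> (k + s)), r)) * W \<pi> s r) =
            (\<Sum>r<k. if r = \<pi> s then a (Inl (u (\<sigma> (k + s)), r)) else 0)"
          by (rule sum.cong) (auto simp: W_def)
        then show "a (Inl (u (\<sigma> (k + s)), \<pi> s)) = (\<Sum>r<k. a (Inl (u (\<sigma> (k + s)), r)) * W \<pi> s r)"
          using \<open>\<pi> s < k\<close> by simp
      qed
      finally show "of_int (sign \<pi>) * (\<Prod>c<k. a (Inl (u (\<sigma> (k + c)), \<pi> c))) = of_int (sign \<pi>) * C \<pi> *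
        (\<Prod>s\<le>t. \<Sum>r<k. a (Inl (u (\<sigma> (k + s)), r)) * W \<pi> s r)" by simp
    qed
    let ?X = "starred_fun k M E0 a"
    have "(\<Sum>\<sigma> | \<sigma> permutes ?S. of_int (sign \<sigma>) * F \<sigma> a) =
      (\<Sum>\<sigma> | \<sigma> permutes ?S. \<Sum>\<pi> | \<pi> permutes {..<k}. (of_int (sign \<pi>) * C \<pi> * ?X) *
        (of_int (sign \<sigma>) * (bracket k (u \<circ> \<sigma>) a *
        (\<Prod>s\<le>t. \<Sum>r<k. a (Inl (u (\<sigma> (k + s)), r)) * W \<pi> s r))))"
    proof (rule sum.cong[OF refl])
      fix \<sigma> assume "\<sigma> \<in> {\<sigma>. \<sigma> permutes ?S}"
      then have "F \<sigma> a = bracket k (u \<circ> \<sigma>) a * (\<Sum>\<pi> | \<pi> permutes {..<k}. of_int (sign \<pi>) * C \<pi> *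
        (\<Prod>s\<le>t. \<Sum>r<k. a (Inl (u (\<sigma> (k + s)), r)) * W \<pi> s r)) * ?X"
        unfolding F_def using second by simp
      then show "of_int (sign \<sigma>) * F \<sigma> a = (\<Sum>\<pi> | \<pi> permutes {..<k}. (of_int (sign \<pi>) * C \<pi> * ?X) *
        (of_int (sign \<sigma>) * (bracket k (u \<circ> \<sigma>) a *
        (\<Prod>s\<le>t. \<Sum>r<k. a (Inl (u (\<sigma> (k + s)), r)) * W \<pi> s r))))"
        by (simp only: sum_distrib_left sum_distrib_right) (simp only: mult_ac)
    qed
    also have "\<dots> = (\<Sum>\<pi> | \<pi> permutes {..<k}. (of_int (sign \<pi>) * C \<pi> * ?X) *
        (\<Sum>\<sigma> | \<sigma> permutes ?S. of_int (sign \<sigma>) * (bracket k (u \<circ> \<sigma>) a *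
        (\<Prod>s\<le>t. \<Sum>r<k. a (Inl (u (\<sigma> (k + s)), r)) * W \<pi> s r))))"
      unfolding sum_distrib_left by (rule sum.swap)
    also have "\<dots> = 0" using bracket_exchange[OF t(1), of u a] by simp
    finally show "(\<Sum>\<sigma> | \<sigma> permutes ?S. of_int (sign \<sigma>) * F \<sigma> a) = 0" .
  qed (auto simp: finite_permutations permutes_id)
qed

lemma sum_mset_bounded: "(\<And>x. x \<in># A \<Longrightarrow> f x \<le> (b::nat)) \<Longrightarrow> (\<Sum>x\<in>#A. f x) \<le> size A * b"
  by (induction A) (auto intro: add_mono)

lemma not_admissible_heavier:
  assumes M: "arc_diagram p q M" and E: "set_mset E \<subseteq> hyperedges p k"
    and nadm: "\<not> starred_admissible k p q M E"
  shows "starred_fun k M E \<in> fun_space.span (heavier k p q M E)"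
proof -
  consider (nest) S where "S \<subseteq> set_mset M" "strict_nesting S" "card S > k"
    | (chain) I I' where "I \<in># E" "I' \<in># E" "\<not> hyperedge_le I I'" "\<not> hyperedge_le I' I"
    | (rule) T l x where "T \<in># E" "l \<in> {1..k}" "x \<in># nth_chain first_chain_starred l M" "fst x < T ! (l - 1)"
    using nadm M E unfolding starred_admissible_def hyperedge_chain_def topmost_def
    by (auto simp: not_le)
  then show ?thesis
  proof cases
    case nest
    obtain f where "\<forall>s\<le>k. f s \<in> S"
      "\<forall>s t. s < t \<and> t \<le> k \<longrightarrow> fst (f s) < fst (f t) \<and> snd (f t) < snd (f s)"
      using strict_nesting_enumeration[OF nest(2,3)] by auto
    then show ?thesis using nest(1) by (intro straighten_nesting[OF M E, of f]) auto
  next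
    case chain
    have *: ?thesis if I: "I \<in># E" "I' \<in># E" "\<not> hyperedge_le I I'" "sum_list I \<le> sum_list I'" for I I'
    proof -
      have len: "length I = k" "length I' = k" using I E by (auto simp: hyperedges_def)
      obtain t where t: "t < k" "I' ! t < I ! t"
        using I(3) len by (auto simp: hyperedge_le_def list_all2_conv_all_nth not_le)
      then have "I \<noteq> I'" by auto
      then obtain E0 where "E = add_mset I (add_mset I' E0)"
        using I(1,2) by (metis insert_noteq_member mset_add)
      from straighten_incomparable[OF M E this I(4) t] show ?thesis .
    qed
    show ?thesis using *[of I I'] *[of I' I] chain by linarith
  next
    case rule
    obtain f where f: "f (l - 1) = x" "\<forall>s\<le>l - 1. f s \<in># M"
      "\<forall>s t. s < t \<and> t \<le> l - 1 \<longrightarrow> fst (f s) < fst (f t) \<and> snd (f t) < snd (f s)"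
      using nth_chain_nesting[OF rule(3)] by auto
    show ?thesis
      by (rule straighten_hyperedge_rule[OF M E rule(1) _ _ f(2,3)]) (use rule f(1) in auto)
  qed
qed

text \<open>
  Both weights are bounded in terms of \<open>k\<close>, \<open>p\<close>, \<open>q\<close> and the numbers of arcs and hyperedges, which the
  straightening steps preserve.
\<close>

theorem straightening:
  assumes "arc_diagram p q M" and "set_mset E \<subseteq> hyperedges p k"
  shows "starred_fun k M E \<in> admissible_span k p q (size M) (size E)"
proof -
  define B where "B = size M * (p * q)"
  define C where "C = size E * (k * p)\<^sup>2"
  have "arc_diagram p q M' \<Longrightarrow> set_mset E' \<subseteq> hyperedges p k \<Longrightarrow> size M' = size M \<Longrightarrow> size E' = size E \<Longrightarrow>
    starred_fun k M' E' \<in> admissible_span k p q (size M) (size E)" for M' E'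
  proof (induction "(B - arc_weight M', C - hyperedge_weight E')" arbitrary: M' E'
      rule: wf_induct_rule[OF wf_lex_prod[OF wf_less_than wf_less_than]])
    case (1 M' E')
    show ?case
    proof (cases "starred_admissible k p q M' E'")
      case True
      then show ?thesis unfolding admissible_span_def
        by (intro fun_space.span_base CollectI exI[of _ M'] exI[of _ E']) (use 1 in auto)
    next
      case False
      have "heavier k p q M' E' \<subseteq> admissible_span k p q (size M) (size E)"
      proof
        fix F assume "F \<in> heavier k p q M' E'"
        then obtain M2 E2 where F: "F = starred_fun k M2 E2" and 2: "arc_diagram p q M2"
          "set_mset E2 \<subseteq> hyperedges p k" "size M2 = size M'" "size E2 = size E'"
          and w: "arc_weight M' < arc_weight M2 \<or>
            arc_weight M' = arc_weight M2 \<and> hyperedge_weight E' < hyperedge_weight E2"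
          unfolding heavier_def by auto
        have "arc_weight M2 \<le> B"
          unfolding arc_weight_def B_def using 2(1,3) 1(4)
          by (metis (no_types, lifting) sum_mset_bounded[of M2 "\<lambda>(i, j). i * j" "p * q"]
              arc_diagram_def atLeastAtMost_iff case_prod_conv mem_Sigma_iff mult_le_mono subset_iff surj_pair)
        moreover have "hyperedge_weight E2 \<le> C"
          unfolding hyperedge_weight_def C_def 1(5)[symmetric] 2(4)[symmetric]
        proof (rule sum_mset_bounded)
          fix I assume "I \<in># E2"
          then have "I \<in> hyperedges p k" using 2(2) by auto
          note In = hyperedges_nth[OF this]
          have "sum_list I \<le> (\<Sum>c<k. p)"
            unfolding sum_list_nth[OF In(1)] by (rule sum_mono) (use In(2) in auto)
          then show "(sum_list I)\<^sup>2 \<le> (k * p)\<^sup>2" by (intro power_mono) auto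
        qed
        ultimately show "F \<in> admissible_span k p q (size M) (size E)"
          unfolding F using w 2 1 by (intro 1(1)) auto
      qed
      then have "fun_space.span (heavier k p q M' E') \<subseteq> admissible_span k p q (size M) (size E)"
        unfolding admissible_span_def by (intro fun_space.span_minimal fun_space.subspace_span)
      then show ?thesis using not_admissible_heavier[OF 1(2,3) False] by auto
    qed
  qed
  then show ?thesis using assms by simp
qed

section \<open>Formal polynomials\<close>

type_synonym formal_poly = "coord_index multiset \<Rightarrow>\<^sub>0 complex"

abbreviation "keys \<equiv> Poly_Mapping.keys"
abbreviation "lookup \<equiv> Poly_Mapping.lookup"
abbreviation "single \<equiv> Poly_Mapping.single"

definition ev :: "coords \<Rightarrow> formal_poly \<Rightarrow> complex" where
  "ev a P = (\<Sum>N\<in>keys P. lookup P N * (\<Prod>x\<in>#N. a x))"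

lemma ev_superset:
  "finite S \<Longrightarrow> keys P \<subseteq> S \<Longrightarrow> ev a P = (\<Sum>N\<in>S. lookup P N * (\<Prod>x\<in>#N. a x))"
  unfolding ev_def by (rule sum.mono_neutral_left) (auto simp: in_keys_iff)

lemma ev_zero [simp]: "ev a 0 = 0"
  by (simp add: ev_def)

lemma ev_single [simp]: "ev a (single N c) = c * (\<Prod>x\<in>#N. a x)"
  by (subst ev_superset[of "{N}"]) auto

lemma ev_one [simp]: "ev a 1 = 1"
  using ev_single[of a 0 1] by simp

lemma ev_add [simp]: "ev a (P + Q) = ev a P + ev a Q"
proof -
  let ?S = "keys P \<union> keys Q"
  show ?thesis
    using Poly_Mapping.keys_add[of P Q]
    by (subst (1 2 3) ev_superset[of ?S]) (auto simp: lookup_add sum.distrib algebra_simps)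
qed

lemma ev_sum [simp]: "ev a (sum f A) = (\<Sum>x\<in>A. ev a (f x))"
  by (induction A rule: infinite_finite_induct) auto

lemma formal_poly_expand: "P = (\<Sum>N\<in>keys P. single N (lookup P N))"
  by (rule poly_mapping_eqI) (simp add: lookup_sum lookup_single when_def in_keys_iff)

lemma ev_mult [simp]: "ev a (P * Q) = ev a P * ev a Q"
proof -
  have "P * Q = (\<Sum>N\<in>keys P. single N (lookup P N)) *
      (\<Sum>N\<in>keys Q. single N (lookup Q N))"
    by (simp flip: formal_poly_expand)
  then have "ev a (P * Q) = ev a (\<Sum>M\<in>keys P. \<Sum>N\<in>keys Q.
      single (M + N) (lookup P M * lookup Q N))"
    by (simp only: sum_product mult_single)
  also have "\<dots> = (\<Sum>M\<in>keys P. \<Sum>N\<in>keys Q.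
      (lookup P M * (\<Prod>x\<in>#M. a x)) * (lookup Q N * (\<Prod>x\<in>#N. a x)))"
    unfolding ev_sum ev_single by (simp add: mult_ac)
  also have "\<dots> = ev a P * ev a Q" unfolding ev_def sum_product ..
  finally show ?thesis .
qed

lemma ev_prod_mset [simp]: "ev a (\<Prod>x\<in>#M. f x) = (\<Prod>x\<in>#M. ev a (f x))"
  by (induction M) auto

lemma ev_diff [simp]: "ev a (P - Q) = ev a P - ev a Q"
  using ev_add[of a "P - Q" Q] by simp

text \<open>
  Comparison of coefficients in one variable \<open>t\<close>.  It is used for separating the degree in one
  variable, the degree in the covectors, and the total degree.
\<close>

lemma power_sum_coefficients:
  fixes v :: "'i \<Rightarrow> complex"
  assumes "finite K" and "\<And>t. (\<Sum>N\<in>K. t ^ e N * v N) = 0"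
  shows "(\<Sum>N | N \<in> K \<and> e N = n. v N) = 0"
proof -
  define P where "P = (\<Sum>N\<in>K. Polynomial.monom (v N) (e N))"
  have "poly P t = 0" for t
    using assms(2)[of t] by (simp add: P_def poly_sum poly_monom mult.commute)
  then have "P = 0" using poly_all_0_iff_0 by blast
  then have "coeff P n = 0" by simp
  then have "(\<Sum>N\<in>K. if e N = n then v N else 0) = 0" by (simp add: P_def coeff_sum)
  then show ?thesis using assms(1) by (simp add: sum.inter_filter[symmetric])
qed

text \<open>
  Polynomial functions determine their coefficients, even if they are only evaluated where all
  variables outside \<open>V\<close> vanish.  Induction on \<open>V\<close> splits off one variable at a time.
\<close>

lemma vanishing_monomial_sum:
  assumes "finite V" and "finite K" and "\<And>N. N \<in> K \<Longrightarrow> set_mset N \<subseteq> V"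
    and "\<And>a :: 'x \<Rightarrow> complex. (\<forall>x. x \<notin> V \<longrightarrow> a x = 0) \<Longrightarrow> (\<Sum>N\<in>K. c N * (\<Prod>x\<in>#N. a x)) = 0"
    and "N \<in> K"
  shows "c N = 0"
  using assms
proof (induction V arbitrary: K c N rule: finite_induct)
  case empty
  then have "K = {{#}}" by auto
  then show ?case using empty(3)[of "\<lambda>_. 0"] empty(4) by simp
next
  case (insert x V)
  define drop where "drop M = filter_mset (\<lambda>y. y \<noteq> x) M" for M :: "'x multiset"
  have decomp: "M = replicate_mset (count M x) x + drop M" for M
    by (rule multiset_eqI) (simp add: drop_def)
  define n where "n = count N x"
  define Kn where "Kn = {M \<in> K. count M x = n}"
  have fin: "finite Kn" using insert.prems(1) by (simp add: Kn_def)
  have inj: "inj_on drop Kn"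
  proof (rule inj_onI)
    fix M M' assume "M \<in> Kn" "M' \<in> Kn" "drop M = drop M'"
    then show "M = M'" using decomp[of M] decomp[of M'] by (simp add: Kn_def)
  qed
  define c' where "c' M = c (replicate_mset n x + M)" for M
  have c': "c' (drop M) = c M" if "M \<in> Kn" for M
    using decomp[of M] that by (simp add: c'_def Kn_def)
  have "c' (drop N) = 0"
  proof (rule insert.IH)
    show "finite (drop ` Kn)" using fin by simp
    show "set_mset M \<subseteq> V" if "M \<in> drop ` Kn" for M
      using that insert.prems(2) by (auto simp: drop_def Kn_def) blast
    show "drop N \<in> drop ` Kn" using insert.prems(4) by (simp add: Kn_def n_def)
    fix a :: "'x \<Rightarrow> complex" assume a: "\<forall>x. x \<notin> V \<longrightarrow> a x = 0"
    have prod: "(\<Prod>y\<in>#M. (a(x := t)) y) = t ^ count M x * (\<Prod>y\<in>#drop M. a y)" for M t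
    proof -
      have "(\<Prod>y\<in>#M. (a(x := t)) y) = (\<Prod>y\<in>#replicate_mset (count M x) x. (a(x := t)) y) *
          (\<Prod>y\<in>#drop M. (a(x := t)) y)"
        by (subst (1) decomp[of M]) simp
      also have "image_mset (a(x := t)) (drop M) = image_mset a (drop M)"
        by (rule image_mset_cong) (simp add: drop_def)
      finally show ?thesis by simp
    qed
    have "(\<Sum>M\<in>K. t ^ count M x * (c M * (\<Prod>y\<in>#drop M. a y))) = 0" for t
    proof -
      have "(\<Sum>M\<in>K. c M * (\<Prod>y\<in>#M. (a(x := t)) y)) = 0"
        by (rule insert.prems(3)) (use a in auto)
      then show ?thesis unfolding prod by (simp add: mult_ac)
    qed
    from power_sum_coefficients[OF insert.prems(1) this, of n]
    have "(\<Sum>M\<in>Kn. c M * (\<Prod>y\<in>#drop M. a y)) = 0" by (simp add: Kn_def)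
    then show "(\<Sum>M\<in>drop ` Kn. c' M * (\<Prod>x\<in>#M. a x)) = 0"
      by (simp add: sum.reindex[OF inj] c')
  qed
  then show ?case using c'[of N] insert.prems(4) by (simp add: Kn_def n_def)
qed

lemma coefficient_eq_0:
  assumes "\<And>a. (\<forall>x\<in>Z. a x = 0) \<Longrightarrow> ev a P = 0" and "set_mset N \<inter> Z = {}"
  shows "lookup P N = 0"
proof (cases "N \<in> keys P")
  case True
  define V where "V = (\<Union>M\<in>keys P. set_mset M) - Z"
  define K where "K = {M \<in> keys P. set_mset M \<inter> Z = {}}"
  show ?thesis
  proof (rule vanishing_monomial_sum[of V K])
    fix a :: coords assume a: "\<forall>x. x \<notin> V \<longrightarrow> a x = 0"
    have "ev a P = (\<Sum>M\<in>K. lookup P M * (\<Prod>x\<in>#M. a x))"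
      unfolding ev_def
    proof (rule sum.mono_neutral_right)
      show "\<forall>M\<in>keys P - K. lookup P M * (\<Prod>x\<in>#M. a x) = 0"
      proof
        fix M assume "M \<in> keys P - K"
        then obtain x where "x \<in># M" "x \<in> Z" by (auto simp: K_def)
        then have "(\<Prod>x\<in>#M. a x) = 0" using a by (auto simp: prod_mset_zero_iff V_def)
        then show "lookup P M * (\<Prod>x\<in>#M. a x) = 0" by simp
      qed
    qed (auto simp: K_def)
    moreover have "ev a P = 0" using a by (intro assms(1)) (auto simp: V_def)
    ultimately show "(\<Sum>M\<in>K. lookup P M * (\<Prod>x\<in>#M. a x)) = 0" by simp
  qed (use True assms(2) in \<open>auto simp: V_def K_def\<close>)
qed (simp add: in_keys_iff)

lemma keys_sumD: "N \<in> keys (sum f A) \<Longrightarrow> \<exists>x\<in>A. N \<in> keys (f x)"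
  by (auto simp: in_keys_iff lookup_sum intro: sum.neutral)

lemma lookup_mult_unique:
  fixes P Q :: formal_poly
  assumes "\<And>a b. a \<in> keys P \<Longrightarrow> b \<in> keys Q \<Longrightarrow> a + b = m + n \<Longrightarrow> a = m \<and> b = n"
  shows "lookup (P * Q) (m + n) = lookup P m * lookup Q n"
proof -
  define P' where "P' = P - single m (lookup P m)"
  define Q' where "Q' = Q - single n (lookup Q n)"
  have P': "a \<in> keys P \<and> a \<noteq> m" if "a \<in> keys P'" for a
    using that by (auto simp: P'_def in_keys_iff lookup_minus lookup_single when_def split: if_splits)
  have Q': "a \<in> keys Q \<and> a \<noteq> n" if "a \<in> keys Q'" for a
    using that by (auto simp: Q'_def in_keys_iff lookup_minus lookup_single when_def split: if_splits)
  have "P * Q = P' * Q + single m (lookup P m) * Q' +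
      single (m + n) (lookup P m * lookup Q n)"
    by (simp add: P'_def Q'_def algebra_simps mult_single)
  moreover have "m + n \<notin> keys (P' * Q)"
    using keys_mult[of P' Q] P' assms by (fastforce simp: add.commute)
  moreover have "m + n \<notin> keys (single m (lookup P m) * Q')"
    using keys_mult[of "single m (lookup P m)" Q'] Q'
    by (fastforce split: if_splits)
  ultimately show ?thesis by (simp add: lookup_add in_keys_iff)
qed

section \<open>Leading monomials\<close>

definition pairing_poly :: "nat \<Rightarrow> nat \<Rightarrow> nat \<Rightarrow> formal_poly" where
  "pairing_poly k i j = (\<Sum>r<k. single {#Inl (i, r), Inr (j, r)#} 1)"

definition arcs_poly :: "nat \<Rightarrow> arc multiset \<Rightarrow> formal_poly" where
  "arcs_poly k M = (\<Prod>x\<in>#M. pairing_poly k (fst x) (snd x))"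

text \<open>
  The embedding \<open>e\<close> is \<open>Inl\<close> for the starred and \<open>Inr\<close> for the unstarred side.
\<close>

definition bracket_poly :: "(nat \<times> nat \<Rightarrow> coord_index) \<Rightarrow> nat \<Rightarrow> nat list \<Rightarrow> formal_poly" where
  "bracket_poly e k I = (\<Sum>\<pi> | \<pi> permutes {..<k}.
    single (image_mset (\<lambda>r. e (I ! \<pi> r, r)) (mset_set {..<k})) (of_int (sign \<pi>)))"

definition hyper_poly :: "(nat \<times> nat \<Rightarrow> coord_index) \<Rightarrow> nat \<Rightarrow> nat list multiset \<Rightarrow> formal_poly" where
  "hyper_poly e k E = (\<Prod>I\<in>#E. bracket_poly e k I)"

lemma ev_pairing_poly: "ev a (pairing_poly k i j) = pairing k i j a"
  by (simp add: pairing_poly_def pairing_def)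

lemma ev_bracket_poly: "ev a (bracket_poly e k I) = bracket k ((!) I) (\<lambda>x. case x of Inl y \<Rightarrow> a (e y) | Inr y \<Rightarrow> 0)"
  by (simp add: bracket_poly_def bracket_leibniz_rows multiset.map_comp comp_def prod_unfold_prod_mset)

lemma bracket_cong_coords:
  "(\<And>c r. c < k \<Longrightarrow> r < k \<Longrightarrow> a (Inl (u c, r)) = a' (Inl (u c, r))) \<Longrightarrow> bracket k u a = bracket k u a'"
  unfolding bracket_def by (intro arg_cong[of _ _ Determinant.det] eq_matI) auto

lemma ev_starred: "ev a (arcs_poly k M * hyper_poly Inl k E) = starred_fun k M E a"
proof -
  have "ev a (bracket_poly Inl k I) = bracket k ((!) I) a" for I
    unfolding ev_bracket_poly by (rule bracket_cong_coords) simp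
  then show ?thesis
    by (simp add: starred_fun_def arcs_poly_def hyper_poly_def ev_pairing_poly case_prod_unfold)
qed

text \<open>
  A multiset of pairs of a colour and an arc records which of the \<open>k\<close> summands of \<open>pairing_poly\<close> was
  chosen for each arc when a product of arcs is expanded.
\<close>

definition colour_class :: "nat \<Rightarrow> (nat \<times> arc) multiset \<Rightarrow> arc multiset" where
  "colour_class r R = image_mset snd (filter_mset (\<lambda>y. fst y = r) R)"

definition colour_monomial :: "(nat \<times> arc) multiset \<Rightarrow> coord_index multiset" where
  "colour_monomial R = (\<Sum>y\<in>#R. {#Inl (fst (snd y), fst y), Inr (snd (snd y), fst y)#})"

definition diag_monomial :: "(nat \<times> nat \<Rightarrow> coord_index) \<Rightarrow> nat \<Rightarrow> nat list multiset \<Rightarrow> coord_index multiset" where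
  "diag_monomial e k E = (\<Sum>I\<in>#E. image_mset (\<lambda>r. e (I ! r, r)) (mset_set {..<k}))"

definition chain_colouring :: "nat \<Rightarrow> arc multiset \<Rightarrow> (nat \<times> arc) multiset" where
  "chain_colouring k M = (\<Sum>r<k. image_mset (Pair r) (nth_chain first_chain_starred (Suc r) M))"

text \<open>
  The starred vertices of colour \<open>r\<close> in a monomial, with multiplicity; \<open>col_content\<close> lists the unstarred
  ones.  These two multisets are all that a monomial remembers about a coloured graph.
\<close>

definition row_content :: "nat \<Rightarrow> coord_index multiset \<Rightarrow> nat multiset" where
  "row_content r N = (\<Sum>x\<in>#N. case x of Inl y \<Rightarrow> if snd y = r then {#fst y#} else {#} | Inr y \<Rightarrow> {#})"

definition col_content :: "nat \<Rightarrow> coord_index multiset \<Rightarrow> nat multiset" where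
  "col_content r N = (\<Sum>x\<in>#N. case x of Inr y \<Rightarrow> if snd y = r then {#fst y#} else {#} | Inl y \<Rightarrow> {#})"

lemma content_simps [simp]:
  "row_content r {#} = {#}" "col_content r {#} = {#}"
  "row_content r (N + N') = row_content r N + row_content r N'"
  "col_content r (N + N') = col_content r N + col_content r N'"
  "row_content r (add_mset (Inl y) N) = (if snd y = r then {#fst y#} else {#}) + row_content r N"
  "col_content r (add_mset (Inl y) N) = col_content r N"
  "row_content r (add_mset (Inr y) N) = row_content r N"
  "col_content r (add_mset (Inr y) N) = (if snd y = r then {#fst y#} else {#}) + col_content r N"
  by (simp_all add: row_content_def col_content_def)

lemma content_colour_monomial:
  "row_content r (colour_monomial R) = image_mset fst (colour_class r R)"
  "col_content r (colour_monomial R) = image_mset snd (colour_class r R)"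
  by (induction R) (auto simp: colour_monomial_def colour_class_def)

lemma content_bracket_monomial:
  fixes f :: "nat \<Rightarrow> nat"
  assumes "r < k"
  shows "row_content r (image_mset (\<lambda>s. Inl (f s, s)) (mset_set {..<k})) = {#f r#}"
    and "col_content r (image_mset (\<lambda>s. Inl (f s, s)) (mset_set {..<k})) = {#}"
proof -
  have "row_content r (image_mset (\<lambda>s. Inl (f s, s)) (mset_set {..<k})) = (\<Sum>s<k. if s = r then {#f s#} else {#})"
    by (simp add: row_content_def multiset.map_comp comp_def sum_unfold_sum_mset cong: if_cong)
  also have "\<dots> = {#f r#}" using assms by simp
  finally show "row_content r (image_mset (\<lambda>s. Inl (f s, s)) (mset_set {..<k})) = {#f r#}" .
  show "col_content r (image_mset (\<lambda>s. Inl (f s, s)) (mset_set {..<k})) = {#}"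
    by (simp add: col_content_def multiset.map_comp comp_def)
qed

lemma content_diag_monomial:
  assumes "r < k"
  shows "row_content r (diag_monomial Inl k E) = image_mset (\<lambda>I. I ! r) E"
    and "col_content r (diag_monomial Inl k E) = {#}"
  using content_bracket_monomial[OF assms] by (induction E) (auto simp: diag_monomial_def)

lemma keys_arcs_poly:
  "N \<in> keys (arcs_poly k M) \<Longrightarrow>
    \<exists>R. image_mset snd R = M \<and> (\<forall>y\<in>#R. fst y < k) \<and> N = colour_monomial R"
proof (induction M arbitrary: N)
  case empty
  then show ?case by (intro exI[of _ "{#}"]) (auto simp: arcs_poly_def colour_monomial_def)
next
  case (add x M)
  then have "N \<in> keys (pairing_poly k (fst x) (snd x) * arcs_poly k M)"
    by (simp add: arcs_poly_def)
  then obtain n N' where n: "N = n + N'" "n \<in> keys (pairing_poly k (fst x) (snd x))"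
    "N' \<in> keys (arcs_poly k M)"
    using keys_mult by blast
  obtain r where r: "r < k" "n = {#Inl (fst x, r), Inr (snd x, r)#}"
    using keys_sumD[OF n(2)[unfolded pairing_poly_def]] by (auto split: if_splits)
  obtain R where "image_mset snd R = M" "\<forall>y\<in>#R. fst y < k" "N' = colour_monomial R"
    using add.IH[OF n(3)] by auto
  then show ?case using n(1) r
    by (intro exI[of _ "add_mset (r, x) R"]) (auto simp: colour_monomial_def)
qed

lemma lookup_single_mult:
  fixes P :: formal_poly
  shows "lookup (single n 1 * P) N =
    (if n \<subseteq># N then lookup P (N - n) else (0::complex))"
proof (cases "n \<subseteq># N")
  case True
  have "lookup (single n 1 * P) (n + (N - n)) =
      lookup (single n 1) n * lookup P (N - n)"
    by (rule lookup_mult_unique) (auto split: if_splits)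
  then show ?thesis using True by simp
next
  case False
  then have "N \<notin> keys (single n 1 * P)"
    using keys_mult[of "single n 1" P] by fastforce
  then show ?thesis using False by (simp add: in_keys_iff)
qed

text \<open>
  Different colourings of a graph can have the same monomial, but products of arcs have no negative
  coefficients, so their contributions cannot cancel.
\<close>

lemma arcs_poly_coefficients:
  "Im (lookup (arcs_poly k M) N) = 0 \<and> 0 \<le> Re (lookup (arcs_poly k M) N)"
proof (induction M arbitrary: N)
  case empty
  then show ?case by (simp add: arcs_poly_def lookup_one when_def)
next
  case (add x M)
  have e: "arcs_poly k (add_mset x M) =
      (\<Sum>r<k. single {#Inl (fst x, r), Inr (snd x, r)#} 1 * arcs_poly k M)"
    by (simp add: arcs_poly_def pairing_poly_def sum_distrib_right)
  show ?case unfolding e lookup_sum lookup_single_mult Re_sum Im_sum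
    by (intro conjI sum.neutral sum_nonneg ballI) (use add in auto)
qed

lemma arcs_poly_coefficient_pos:
  "\<forall>y\<in>#R. fst y < k \<Longrightarrow> 0 < Re (lookup (arcs_poly k (image_mset snd R)) (colour_monomial R))"
proof (induction R)
  case empty
  then show ?case by (simp add: arcs_poly_def colour_monomial_def)
next
  case (add y R)
  obtain r x where y: "y = (r, x)" by (cases y)
  let ?n = "\<lambda>r. {#Inl (fst x, r), Inr (snd x, r)#} :: coord_index multiset"
  have e: "arcs_poly k (image_mset snd (add_mset y R)) =
      (\<Sum>s<k. single (?n s) 1 * arcs_poly k (image_mset snd R))"
    by (simp add: arcs_poly_def pairing_poly_def sum_distrib_right y)
  have m: "colour_monomial (add_mset y R) = ?n r + colour_monomial R"
    by (simp add: colour_monomial_def y)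
  have "0 < Re (lookup (single (?n r) 1 * arcs_poly k (image_mset snd R)) (?n r + colour_monomial R))"
    unfolding lookup_single_mult using add by simp
  also have "\<dots> \<le> (\<Sum>s<k. Re (lookup (single (?n s) 1 * arcs_poly k (image_mset snd R)) (?n r + colour_monomial R)))"
    by (rule member_le_sum) (use add.prems arcs_poly_coefficients in \<open>auto simp: y lookup_single_mult\<close>)
  finally show ?case unfolding e m lookup_sum Re_sum .
qed

definition colour_weight :: "coord_index multiset \<Rightarrow> nat" where
  "colour_weight N = (\<Sum>x\<in>#N. case x of Inl y \<Rightarrow> fst y * snd y | Inr y \<Rightarrow> 0)"

lemma colour_weight_simps [simp]:
  "colour_weight {#} = 0" "colour_weight (N + N') = colour_weight N + colour_weight N'"
  by (simp_all add: colour_weight_def)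

text \<open>
  In a bracket the diagonal term matches positions with vertices monotonically, so by the
  rearrangement inequality it is the unique term of largest \<open>colour_weight\<close>.
\<close>

lemma keys_bracket_poly:
  assumes I: "I \<in> hyperedges p k" and n: "n \<in> keys (bracket_poly Inl k I)"
  shows "\<exists>\<pi>. \<pi> permutes {..<k} \<and> n = image_mset (\<lambda>r. Inl (I ! \<pi> r, r)) (mset_set {..<k})"
    and "colour_weight n \<le> colour_weight (diag_monomial Inl k {#I#})"
    and "colour_weight n = colour_weight (diag_monomial Inl k {#I#}) \<Longrightarrow> n = diag_monomial Inl k {#I#}"
proof -
  obtain \<pi> where \<pi>: "\<pi> permutes {..<k}" and n_eq: "n = image_mset (\<lambda>r. Inl (I ! \<pi> r, r)) (mset_set {..<k})"
    using keys_sumD[OF n[unfolded bracket_poly_def]] by (auto split: if_splits)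
  then show "\<exists>\<pi>. \<pi> permutes {..<k} \<and> n = image_mset (\<lambda>r. Inl (I ! \<pi> r, r)) (mset_set {..<k})"
    by blast
  define P where "P \<rho> = image_mset (\<lambda>r. (I ! \<rho> r, r)) (mset_set {..<k})" for \<rho> :: "nat \<Rightarrow> nat"
  have w: "colour_weight (image_mset (\<lambda>r. Inl (I ! \<rho> r, r)) (mset_set {..<k})) = arc_weight (P \<rho>)" for \<rho>
    by (simp add: colour_weight_def P_def arc_weight_def multiset.map_comp comp_def)
  have Inl: "image_mset (\<lambda>r. Inl (I ! \<rho> r, r)) (mset_set {..<k}) = image_mset Inl (P \<rho>)" for \<rho>
    by (simp add: P_def multiset.map_comp comp_def)
  have d: "diag_monomial Inl k {#I#} = image_mset Inl (P id)"
    using Inl[of id] by (simp add: diag_monomial_def)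
  have "monotone_matching (P id)"
    using hyperedges_nth(4)[OF I] unfolding monotone_matching_def P_def
    by auto (metis nat_le_linear)
  moreover have "image_mset fst (P \<pi>) = image_mset fst (P id)"
  proof -
    have "image_mset (\<lambda>r. I ! r) (image_mset \<pi> (mset_set {..<k})) = image_mset (\<lambda>r. I ! r) (mset_set {..<k})"
      using permutes_image_mset[OF \<pi>] by simp
    then show ?thesis by (simp add: P_def multiset.map_comp comp_def)
  qed
  moreover have "image_mset snd (P \<pi>) = image_mset snd (P id)"
    by (simp add: P_def multiset.map_comp comp_def)
  ultimately have ra: "arc_weight (P \<pi>) \<le> arc_weight (P id) \<and>
      (arc_weight (P \<pi>) = arc_weight (P id) \<longrightarrow> P \<pi> = P id)"
    by (rule rearrangement)
  have wd: "colour_weight (diag_monomial Inl k {#I#}) = arc_weight (P id)"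
    using w[of id] by (simp add: diag_monomial_def)
  show "colour_weight n \<le> colour_weight (diag_monomial Inl k {#I#})"
    using ra by (simp add: n_eq w wd)
  show "n = diag_monomial Inl k {#I#}" if "colour_weight n = colour_weight (diag_monomial Inl k {#I#})"
  proof -
    have "arc_weight (P \<pi>) = arc_weight (P id)" using that by (simp only: n_eq w wd)
    then show ?thesis using ra by (simp add: n_eq d Inl)
  qed
qed

lemma lookup_bracket_poly_diag:
  assumes I: "I \<in> hyperedges p k"
  shows "lookup (bracket_poly Inl k I) (diag_monomial Inl k {#I#}) = 1"
proof -
  have "\<pi> = id" if \<pi>: "\<pi> permutes {..<k}"
    and eq: "image_mset (\<lambda>r. Inl (I ! \<pi> r, r) :: coord_index) (mset_set {..<k}) = diag_monomial Inl k {#I#}" for \<pi>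
  proof
    fix r
    show "\<pi> r = id r"
    proof (cases "r < k")
      case True
      then have "Inl (I ! \<pi> r, r) \<in># diag_monomial Inl k {#I#}" unfolding eq[symmetric] by simp
      then have "I ! \<pi> r = I ! r" by (auto simp: diag_monomial_def)
      moreover have "\<pi> r < k" using permutes_in_image[OF \<pi>, of r] True by simp
      ultimately show ?thesis
        using hyperedges_nth(3)[OF I, of "\<pi> r" r] hyperedges_nth(3)[OF I, of r "\<pi> r"] True
        by (cases "\<pi> r" r rule: linorder_cases) auto
    qed (use \<pi> in \<open>simp add: permutes_not_in\<close>)
  qed
  then have "lookup (bracket_poly Inl k I) (diag_monomial Inl k {#I#}) =
      (\<Sum>\<pi> | \<pi> permutes {..<k}. if \<pi> = id then 1 else 0)"
    unfolding bracket_poly_def lookup_sum lookup_single when_def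
    by (intro sum.cong refl) (auto simp: diag_monomial_def)
  then show ?thesis by (simp add: finite_permutations permutes_id)
qed

text \<open>
  The diagonal term is the heaviest one in each factor and \<open>colour_weight\<close> is additive, so the
  heaviest term of the product arises in one way only.
\<close>

lemma hyper_poly_leading:
  assumes "set_mset E \<subseteq> hyperedges p k"
  shows "N \<in> keys (hyper_poly Inl k E) \<Longrightarrow> colour_weight N \<le> colour_weight (diag_monomial Inl k E) \<and>
      (colour_weight N = colour_weight (diag_monomial Inl k E) \<longrightarrow> N = diag_monomial Inl k E)"
    and "lookup (hyper_poly Inl k E) (diag_monomial Inl k E) = 1"
    and "N \<in> keys (hyper_poly Inl k E) \<Longrightarrow> r < k \<Longrightarrow>
      size (row_content r N) = size E \<and> col_content r N = {#}"
  using assms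
proof (induction E arbitrary: N)
  case empty
  { case 1 then show ?case by (simp add: hyper_poly_def diag_monomial_def) next
    case 2 then show ?case by (simp add: hyper_poly_def diag_monomial_def) next
    case 3 then show ?case by (auto simp: hyper_poly_def) }
next
  case (add I E)
  have hp: "hyper_poly Inl k (add_mset I E) = bracket_poly Inl k I * hyper_poly Inl k E"
    by (simp add: hyper_poly_def)
  have dm: "diag_monomial Inl k (add_mset I E) = diag_monomial Inl k {#I#} + diag_monomial Inl k E"
    by (simp add: diag_monomial_def)
  { case 1
    then have I: "I \<in> hyperedges p k" by simp
    obtain n N' where n: "N = n + N'" "n \<in> keys (bracket_poly Inl k I)"
        "N' \<in> keys (hyper_poly Inl k E)"
      using 1(1) keys_mult unfolding hp by blast
    show ?case
      using keys_bracket_poly(2,3)[OF I n(2)] add.IH(1)[OF n(3)] 1(2) unfolding dm n(1) by auto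
  next
    case 2
    then have I: "I \<in> hyperedges p k" by simp
    have "a = diag_monomial Inl k {#I#} \<and> b = diag_monomial Inl k E"
      if ab: "a \<in> keys (bracket_poly Inl k I)" "b \<in> keys (hyper_poly Inl k E)"
        "a + b = diag_monomial Inl k {#I#} + diag_monomial Inl k E" for a b
    proof -
      have "colour_weight a + colour_weight b =
          colour_weight (diag_monomial Inl k {#I#}) + colour_weight (diag_monomial Inl k E)"
        using arg_cong[OF ab(3), of colour_weight] by simp
      then show ?thesis
        using keys_bracket_poly(2,3)[OF I ab(1)] add.IH(1)[OF ab(2)] 2 by auto
    qed
    from lookup_mult_unique[OF this] show ?case
      unfolding hp dm using lookup_bracket_poly_diag[OF I] add.IH(2) 2 by simp
  next
    case 3
    then have I: "I \<in> hyperedges p k" by simp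
    obtain n N' where n: "N = n + N'" "n \<in> keys (bracket_poly Inl k I)"
        "N' \<in> keys (hyper_poly Inl k E)"
      using 3(1) keys_mult unfolding hp by blast
    obtain \<pi> where "n = image_mset (\<lambda>r. Inl (I ! \<pi> r, r)) (mset_set {..<k})"
      using keys_bracket_poly(1)[OF I n(2)] by auto
    then show ?case
      using content_bracket_monomial[OF 3(2), of "\<lambda>r. I ! \<pi> r"] add.IH(3)[OF n(3) 3(2)] 3(3) by (simp add: n(1))
  }
qed

lemma topmost_exists:
  assumes "E \<noteq> {#}" "hyperedge_chain E"
  shows "\<exists>T. topmost E T"
proof -
  obtain T where T: "T \<in># E" and Tmax: "\<And>I. I \<in># E \<Longrightarrow> sum_list I \<le> sum_list T"
    using ex_has_greatest_nat_finite[of "set_mset E" sum_list] assms(1) by auto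
  have sum_le: "sum_list xs \<le> sum_list ys \<and> (sum_list xs = sum_list ys \<longrightarrow> xs = ys)"
    if "list_all2 (\<le>) xs ys" for xs ys :: "nat list"
    using that by (induction rule: list_all2_induct) auto
  have "hyperedge_le I T" if "I \<in># E" for I
  proof (rule ccontr)
    assume n: "\<not> hyperedge_le I T"
    then have "hyperedge_le T I" using assms(2) T that by (auto simp: hyperedge_chain_def)
    then have "T = I" using sum_le[of T I] Tmax[OF that] by (auto simp: hyperedge_le_def)
    then show False using n by (simp add: hyperedge_le_def list.rel_refl)
  qed
  then show ?thesis using T by (auto simp: topmost_def)
qed

lemma hyperedge_le_nth:
  "length I = k \<Longrightarrow> length J = k \<Longrightarrow> hyperedge_le I J \<longleftrightarrow> (\<forall>c<k. I ! c \<le> J ! c)"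
  by (auto simp: hyperedge_le_def list_all2_conv_all_nth)

text \<open>
  A chain of hyperedges can be read off from its columns: the topmost hyperedge consists of the
  column maxima.
\<close>

lemma hyperedge_chain_unique:
  assumes "0 < k" and "set_mset E \<subseteq> hyperedges p k" "hyperedge_chain E"
    and "set_mset E' \<subseteq> hyperedges p k" "hyperedge_chain E'"
    and "\<And>r. r < k \<Longrightarrow> image_mset (\<lambda>I. I ! r) E' = image_mset (\<lambda>I. I ! r) E"
  shows "E' = E"
  using assms
proof (induction "size E" arbitrary: E E')
  case 0
  then show ?case using 0(7)[of 0] by auto
next
  case (Suc n)
  have ne: "E \<noteq> {#}" using Suc(2) by auto
  moreover have "image_mset (\<lambda>I. I ! 0) E' = image_mset (\<lambda>I. I ! 0) E" using Suc by blast
  ultimately have "E' \<noteq> {#}" by auto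
  with ne obtain T T' where T: "topmost E T" and T': "topmost E' T'"
    using topmost_exists Suc.prems by metis
  have len: "length I = k" if "I \<in># E \<or> I \<in># E'" for I
    using that Suc.prems by (auto simp: hyperedges_def)
  have TE: "T \<in># E" "T' \<in># E'" using T T' by (auto simp: topmost_def)
  have "T' ! r = T ! r" if r: "r < k" for r
  proof (rule antisym)
    have "T' ! r \<in># image_mset (\<lambda>I. I ! r) E" unfolding Suc.prems(6)[OF r, symmetric] using TE by auto
    then obtain I where "I \<in># E" "T' ! r = I ! r" by auto
    then show "T' ! r \<le> T ! r"
      using T r hyperedge_le_nth[of I k T] len TE by (auto simp: topmost_def)
    have "T ! r \<in># image_mset (\<lambda>I. I ! r) E'" unfolding Suc.prems(6)[OF r] using TE by auto
    then obtain I where "I \<in># E'" "T ! r = I ! r" by auto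
    then show "T ! r \<le> T' ! r"
      using T' r hyperedge_le_nth[of I k T'] len TE by (auto simp: topmost_def)
  qed
  then have eq: "T' = T" using len TE by (intro nth_equalityI) auto
  obtain E0 E0' where E0: "E = add_mset T E0" "E' = add_mset T E0'"
    using TE eq by (metis mset_add)
  have rows: "image_mset (\<lambda>I. I ! r) E0' = image_mset (\<lambda>I. I ! r) E0" if "r < k" for r
    using Suc.prems(6)[OF that] by (simp add: E0)
  have f: "set_mset E0 \<subseteq> hyperedges p k" "hyperedge_chain E0"
    "set_mset E0' \<subseteq> hyperedges p k" "hyperedge_chain E0'" "n = size E0"
    using Suc.prems(2-5) Suc.hyps(2) by (simp_all add: E0 hyperedge_chain_def)
  have "E0' = E0" by (rule Suc.hyps(1)[OF f(5) Suc.prems(1) f(1-4) rows])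
  then show ?case by (simp add: E0)
qed

lemma chain_rest_split:
  "chain_rest first_chain_starred r M =
    nth_chain first_chain_starred (Suc r) M + chain_rest first_chain_starred (Suc r) M"
proof -
  let ?N = "chain_rest first_chain_starred r M"
  have "first_chain_starred ?N \<subseteq># ?N" by (simp add: first_chain_starred_def)
  then have "first_chain_starred ?N + (?N - first_chain_starred ?N) = ?N"
    by (rule subset_mset.add_diff_inverse)
  then show ?thesis unfolding nth_chain_def chain_rest.simps diff_Suc_1 by (rule sym)
qed

text \<open>
  An arc that is left after \<open>k\<close> rounds of chain removal would be the innermost of \<open>k + 1\<close> nested ones.
\<close>

lemma chains_exhaust:
  assumes "\<forall>S. S \<subseteq> set_mset M \<and> strict_nesting S \<longrightarrow> card S \<le> k"
  shows "M = (\<Sum>r<k. nth_chain first_chain_starred (Suc r) M)"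
proof -
  have "M = (\<Sum>r<l. nth_chain first_chain_starred (Suc r) M) + chain_rest first_chain_starred l M" for l
  proof (induction l)
    case (Suc l)
    have "M = (\<Sum>r<l. nth_chain first_chain_starred (Suc r) M) +
        (nth_chain first_chain_starred (Suc l) M + chain_rest first_chain_starred (Suc l) M)"
      unfolding chain_rest_split[symmetric] by (rule Suc)
    then show ?case by (simp only: sum.lessThan_Suc add.assoc)
  qed simp
  moreover have "chain_rest first_chain_starred k M = {#}"
  proof (rule ccontr)
    assume "chain_rest first_chain_starred k M \<noteq> {#}"
    then obtain x where "x \<in># chain_rest first_chain_starred k M" by auto
    from chain_rest_nesting[OF this] obtain f where f: "\<forall>s\<le>k. f s \<in># M"
      "\<forall>s t. s < t \<and> t \<le> k \<longrightarrow> fst (f s) < fst (f t) \<and> snd (f t) < snd (f s)" by auto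
    have "inj_on f {..k}"
    proof (rule inj_onI)
      fix s t assume "s \<in> {..k}" "t \<in> {..k}" "f s = f t"
      then show "s = t" using f(2)[rule_format, of s t] f(2)[rule_format, of t s]
        by (cases s t rule: linorder_cases) auto
    qed
    then have "card (f ` {..k}) = Suc k" by (simp add: card_image)
    moreover have "fst (f s) < fst (f t) \<and> snd (f s) > snd (f t) \<or> fst (f s) > fst (f t) \<and> snd (f s) < snd (f t)"
      if "s \<le> k" "t \<le> k" "f s \<noteq> f t" for s t
      using f(2)[rule_format, of s t] f(2)[rule_format, of t s] that
      by (cases s t rule: linorder_cases) auto
    then have "strict_nesting (f ` {..k})"
      unfolding strict_nesting_def split_beta prod.collapse by blast
    moreover have "f ` {..k} \<subseteq> set_mset M" using f(1) by auto
    ultimately have "card (f ` {..k}) \<le> k" using assms by blast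
    then show False using \<open>card (f ` {..k}) = Suc k\<close> by simp
  qed
  ultimately show ?thesis by (metis add.right_neutral)
qed

lemma first_chain_monotone: "monotone_matching (first_chain_starred M)"
  unfolding monotone_matching_def
proof (intro ballI)
  fix x y assume xy: "x \<in># first_chain_starred M" "y \<in># first_chain_starred M"
  have "\<not> (fst y < fst x \<and> snd x < snd y)" "\<not> (fst x < fst y \<and> snd y < snd x)"
    using xy by (auto simp: first_chain_starred_def)
  then show "fst x \<le> fst y \<and> snd x \<le> snd y \<or> fst y \<le> fst x \<and> snd y \<le> snd x" by linarith
qed

lemma arc_weight_sum: "arc_weight (\<Sum>r\<in>A. f r) = (\<Sum>r\<in>A. arc_weight (f r))"
  by (induction A rule: infinite_finite_induct) auto

lemma image_mset_sum: "image_mset g (\<Sum>r\<in>A. f r) = (\<Sum>r\<in>A. image_mset g (f r))"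
  by (induction A rule: infinite_finite_induct) auto

lemma colour_classes:
  assumes "\<forall>y\<in>#R. fst y < k"
  shows "R = (\<Sum>r<k. image_mset (Pair r) (colour_class r R))"
  using assms
proof (induction R)
  case empty
  then show ?case by (simp add: colour_class_def)
next
  case (add y R)
  have "(\<Sum>r<k. image_mset (Pair r) (colour_class r (add_mset y R))) =
      (\<Sum>r<k. (if fst y = r then {#y#} else {#}) + image_mset (Pair r) (colour_class r R))"
    by (intro sum.cong refl) (auto simp: colour_class_def)
  also have "\<dots> = {#y#} + R" using add by (simp add: sum.distrib)
  finally show ?case by simp
qed

lemma colour_class_chain_colouring:
  "r < k \<Longrightarrow> colour_class r (chain_colouring k M) = nth_chain first_chain_starred (Suc r) M"
proof -
  assume r: "r < k"
  have "colour_class r (\<Sum>s\<in>A. image_mset (Pair s) (g s)) = (\<Sum>s\<in>A. if s = r then g s else {#})" for A and g :: "nat \<Rightarrow> arc multiset"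
    by (induction A rule: infinite_finite_induct)
      (auto simp: colour_class_def filter_mset_image_mset multiset.map_comp comp_def)
  then show ?thesis using r by (simp add: chain_colouring_def)
qed

lemma starred_rule_nth:
  assumes adm: "starred_admissible k p q M E" and I: "I \<in># E" and r: "r < k"
    and x: "x \<in># nth_chain first_chain_starred (Suc r) M"
  shows "I ! r \<le> fst x"
proof -
  have "E \<noteq> {#}" using I by auto
  moreover have "hyperedge_chain E" using adm by (simp add: starred_admissible_def)
  ultimately obtain T where T: "topmost E T" using topmost_exists by blast
  have "\<forall>l\<in>{1..k}. \<forall>(i, j)\<in>#nth_chain first_chain_starred l M. T ! (l - 1) \<le> i"
    using adm T by (auto simp: starred_admissible_def)
  moreover have "Suc r \<in> {1..k}" using r by simp
  ultimately have "\<forall>(i, j)\<in>#nth_chain first_chain_starred (Suc r) M. T ! (Suc r - 1) \<le> i" by (rule bspec)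
  then have "T ! r \<le> fst x" using x by auto
  moreover have "I ! r \<le> T ! r"
    using T I r adm hyperedge_le_nth[of I k T]
    by (auto simp: topmost_def starred_admissible_def hyperedges_def)
  ultimately show ?thesis by simp
qed

text \<open>
  For each colour \<open>r\<close> the arcs of that colour, together with the hyperedge vertices of colour \<open>r\<close>
  matched with \<open>0\<close>, form a matching whose two contents are prescribed by the monomial.  For the
  admissible graph this matching is monotone: its arcs form a chain, and by the hyperedge rule the
  hyperedge vertices lie weakly before them.  Arcs have positive end points, so the matching
  determines which of its elements are arcs.
\<close>

lemma monomial_triangular:
  assumes adm: "starred_admissible k p q M E"
    and M': "arc_diagram p q M'" and E': "set_mset E' \<subseteq> hyperedges p k"
    and N1: "N1 \<in> keys (arcs_poly k M')" and N2: "N2 \<in> keys (hyper_poly Inl k E')"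
    and N: "N1 + N2 = colour_monomial (chain_colouring k M) + diag_monomial Inl k E"
  shows "arc_weight M' \<le> arc_weight M"
    and "arc_weight M' = arc_weight M \<Longrightarrow>
      M' = M \<and> N1 = colour_monomial (chain_colouring k M) \<and> N2 = diag_monomial Inl k E"
proof -
  have M: "arc_diagram p q M" and E: "set_mset E \<subseteq> hyperedges p k"
    using adm by (auto simp: starred_admissible_def)
  let ?C = "\<lambda>r. nth_chain first_chain_starred (Suc r) M"
  have Msum: "M = (\<Sum>r<k. ?C r)" using adm by (intro chains_exhaust) (auto simp: starred_admissible_def)
  obtain R where R: "image_mset snd R = M'" "\<forall>y\<in>#R. fst y < k" "N1 = colour_monomial R"
    using keys_arcs_poly[OF N1] by auto
  have Rsum: "R = (\<Sum>r<k. image_mset (Pair r) (colour_class r R))" by (rule colour_classes[OF R(2)])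
  have M'sum: "M' = (\<Sum>r<k. colour_class r R)"
    using arg_cong[OF Rsum, of "image_mset snd"] by (simp add: R(1) image_mset_sum multiset.map_comp comp_def)
  \<comment> \<open>Hyperedge vertices of colour \<open>r\<close> count as arcs to the unstarred vertex \<open>0\<close>.\<close>
  define A where "A r = colour_class r R + image_mset (\<lambda>i. (i, 0)) (row_content r N2)" for r
  define B where "B r = ?C r + image_mset (\<lambda>i. (i, 0)) (image_mset (\<lambda>I. I ! r) E)" for r
  have zero_weight: "arc_weight (image_mset (\<lambda>i. (i, 0)) X) = 0" for X :: "nat multiset"
    by (induction X) auto
  have main: "arc_weight (A r) \<le> arc_weight (B r) \<and> (arc_weight (A r) = arc_weight (B r) \<longrightarrow> A r = B r)"
    if r: "r < k" for r
  proof (rule rearrangement)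
    have rows: "image_mset fst (colour_class r R) + row_content r N2 =
        image_mset fst (?C r) + image_mset (\<lambda>I. I ! r) E"
      using arg_cong[OF N, of "row_content r"] r
      by (simp add: R(3) content_colour_monomial content_diag_monomial colour_class_chain_colouring)
    have cols: "image_mset snd (colour_class r R) = image_mset snd (?C r)"
      using arg_cong[OF N, of "col_content r"] r hyper_poly_leading(3)[OF E' N2 r]
      by (simp add: R(3) content_colour_monomial content_diag_monomial colour_class_chain_colouring)
    have "size (row_content r N2) = size E"
      using arg_cong[OF rows, of size] arg_cong[OF cols, of size] by simp
    then show "image_mset snd (A r) = image_mset snd (B r)"
      by (simp add: A_def B_def cols multiset.map_comp comp_def image_mset_const_eq)
    show "image_mset fst (A r) = image_mset fst (B r)"
      using rows by (simp add: A_def B_def multiset.map_comp comp_def)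
    have cmp: "fst x \<le> fst y \<and> snd x \<le> snd y \<or> fst y \<le> fst x \<and> snd y \<le> snd x"
      if "x \<in># ?C r" "y \<in># ?C r" for x y
      using first_chain_monotone that unfolding monotone_matching_def nth_chain_def by blast
    show "monotone_matching (B r)"
      unfolding monotone_matching_def
    proof (intro ballI)
      fix x y assume xy: "x \<in># B r" "y \<in># B r"
      have B: "z \<in># ?C r \<or> snd z = 0 \<and> (\<exists>I\<in>#E. fst z = I ! r)" if "z \<in># B r" for z
        using that by (auto simp: B_def)
      from B[OF xy(1)] B[OF xy(2)] show "fst x \<le> fst y \<and> snd x \<le> snd y \<or> fst y \<le> fst x \<and> snd y \<le> snd x"
      proof (elim disjE)
        assume "x \<in># ?C r" "y \<in># ?C r"
        then show ?thesis by (rule cmp)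
      next
        assume "x \<in># ?C r" "snd y = 0 \<and> (\<exists>I\<in>#E. fst y = I ! r)"
        then show ?thesis using starred_rule_nth[OF adm _ r, of _ x] by auto
      next
        assume "snd x = 0 \<and> (\<exists>I\<in>#E. fst x = I ! r)" "y \<in># ?C r"
        then show ?thesis using starred_rule_nth[OF adm _ r, of _ y] by auto
      next
        assume "snd x = 0 \<and> (\<exists>I\<in>#E. fst x = I ! r)" "snd y = 0 \<and> (\<exists>I\<in>#E. fst y = I ! r)"
        then show ?thesis using nat_le_linear by auto
      qed
    qed
  qed
  have wA: "arc_weight M' = (\<Sum>r<k. arc_weight (A r))"
    by (simp add: M'sum arc_weight_sum A_def zero_weight)
  have wB: "arc_weight M = (\<Sum>r<k. arc_weight (B r))"
    by (subst Msum) (simp add: arc_weight_sum B_def zero_weight)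
  show "arc_weight M' \<le> arc_weight M"
    unfolding wA wB by (rule sum_mono) (use main in auto)
  assume eq: "arc_weight M' = arc_weight M"
  have AB: "A r = B r" if r: "r < k" for r
  proof (rule ccontr)
    assume "A r \<noteq> B r"
    then have "arc_weight (A r) < arc_weight (B r)" using main[OF r] by auto
    then have "arc_weight M' < arc_weight M"
      unfolding wA wB by (intro sum_strict_mono_ex1) (use main r in auto)
    then show False using eq by simp
  qed
  have pos: "filter_mset (\<lambda>x. 0 < snd x) X = X" if "X \<subseteq># Y" "arc_diagram p q Y" for X Y :: "arc multiset"
  proof -
    have "0 < snd x" if "x \<in># X" for x
      using mset_subset_eqD[OF \<open>X \<subseteq># Y\<close> that] \<open>arc_diagram p q Y\<close> by (auto simp: arc_diagram_def)
    then show ?thesis by (simp add: filter_mset_eq_conv)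
  qed
  have zero: "filter_mset (\<lambda>x. 0 < snd x) (image_mset (\<lambda>i. (i, 0::nat)) X) = {#}" for X :: "nat multiset"
    by (induction X) auto
  have classes: "colour_class r R = ?C r" if r: "r < k" for r
  proof -
    have "?C r \<subseteq># chain_rest first_chain_starred r M"
      by (simp add: nth_chain_def first_chain_starred_def)
    then have "?C r \<subseteq># M" using chain_rest_subset by (rule subset_mset.order_trans)
    moreover have "colour_class r R \<subseteq># M'"
      unfolding colour_class_def R(1)[symmetric] by (intro image_mset_subseteq_mono) simp
    moreover have "filter_mset (\<lambda>x. 0 < snd x) (A r) = filter_mset (\<lambda>x. 0 < snd x) (B r)"
      using AB[OF r] by simp
    ultimately show ?thesis using pos M M' by (simp add: A_def B_def zero)
  qed
  have "R = chain_colouring k M"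
    by (subst Rsum) (simp add: chain_colouring_def classes)
  moreover have "M' = M" by (subst M'sum, subst Msum) (simp add: classes)
  ultimately show "M' = M \<and> N1 = colour_monomial (chain_colouring k M) \<and> N2 = diag_monomial Inl k E"
    using N R(3) by simp
qed

definition leading_monomial :: "nat \<Rightarrow> arc multiset \<Rightarrow> nat list multiset \<Rightarrow> coord_index multiset" where
  "leading_monomial k M E = colour_monomial (chain_colouring k M) + diag_monomial Inl k E"

lemma leading_coefficient_nonzero:
  assumes adm: "starred_admissible k p q M E"
  shows "lookup (arcs_poly k M * hyper_poly Inl k E) (leading_monomial k M E) \<noteq> 0"
proof -
  have M: "arc_diagram p q M" and E: "set_mset E \<subseteq> hyperedges p k"
    using adm by (auto simp: starred_admissible_def)
  let ?R = "chain_colouring k M"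
  have "image_mset snd ?R = (\<Sum>r<k. nth_chain first_chain_starred (Suc r) M)"
    by (simp add: chain_colouring_def image_mset_sum multiset.map_comp comp_def)
  also have "\<dots> = M" using adm by (intro chains_exhaust[symmetric]) (auto simp: starred_admissible_def)
  finally have RM: "image_mset snd ?R = M" .
  have "fst y < k" if "y \<in># ?R" for y
    using that by (auto simp: chain_colouring_def set_mset_sum)
  then have "0 < Re (lookup (arcs_poly k M) (colour_monomial ?R))"
    using arcs_poly_coefficient_pos[of ?R k] by (simp add: RM)
  then have "lookup (arcs_poly k M) (colour_monomial ?R) \<noteq> 0" by auto
  moreover have "lookup (arcs_poly k M * hyper_poly Inl k E) (leading_monomial k M E) =
      lookup (arcs_poly k M) (colour_monomial ?R) * lookup (hyper_poly Inl k E) (diag_monomial Inl k E)"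
    unfolding leading_monomial_def
    by (rule lookup_mult_unique) (use monomial_triangular(2)[OF adm M E] in blast)
  ultimately show ?thesis using hyper_poly_leading(2)[OF E] by simp
qed

lemma leading_triangular:
  assumes "0 < k" and adm: "starred_admissible k p q M E" and adm': "starred_admissible k p q M' E'"
    and key: "lookup (arcs_poly k M' * hyper_poly Inl k E') (leading_monomial k M E) \<noteq> 0"
  shows "arc_weight M' \<le> arc_weight M"
    and "arc_weight M' = arc_weight M \<Longrightarrow> colour_weight (diag_monomial Inl k E) \<le> colour_weight (diag_monomial Inl k E')"
    and "arc_weight M' = arc_weight M \<Longrightarrow> colour_weight (diag_monomial Inl k E) = colour_weight (diag_monomial Inl k E') \<Longrightarrow>
      M' = M \<and> E' = E"
proof -
  have M': "arc_diagram p q M'" and E': "set_mset E' \<subseteq> hyperedges p k"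
    using adm' by (auto simp: starred_admissible_def)
  obtain N1 N2 where N: "leading_monomial k M E = N1 + N2" "N1 \<in> keys (arcs_poly k M')"
      "N2 \<in> keys (hyper_poly Inl k E')"
  proof -
    have "leading_monomial k M E \<in> keys (arcs_poly k M' * hyper_poly Inl k E')"
      using key by (simp add: in_keys_iff)
    then show ?thesis using keys_mult that by blast
  qed
  note tri = monomial_triangular[OF adm M' E' N(2,3) N(1)[unfolded leading_monomial_def, symmetric]]
  show "arc_weight M' \<le> arc_weight M" by (rule tri(1))
  assume eq: "arc_weight M' = arc_weight M"
  note lead = hyper_poly_leading(1)[OF E' N(3)]
  show "colour_weight (diag_monomial Inl k E) \<le> colour_weight (diag_monomial Inl k E')"
    using lead tri(2)[OF eq] by simp
  assume "colour_weight (diag_monomial Inl k E) = colour_weight (diag_monomial Inl k E')"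
  then have "diag_monomial Inl k E = diag_monomial Inl k E'" using lead tri(2)[OF eq] by simp
  then have "image_mset (\<lambda>I. I ! r) E' = image_mset (\<lambda>I. I ! r) E" if "r < k" for r
    using content_diag_monomial(1)[OF that] by metis
  then have "E' = E"
    using adm adm' assms(1) by (intro hyperedge_chain_unique[of k E p E']) (auto simp: starred_admissible_def)
  then show "M' = M \<and> E' = E" using tri(2)[OF eq] by simp
qed

lemma lookup_scale:
  fixes P :: formal_poly
  shows "lookup (single {#} d * P) N = d * lookup P N"
proof -
  have "lookup (single {#} d * P) ({#} + N) =
      lookup (single {#} d :: formal_poly) {#} * lookup P N"
    by (rule lookup_mult_unique) (auto split: if_splits)
  then show ?thesis by simp
qed

text \<open>
  Triangularity at work: among the graphs with a nonzero coefficient take one with lightest arcs, and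
  among those one whose hyperedges have the largest weight.  Only this graph contributes to the
  coefficient of its own leading monomial.
\<close>

theorem admissible_coefficients_vanish:
  assumes "0 < k" and fin: "finite S" and S: "\<And>M E. (M, E) \<in> S \<Longrightarrow> starred_admissible k p q M E"
    and vanish: "\<And>M E. (M, E) \<in> S \<Longrightarrow> lookup (\<Sum>(M', E')\<in>S.
      single {#} (c (M', E')) * (arcs_poly k M' * hyper_poly Inl k E')) (leading_monomial k M E) = 0"
  shows "\<forall>x\<in>S. c x = 0"
proof (rule ccontr)
  assume "\<not> (\<forall>x\<in>S. c x = 0)"
  define S0 where "S0 = {x \<in> S. c x \<noteq> 0}"
  have "S0 \<noteq> {}" "finite S0" using \<open>\<not> _\<close> fin by (auto simp: S0_def)
  define m where "m = Min ((\<lambda>x. arc_weight (fst x)) ` S0)"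
  define S1 where "S1 = {x \<in> S0. arc_weight (fst x) = m}"
  have "m \<in> (\<lambda>x. arc_weight (fst x)) ` S0" unfolding m_def using \<open>S0 \<noteq> {}\<close> \<open>finite S0\<close> by (intro Min_in) auto
  then have "S1 \<noteq> {}" "finite S1" using \<open>finite S0\<close> by (auto simp: S1_def)
  obtain y where y: "y \<in> S1" and ymax: "\<And>x. x \<in> S1 \<Longrightarrow>
      colour_weight (diag_monomial Inl k (snd x)) \<le> colour_weight (diag_monomial Inl k (snd y))"
    using ex_has_greatest_nat_finite[OF \<open>finite S1\<close> \<open>S1 \<noteq> {}\<close>, of "\<lambda>x. colour_weight (diag_monomial Inl k (snd x))"] by blast
  obtain M E where ME: "y = (M, E)" by (cases y)
  have yS: "(M, E) \<in> S" "c (M, E) \<noteq> 0" using y by (auto simp: ME S1_def S0_def)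
  have "c (M', E') * lookup (arcs_poly k M' * hyper_poly Inl k E') (leading_monomial k M E) = 0"
    if x: "(M', E') \<in> S - {(M, E)}" for M' E'
  proof (rule ccontr)
    assume n: "\<not> ?thesis"
    then have 0: "(M', E') \<in> S0" using x by (auto simp: S0_def)
    note tri = leading_triangular[OF \<open>0 < k\<close> S[OF yS(1)] S, of M' E']
    have "arc_weight (fst (M', E')) \<in> (\<lambda>x. arc_weight (fst x)) ` S0" using 0 by (rule imageI)
    then have "m \<le> arc_weight M'" unfolding m_def using \<open>finite S0\<close> by (intro Min_le) simp_all
    moreover have "arc_weight M = m" using y by (simp add: S1_def ME)
    ultimately have eq: "arc_weight M' = arc_weight M" using tri(1) x n by auto
    then have "(M', E') \<in> S1" using 0 \<open>arc_weight M = m\<close> by (simp add: S1_def)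
    then have "colour_weight (diag_monomial Inl k E') \<le> colour_weight (diag_monomial Inl k E)"
      using ymax[of "(M', E')"] by (simp add: ME)
    then have "M' = M \<and> E' = E"
      using tri(2) tri(3) eq x n by (metis DiffD1 antisym mult_eq_0_iff)
    then show False using x by simp
  qed
  note z0 = this
  have zero: "(\<Sum>(M', E')\<in>S - {(M, E)}. c (M', E') *
      lookup (arcs_poly k M' * hyper_poly Inl k E') (leading_monomial k M E)) = 0"
  proof (rule sum.neutral, rule ballI)
    fix x assume x: "x \<in> S - {(M, E)}"
    obtain M' E' where "x = (M', E')" by (cases x)
    then show "(case x of (M', E') \<Rightarrow> c (M', E') *
        lookup (arcs_poly k M' * hyper_poly Inl k E') (leading_monomial k M E)) = 0"
      using z0[of M' E'] x by simp
  qed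
  have "0 = (\<Sum>(M', E')\<in>S. c (M', E') *
      lookup (arcs_poly k M' * hyper_poly Inl k E') (leading_monomial k M E))"
    using vanish[OF yS(1)] by (simp add: lookup_sum case_prod_unfold lookup_scale)
  also have "\<dots> = c (M, E) * lookup (arcs_poly k M * hyper_poly Inl k E) (leading_monomial k M E)"
    using zero by (subst sum.remove[OF fin yS(1)]) (simp add: case_prod_unfold)
  finally show False using yS(2) leading_coefficient_nonzero[OF S[OF yS(1)]] by simp
qed

section \<open>Normalizing the first covectors by Cramer's rule\<close>

definition starred_span :: "nat \<Rightarrow> nat \<Rightarrow> nat \<Rightarrow> nat \<Rightarrow> (coords \<Rightarrow> complex) set" where
  "starred_span k p q n = fun_space.span
    ((\<lambda>(M, E). starred_fun k M E) ` {(M, E). starred_admissible k p q M E \<and> size E = n})"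

lemma span_family:
  assumes "f \<in> fun_space.span (F ` G)"
  obtains S c where "finite S" "S \<subseteq> G" "\<And>a. f a = (\<Sum>x\<in>S. c x * F x a)"
proof -
  obtain t r where t: "finite t" "t \<subseteq> F ` G" "f = (\<Sum>v\<in>t. fun_scale (r v) v)"
    using assms unfolding fun_space.span_explicit by auto
  define g where "g = inv_into G F"
  have g: "g v \<in> G" "F (g v) = v" if "v \<in> t" for v
    using t(2) that by (auto simp: g_def inv_into_into f_inv_into_f)
  have inj: "inj_on g t" by (rule inj_onI) (metis g(2))
  have ev: "(\<Sum>v\<in>A. fun_scale (r v) v) a = (\<Sum>v\<in>A. r v * v a)" for A a
    by (induction A rule: infinite_finite_induct) (auto simp: fun_scale_def)
  have "f a = (\<Sum>x\<in>g ` t. r (F x) * F x a)" for a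
    unfolding t(3) ev sum.reindex[OF inj] by (rule sum.cong) (auto simp: g)
  then show ?thesis using t(1) g(1) by (intro that[of "g ` t" "\<lambda>x. r (F x)"]) auto
qed

lemma span_of_sum:
  assumes "\<And>x. x \<in> S \<Longrightarrow> F x \<in> fun_space.span B"
  shows "(\<lambda>a. \<Sum>x\<in>S. c x * F x a) \<in> fun_space.span B"
proof -
  have "(\<Sum>x\<in>S. fun_scale (c x) (F x)) a = (\<Sum>x\<in>S. c x * F x a)" for a
    by (induction S rule: infinite_finite_induct) (auto simp: fun_scale_def)
  then have "(\<lambda>a. \<Sum>x\<in>S. c x * F x a) = (\<Sum>x\<in>S. fun_scale (c x) (F x))" by (intro ext) simp
  then show ?thesis using assms by (simp add: fun_space.span_sum fun_space.span_scale)
qed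

lemma starred_straightening:
  assumes "arc_diagram p q M" "set_mset E \<subseteq> hyperedges p k"
  shows "starred_fun k M E \<in> starred_span k p q (size E)"
proof -
  have "{starred_fun k M' E' | M' E'. starred_admissible k p q M' E' \<and> size M' = size M \<and> size E' = size E}
      \<subseteq> (\<lambda>(M, E). starred_fun k M E) ` {(M', E'). starred_admissible k p q M' E' \<and> size E' = size E}"
    by force
  from fun_space.span_mono[OF this] show ?thesis
    using straightening[OF assms] unfolding starred_span_def admissible_span_def by blast
qed

lemma bracket_products_span:
  assumes M: "arc_diagram p q M" and U: "\<And>u. u \<in># U \<Longrightarrow> u ` {..<k} \<subseteq> {1..p}"
    and E: "set_mset E \<subseteq> hyperedges p k"
  shows "(\<lambda>a. starred_fun k M E a * (\<Prod>u\<in>#U. bracket k u a)) \<in> starred_span k p q (size E + size U)"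
  using U E
proof (induction U arbitrary: E)
  case empty
  then show ?case using starred_straightening[OF M] by simp
next
  case (add u U)
  have "u ` {..<k} \<subseteq> {1..p}" using add.prems(1) by simp
  from bracket_sort[OF this] consider "\<forall>a. bracket k u a = 0"
    | L \<epsilon> where "L \<in> hyperedges p k" "\<forall>a. bracket k u a = \<epsilon> * bracket k ((!) L) a" by auto
  then show ?case
  proof cases
    case 1
    then have "(\<lambda>a. starred_fun k M E a * (\<Prod>u\<in>#add_mset u U. bracket k u a)) = 0" by (simp add: fun_eq_iff)
    then show ?thesis unfolding starred_span_def using fun_space.span_zero by metis
  next
    case (2 L \<epsilon>)
    have "(\<lambda>a. starred_fun k M (add_mset L E) a * (\<Prod>u\<in>#U. bracket k u a)) \<in>
        starred_span k p q (size (add_mset L E) + size U)"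
      by (rule add.IH) (use add.prems 2 in auto)
    then have "fun_scale \<epsilon> (\<lambda>a. starred_fun k M (add_mset L E) a * (\<Prod>u\<in>#U. bracket k u a)) \<in>
        starred_span k p q (size (add_mset L E) + size U)"
      unfolding starred_span_def by (rule fun_space.span_scale)
    moreover have "fun_scale \<epsilon> (\<lambda>a. starred_fun k M (add_mset L E) a * (\<Prod>u\<in>#U. bracket k u a)) =
        (\<lambda>a. starred_fun k M E a * (\<Prod>u\<in>#add_mset u U. bracket k u a))"
      using 2(2) by (simp add: fun_scale_def starred_fun_add_bracket fun_eq_iff)
    ultimately show ?thesis by simp
  qed
qed

text \<open>
  The action of a matrix \<open>g\<close> with inverse \<open>h\<close> on points: covectors are multiplied by \<open>g\<close> from the right,
  vectors by \<open>h\<close> from the left.  Keeping \<open>h\<close> as a separate argument avoids inverses.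
\<close>

definition mat_act :: "nat \<Rightarrow> (nat \<Rightarrow> nat \<Rightarrow> complex) \<Rightarrow> (nat \<Rightarrow> nat \<Rightarrow> complex) \<Rightarrow> coords \<Rightarrow> coords" where
  "mat_act k g h a = (\<lambda>x. case x of
      Inl y \<Rightarrow> (\<Sum>r<k. a (Inl (fst y, r)) * g r (snd y))
    | Inr y \<Rightarrow> (\<Sum>c<k. h (snd y) c * a (Inr (fst y, c))))"

definition inverse_pair :: "nat \<Rightarrow> (nat \<Rightarrow> nat \<Rightarrow> complex) \<Rightarrow> (nat \<Rightarrow> nat \<Rightarrow> complex) \<Rightarrow> bool" where
  "inverse_pair k g h \<longleftrightarrow> mat k k (\<lambda>(r, c). g r c) * mat k k (\<lambda>(r, c). h r c) = 1\<^sub>m k"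

definition entry_det :: "nat \<Rightarrow> (nat \<Rightarrow> nat \<Rightarrow> complex) \<Rightarrow> complex" where
  "entry_det k g = Determinant.det (mat k k (\<lambda>(r, c). g r c))"

definition semi_invariant_poly :: "nat \<Rightarrow> int \<Rightarrow> formal_poly \<Rightarrow> bool" where
  "semi_invariant_poly k m P \<longleftrightarrow>
    (\<forall>g h a. inverse_pair k g h \<longrightarrow> ev (mat_act k g h a) P = entry_det k g powi m * ev a P)"

text \<open>
  After normalization the coordinate \<open>c\<close> of covector \<open>i\<close> is the bracket of the first \<open>k\<close> covectors with
  the one in column \<open>c\<close> replaced by \<open>i\<close>, divided by \<open>bracket k Suc\<close>.  The coordinate \<open>r\<close> of vector \<open>j\<close>
  becomes the arc from the covector with number \<open>Suc r\<close> to \<open>j\<close>.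
\<close>

definition cramer_brackets :: "coord_index multiset \<Rightarrow> (nat \<Rightarrow> nat) multiset" where
  "cramer_brackets N = (\<Sum>x\<in>#N. case x of Inl y \<Rightarrow> {#Suc(snd y := fst y)#} | Inr y \<Rightarrow> {#})"

definition cramer_arcs :: "coord_index multiset \<Rightarrow> arc multiset" where
  "cramer_arcs N = (\<Sum>x\<in>#N. case x of Inr y \<Rightarrow> {#(Suc (snd y), fst y)#} | Inl y \<Rightarrow> {#})"

text \<open>
  \<open>g\<close> is the inverse of the matrix formed by the first \<open>k\<close> covectors, written with the adjugate matrix.
\<close>

lemma normalizing_pair:
  assumes D: "bracket k Suc a \<noteq> 0"
  obtains g h where "inverse_pair k g h" "entry_det k g * bracket k Suc a = 1"
    "\<And>i c. c < k \<Longrightarrow> mat_act k g h a (Inl (i, c)) * bracket k Suc a = bracket k (Suc(c := i)) a"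
    "\<And>j r. r < k \<Longrightarrow> mat_act k g h a (Inr (j, r)) = pairing k (Suc r) j a"
proof -
  define A where "A = mat k k (\<lambda>(r, c). a (Inl (Suc c, r)))"
  have A: "A \<in> carrier_mat k k" by (simp add: A_def)
  have dA: "Determinant.det A = bracket k Suc a" by (simp add: A_def bracket_def)
  define B where "B = (1 / Determinant.det A) \<cdot>\<^sub>m adj_mat A"
  have B: "B \<in> carrier_mat k k" using adj_mat(1)[OF A] by (simp add: B_def)
  have AB: "A * B = 1\<^sub>m k"
  proof -
    have "A * B = (1 / Determinant.det A) \<cdot>\<^sub>m (A * adj_mat A)"
      unfolding B_def using A adj_mat(1)[OF A] by (simp add: mult_smult_distrib)
    also have "\<dots> = 1\<^sub>m k"
      unfolding adj_mat(2)[OF A] dA using D by (intro eq_matI) auto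
    finally show ?thesis .
  qed
  have BA: "B * A = 1\<^sub>m k" by (rule mat_mult_left_right_inverse[OF A B AB])
  define g where "g r c = B $$ (c, r)" for r c
  define h where "h r c = A $$ (c, r)" for r c
  have G: "mat k k (\<lambda>(r, c). g r c) = transpose_mat B" and H: "mat k k (\<lambda>(r, c). h r c) = transpose_mat A"
    using A B by (auto simp: g_def h_def intro!: eq_matI)
  have "transpose_mat B * transpose_mat A = 1\<^sub>m k"
    using transpose_mult[OF A B] AB by (simp add: transpose_one)
  then have 1: "inverse_pair k g h" by (simp add: inverse_pair_def G H)
  have 2: "entry_det k g * bracket k Suc a = 1"
  proof -
    have "Determinant.det B * Determinant.det A = 1" using det_mult[OF B A] BA by simp
    then show ?thesis by (simp add: entry_det_def G det_transpose[OF B] dA)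
  qed
  have 3: "mat_act k g h a (Inl (i, c)) * bracket k Suc a = bracket k (Suc(c := i)) a" if c: "c < k" for i c
  proof -
    define b where "b = vec k (\<lambda>r. a (Inl (i, r)))"
    have b: "b \<in> carrier_vec k" by (simp add: b_def)
    have x: "B *\<^sub>v b \<in> carrier_vec k" using B b by simp
    have Ax: "A *\<^sub>v (B *\<^sub>v b) = b"
      using assoc_mult_mat_vec[OF A B b] AB b by simp
    have "mat_act k g h a (Inl (i, c)) = (B *\<^sub>v b) $ c"
      using B b c by (simp add: mat_act_def g_def scalar_prod_def b_def atLeast0LessThan mult.commute)
    moreover have "Determinant.det (replace_col A b c) = (B *\<^sub>v b) $ c * Determinant.det A"
      using cramer_lemma_mat[OF A x c] by (simp add: Ax)
    moreover have "replace_col A b c = mat k k (\<lambda>(r, c'). a (Inl ((Suc(c := i)) c', r)))"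
      by (rule eq_matI) (auto simp: replace_col_def A_def b_def)
    ultimately show ?thesis by (simp add: dA bracket_def)
  qed
  have 4: "mat_act k g h a (Inr (j, r)) = pairing k (Suc r) j a" if "r < k" for j r
    using that by (simp add: mat_act_def h_def A_def pairing_def)
  show ?thesis by (rule that[OF 1 2 3 4])
qed

lemma cramer_monomial:
  assumes "\<And>i c. c < k \<Longrightarrow> a' (Inl (i, c)) * bracket k Suc a = bracket k (Suc(c := i)) a"
    and "\<And>j r. r < k \<Longrightarrow> a' (Inr (j, r)) = pairing k (Suc r) j a"
    and "set_mset N \<subseteq> coord_indices k p q"
  shows "(\<Prod>x\<in>#N. a' x) * bracket k Suc a ^ size (cramer_brackets N) =
    starred_fun k (cramer_arcs N) {#} a * (\<Prod>u\<in>#cramer_brackets N. bracket k u a)"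
  using assms(3)
proof (induction N)
  case empty
  then show ?case by (simp add: cramer_brackets_def cramer_arcs_def starred_fun_def)
next
  case (add x N)
  show ?case
  proof (cases x)
    case (Inl y)
    then have "snd y < k" using add.prems by (auto simp: coord_indices_def)
    then have *: "a' x * bracket k Suc a = bracket k (Suc(snd y := fst y)) a"
      using assms(1)[of "snd y" "fst y"] by (simp add: Inl)
    have "(\<Prod>x\<in>#add_mset x N. a' x) * bracket k Suc a ^ size (cramer_brackets (add_mset x N)) =
      (a' x * bracket k Suc a) * ((\<Prod>x\<in>#N. a' x) * bracket k Suc a ^ size (cramer_brackets N))"
      by (simp add: cramer_brackets_def Inl)
    also have "\<dots> = starred_fun k (cramer_arcs (add_mset x N)) {#} a *
        (\<Prod>u\<in>#cramer_brackets (add_mset x N). bracket k u a)"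
      using add by (simp add: * ) (simp add: cramer_brackets_def cramer_arcs_def Inl)
    finally show ?thesis .
  next
    case (Inr y)
    then have "snd y < k" using add.prems by (auto simp: coord_indices_def)
    then have "a' x = pairing k (Suc (snd y)) (fst y) a"
      using assms(2)[of "snd y" "fst y"] by (simp add: Inr)
    then show ?thesis using add
      by (simp add: cramer_brackets_def cramer_arcs_def Inr starred_fun_def mult.assoc)
  qed
qed

lemma size_cramer_brackets: "size (cramer_brackets N) \<le> size N"
  by (induction N) (auto simp: cramer_brackets_def split: sum.splits)

lemma in_cramer_brackets: "u \<in># cramer_brackets N \<Longrightarrow> \<exists>y. Inl y \<in># N \<and> u = Suc(snd y := fst y)"
proof -
  assume "u \<in># cramer_brackets N"
  then obtain x where "x \<in># N" "u \<in># (case x of Inl y \<Rightarrow> {#Suc(snd y := fst y)#} | Inr y \<Rightarrow> {#})"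
    unfolding cramer_brackets_def by auto
  then show "\<exists>y. Inl y \<in># N \<and> u = Suc(snd y := fst y)" by (cases x) force+
qed

text \<open>
  One factor \<open>bracket k Suc a\<close> more than needed to clear the denominators makes the identity true also
  where this bracket vanishes, since then both sides are zero.
\<close>

lemma localized_semi_invariant:
  assumes k: "0 < k" "k \<le> p" and P: "\<And>N. N \<in> keys P \<Longrightarrow> set_mset N \<subseteq> coord_indices k p q"
    and inv: "semi_invariant_poly k (int m) P"
  shows "\<exists>L. (\<lambda>a. bracket k Suc a ^ L * ev a P) \<in> starred_span k p q (m + L)"
proof -
  \<comment> \<open>an upper bound for the exponents of all denominators\<close>
  define A where "A = (\<Sum>N\<in>keys P. size N)"
  let ?e = "\<lambda>N. size (cramer_brackets N)"
  have eA: "?e N \<le> A" if "N \<in> keys P" for N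
  proof -
    have "size N \<le> A" unfolding A_def by (rule member_le_sum) (use that in auto)
    then show ?thesis using size_cramer_brackets[of N] by simp
  qed
  define T where "T N a = starred_fun k (cramer_arcs N) {#} a *
    (\<Prod>u\<in>#cramer_brackets N + replicate_mset (Suc (m + A - ?e N)) Suc. bracket k u a)" for N a
  have T: "T N \<in> starred_span k p q (m + Suc A)" if N: "N \<in> keys P" for N
  proof -
    have "arc_diagram p q (cramer_arcs N)"
      using P[OF N] k(2) unfolding arc_diagram_def cramer_arcs_def
      by (fastforce simp: coord_indices_def split: sum.splits)
    moreover have "u ` {..<k} \<subseteq> {1..p}" if u: "u \<in># cramer_brackets N + replicate_mset (Suc (m + A - ?e N)) Suc" for u
    proof -
      have "u = Suc \<or> u \<in># cramer_brackets N" using u by (auto split: if_splits)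
      then consider "u = Suc" | y where "Inl y \<in># N" "u = Suc(snd y := fst y)"
        using in_cramer_brackets by blast
      then show ?thesis
      proof cases
        case 1
        then show ?thesis using k by auto
      next
        case 2
        then have "fst y \<in> {1..p}" using P[OF N] by (auto simp: coord_indices_def)
        then show ?thesis using 2 k by auto
      qed
    qed
    ultimately have "T N \<in> starred_span k p q
        (size ({#} :: nat list multiset) + size (cramer_brackets N + replicate_mset (Suc (m + A - ?e N)) Suc))"
      unfolding T_def by (rule bracket_products_span) auto
    moreover have "size ({#} :: nat list multiset) + size (cramer_brackets N + replicate_mset (Suc (m + A - ?e N)) Suc) = m + Suc A"
      using eA[OF N] by simp
    ultimately show ?thesis by simp
  qed
  have "bracket k Suc a ^ Suc A * ev a P = (\<Sum>N\<in>keys P. lookup P N * T N a)" for a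
  proof (cases "bracket k Suc a = 0")
    case True
    then show ?thesis by (simp add: T_def)
  next
    case False
    let ?D = "bracket k Suc a"
    obtain g h where gh: "inverse_pair k g h" "entry_det k g * ?D = 1"
      and 3: "\<And>i c. c < k \<Longrightarrow> mat_act k g h a (Inl (i, c)) * ?D = bracket k (Suc(c := i)) a"
      and 4: "\<And>j r. r < k \<Longrightarrow> mat_act k g h a (Inr (j, r)) = pairing k (Suc r) j a"
      using normalizing_pair[OF False] by blast
    have "ev (mat_act k g h a) P = entry_det k g ^ m * ev a P"
      using inv gh(1) unfolding semi_invariant_poly_def by simp
    have m: "?D ^ m * ev (mat_act k g h a) P = ev a P"
    proof -
      have "?D ^ m * (entry_det k g ^ m * ev a P) = (entry_det k g * ?D) ^ m * ev a P"
        by (simp add: power_mult_distrib mult.commute)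
      then show ?thesis by (simp add: gh(2) \<open>ev (mat_act k g h a) P = entry_det k g ^ m * ev a P\<close>)
    qed
    have "?D ^ Suc A * ev a P = ?D ^ (m + Suc A) * ev (mat_act k g h a) P"
      unfolding m[symmetric] power_add by (simp only: mult_ac)
    also have "\<dots> = (\<Sum>N\<in>keys P. lookup P N * T N a)"
      unfolding ev_def sum_distrib_left
    proof (rule sum.cong[OF refl])
      fix N assume N: "N \<in> keys P"
      have "m + Suc A = ?e N + Suc (m + A - ?e N)" using eA[OF N] by simp
      then have "?D ^ (m + Suc A) * (\<Prod>x\<in>#N. mat_act k g h a x) =
          ((\<Prod>x\<in>#N. mat_act k g h a x) * ?D ^ ?e N) * ?D ^ Suc (m + A - ?e N)"
        by (simp only: power_add mult_ac)
      also have "\<dots> = T N a"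
        using cramer_monomial[of k "mat_act k g h a" a N p q, OF 3 4 P[OF N]]
        by (simp add: T_def mult.assoc)
      finally show "?D ^ (m + Suc A) * (lookup P N * (\<Prod>x\<in>#N. mat_act k g h a x)) =
          lookup P N * T N a" by (simp add: mult.left_commute)
    qed
    finally show ?thesis .
  qed
  then have "(\<lambda>a. bracket k Suc a ^ Suc A * ev a P) \<in> starred_span k p q (m + Suc A)"
    using span_of_sum[of "keys P" T _ "lookup P"] T
    unfolding starred_span_def by presburger
  then show ?thesis by blast
qed

lemma ev_line: "\<exists>f. \<forall>t. ev (\<lambda>x. (1 - t) * a x + t * e x) P = poly f t"
proof -
  have prod: "(\<Prod>x\<in>#N. (1 - t) * a x + t * e x) = poly (\<Prod>x\<in>#N. [:a x, e x - a x:]) t" for N t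
    by (induction N) (auto simp: algebra_simps)
  show ?thesis
    by (intro exI[of _ "\<Sum>N\<in>keys P. Polynomial.smult (lookup P N) (\<Prod>x\<in>#N. [:a x, e x - a x:])"])
      (simp add: ev_def poly_sum prod)
qed

definition minimal_edge :: "nat \<Rightarrow> nat list" where
  "minimal_edge k = [1..<Suc k]"

lemma minimal_edge_nth: "length (minimal_edge k) = k" "c < k \<Longrightarrow> minimal_edge k ! c = Suc c"
  by (simp_all add: minimal_edge_def del: upt_Suc)

lemma minimal_bracket: "bracket k ((!) (minimal_edge k)) a = bracket k Suc a"
  by (rule bracket_cong) (simp add: minimal_edge_nth)

text \<open>
  On the line from \<open>a\<close> to a point \<open>e\<close> where the bracket is \<open>1\<close>, both factors are polynomials in one
  variable, and the one that belongs to the bracket is not zero.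
\<close>

lemma bracket_cancel:
  assumes "\<And>a. bracket k Suc a * ev a P = 0"
  shows "ev a P = 0"
proof -
  \<comment> \<open>the point whose first \<open>k\<close> covectors are the dual basis\<close>
  define e :: coords where "e x = (case x of Inl y \<Rightarrow> if fst y = Suc (snd y) then 1 else 0 | Inr y \<Rightarrow> 0)" for x
  have "mat k k (\<lambda>(r, c). e (Inl (Suc c, r))) = 1\<^sub>m k" by (rule eq_matI) (auto simp: e_def)
  then have e1: "bracket k Suc e = 1" by (simp add: bracket_def)
  obtain f where f: "\<And>t. ev (\<lambda>x. (1 - t) * a x + t * e x) P = poly f t" using ev_line by metis
  obtain d where d: "\<And>t. ev (\<lambda>x. (1 - t) * a x + t * e x) (arcs_poly k {#} * hyper_poly Inl k {#minimal_edge k#}) = poly d t"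
    using ev_line by metis
  have d': "poly d t = bracket k Suc (\<lambda>x. (1 - t) * a x + t * e x)" for t
    unfolding d[symmetric] ev_starred by (simp add: starred_fun_def minimal_bracket)
  have "poly (d * f) t = 0" for t using assms by (simp add: d' f[symmetric])
  then have "d * f = 0" using poly_all_0_iff_0 by blast
  moreover have "d \<noteq> 0" using d'[of 1] e1 by auto
  ultimately have "f = 0" by simp
  then show ?thesis using f[of 0] by simp
qed

section \<open>Removing denominators\<close>

text \<open>
  Setting these coordinates to zero makes the matrix of the first \<open>k\<close> covectors triangular with a
  zero in the last diagonal position, so its determinant vanishes.
\<close>

definition vanishing_locus :: "nat \<Rightarrow> coord_index set" where
  "vanishing_locus k = {Inl (i, r) | i r. i \<le> r} \<union> {Inl (k, k - 1)}"

lemma bracket_vanishing_locus: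
  assumes k: "0 < k" and a: "\<forall>x\<in>vanishing_locus k. a x = 0"
  shows "bracket k Suc a = 0"
  unfolding bracket_leibniz
proof (rule sum.neutral, rule ballI)
  fix \<pi> assume "\<pi> \<in> {\<pi>. \<pi> permutes {..<k}}"
  then have \<pi>: "\<pi> permutes {..<k}" by simp
  have "\<exists>c<k. a (Inl (Suc c, \<pi> c)) = 0"
  proof (cases "\<forall>c<k. \<pi> c \<le> c")
    case True
    then have "\<pi> = id" using permutes_natset_le[OF \<pi>] by auto
    then have "a (Inl (Suc (k - 1), \<pi> (k - 1))) = 0" using a k by (auto simp: vanishing_locus_def)
    then show ?thesis using k by (intro exI[of _ "k - 1"]) simp
  next
    case False
    then obtain c where "c < k" "Suc c \<le> \<pi> c" by (auto simp: not_le)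
    then show ?thesis using a by (auto simp: vanishing_locus_def)
  qed
  then have "(\<Prod>c<k. a (Inl (Suc c, \<pi> c))) = 0" by auto
  then show "of_int (sign \<pi>) * (\<Prod>c<k. a (Inl (Suc c, \<pi> c))) = 0" by simp
qed

lemma nth_chain_depth:
  assumes M: "arc_diagram p q M" and x: "x \<in># nth_chain first_chain_starred (Suc r) M"
  shows "Suc r \<le> fst x"
proof -
  obtain f where f: "f r = x" "\<forall>s\<le>r. f s \<in># M"
    "\<forall>s t. s < t \<and> t \<le> r \<longrightarrow> fst (f s) < fst (f t) \<and> snd (f t) < snd (f s)"
    using nth_chain_nesting[OF x] by auto
  have "Suc s \<le> fst (f s)" if "s \<le> r" for s
    using that
  proof (induction s)
    case 0
    have "f 0 \<in> {1..p} \<times> {1..q}" using f(2) M by (auto simp: arc_diagram_def)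
    then show ?case by (auto simp: mem_Times_iff)
  next
    case (Suc s)
    then show ?case using f(3)[rule_format, of s "Suc s"] by simp
  qed
  then show ?thesis using f(1) by auto
qed

lemma minimal_edge_unique:
  assumes "0 < k" "I \<in> hyperedges p k" "I ! (k - 1) \<le> k"
  shows "I = minimal_edge k"
proof (rule nth_equalityI)
  note In = hyperedges_nth[OF assms(2)]
  show "length I = length (minimal_edge k)" by (simp add: In(1) minimal_edge_nth)
  fix c assume "c < length I"
  then have c: "c < k" by (simp add: In(1))
  have "I ! (k - 1 - d) \<le> k - d" if "d < k" for d
    using that
  proof (induction d)
    case (Suc d)
    then have "k - 1 - Suc d < k - 1 - d" by arith
    then show ?case using Suc In(3)[of "k - 1 - Suc d" "k - 1 - d"] by simp
  qed (use assms in simp)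
  from this[of "k - 1 - c"] have "I ! c \<le> Suc c" using c by simp
  then show "I ! c = minimal_edge k ! c" using In(5)[OF c] c by (simp add: minimal_edge_nth)
qed

text \<open>
  An arc of colour \<open>r\<close> (counted from \<open>0\<close>) is nested inside \<open>r\<close> others, so it starts at \<open>Suc r\<close> or later,
  and so does the vertex in position \<open>r\<close> of a hyperedge.  The vertex \<open>k\<close> with the last colour could only come
  from the minimal hyperedge, or from an arc; in the latter case the hyperedge rule makes every
  hyperedge minimal.
\<close>

lemma leading_monomial_avoids:
  assumes k: "0 < k" and adm: "starred_admissible k p q M E" and E: "E \<noteq> {#}" "minimal_edge k \<notin># E"
  shows "set_mset (leading_monomial k M E) \<inter> vanishing_locus k = {}"
proof -
  have M: "arc_diagram p q M" and EH: "set_mset E \<subseteq> hyperedges p k"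
    using adm by (auto simp: starred_admissible_def)
  have E_last: "k < I ! (k - 1)" if I: "I \<in># E" for I
  proof (rule ccontr)
    assume "\<not> k < I ! (k - 1)"
    then have "I = minimal_edge k" using minimal_edge_unique[OF k, of I p] EH I by auto
    then show False using I E(2) by simp
  qed
  have arcs_ok: "r < i \<and> (i, r) \<noteq> (k, k - 1)" if "r < k" "x \<in># nth_chain first_chain_starred (Suc r) M" "i = fst x" for r x i
  proof
    show "r < i" using nth_chain_depth[OF M that(2)] that(3) by simp
    show "(i, r) \<noteq> (k, k - 1)"
    proof
      assume eq: "(i, r) = (k, k - 1)"
      obtain I where I: "I \<in># E" using E(1) by auto
      then have "I ! r \<le> fst x" using starred_rule_nth[OF adm I that(1,2)] by simp
      then show False using E_last[OF I] eq that(3) by simp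
    qed
  qed
  have edges_ok: "r < I ! r \<and> (I ! r, r) \<noteq> (k, k - 1)" if "I \<in># E" "r < k" for I r
    using hyperedges_nth(5)[of I p k r] EH that E_last[OF that(1)] by auto
  show ?thesis
  proof (rule equals0I)
    fix z assume z: "z \<in> set_mset (leading_monomial k M E) \<inter> vanishing_locus k"
    then consider (arc) r x where "r < k" "x \<in># nth_chain first_chain_starred (Suc r) M" "z = Inl (fst x, r)"
      | (edge) I r where "I \<in># E" "r < k" "z = Inl (I ! r, r)"
      unfolding leading_monomial_def colour_monomial_def diag_monomial_def chain_colouring_def
      by (auto simp: set_mset_sum vanishing_locus_def)
    then show False
    proof cases
      case arc
      then show ?thesis using arcs_ok[of r x "fst x"] z by (auto simp: vanishing_locus_def)
    next
      case edge
      then show ?thesis using edges_ok[of I r] z by (auto simp: vanishing_locus_def)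
    qed
  qed
qed

text \<open>
  The minimal hyperedge lies below every other one, so a hyperedge that is topmost without it is also
  topmost with it, and the hyperedge rule stays the same.
\<close>

lemma remove_minimal_edge:
  assumes adm: "starred_admissible k p q M (add_mset (minimal_edge k) E)"
  shows "starred_admissible k p q M E"
proof -
  have EH: "set_mset E \<subseteq> hyperedges p k" using adm by (auto simp: starred_admissible_def)
  have "topmost (add_mset (minimal_edge k) E) T" if T: "topmost E T" for T
  proof -
    have "T \<in> hyperedges p k" using T EH by (auto simp: topmost_def)
    then have "hyperedge_le (minimal_edge k) T"
      using hyperedges_nth[of T p k] by (subst hyperedge_le_nth[of _ k]) (auto simp: minimal_edge_nth)
    then show ?thesis using T by (simp add: topmost_def)
  qed
  then show ?thesis using adm unfolding starred_admissible_def hyperedge_chain_def by auto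
qed

text \<open>
  Subtracting the contributions of the graphs with a minimal hyperedge, each of which is the bracket times
  an admissible graph, leaves a combination of graphs without one that vanishes where the bracket
  does.  On the vanishing locus their leading monomials survive, so all coefficients are zero.
\<close>

lemma saturation:
  assumes k: "0 < k" and D: "(\<lambda>a. bracket k Suc a * ev a P) \<in> starred_span k p q (Suc n)"
  shows "(\<lambda>a. ev a P) \<in> starred_span k p q n"
proof -
  let ?F = "\<lambda>(M, E). starred_fun k M E"
  obtain S c where S: "finite S" "S \<subseteq> {(M, E). starred_admissible k p q M E \<and> size E = Suc n}"
    and sum: "\<And>a. bracket k Suc a * ev a P = (\<Sum>x\<in>S. c x * ?F x a)"
    using span_family[OF D[unfolded starred_span_def]] by blast
  define S1 where "S1 = {x \<in> S. minimal_edge k \<in># snd x}"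
  define drop where "drop E = E - {#minimal_edge k#}" for E
  have S1: "snd x = add_mset (minimal_edge k) (drop (snd x))" if "x \<in> S1" for x
    using that by (simp add: S1_def drop_def)
  define poly where "poly x = single {#} (c x) * (arcs_poly k (fst x) * hyper_poly Inl k (snd x))" for x
  have ev_poly: "ev a (poly x) = c x * ?F x a" for a x
    unfolding poly_def by (subst ev_mult) (simp add: ev_starred case_prod_beta del: ev_mult)
  define P' where "P' = P - (\<Sum>x\<in>S1. single {#} (c x) * (arcs_poly k (fst x) * hyper_poly Inl k (drop (snd x))))"
  have ev_P': "ev a P' = ev a P - (\<Sum>x\<in>S1. c x * starred_fun k (fst x) (drop (snd x)) a)" for a
    unfolding P'_def ev_diff ev_sum by (subst ev_mult) (simp add: ev_starred del: ev_mult)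
  have F1: "?F x a = bracket k Suc a * starred_fun k (fst x) (drop (snd x)) a" if "x \<in> S1" for x a
  proof -
    have "?F x a = starred_fun k (fst x) (add_mset (minimal_edge k) (drop (snd x))) a"
      by (subst S1[OF that, symmetric]) (simp add: case_prod_beta)
    then show ?thesis by (simp add: starred_fun_add_bracket minimal_bracket)
  qed
  have rest: "bracket k Suc a * ev a P' = (\<Sum>x\<in>S - S1. c x * ?F x a)" for a
  proof -
    have "(\<Sum>x\<in>S. c x * ?F x a) = (\<Sum>x\<in>S - S1. c x * ?F x a) + (\<Sum>x\<in>S1. c x * ?F x a)"
      by (rule sum.subset_diff) (use S(1) in \<open>auto simp: S1_def\<close>)
    moreover have "(\<Sum>x\<in>S1. c x * ?F x a) =
        bracket k Suc a * (\<Sum>x\<in>S1. c x * starred_fun k (fst x) (drop (snd x)) a)"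
      unfolding sum_distrib_left by (rule sum.cong) (auto simp: F1)
    ultimately show ?thesis using sum[of a] by (simp add: ev_P' right_diff_distrib)
  qed
  have "\<forall>x\<in>S - S1. c x = 0"
  proof (rule admissible_coefficients_vanish[OF k, of _ p q])
    show "finite (S - S1)" using S(1) by simp
    show "starred_admissible k p q M E" if "(M, E) \<in> S - S1" for M E using that S(2) by auto
    fix M E assume ME: "(M, E) \<in> S - S1"
    have eq: "(\<Sum>(M', E')\<in>S - S1. single {#} (c (M', E')) * (arcs_poly k M' * hyper_poly Inl k E')) =
        (\<Sum>x\<in>S - S1. poly x)"
      by (rule sum.cong) (auto simp: poly_def)
    show "lookup (\<Sum>(M', E')\<in>S - S1. single {#} (c (M', E')) *
        (arcs_poly k M' * hyper_poly Inl k E')) (leading_monomial k M E) = 0"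
      unfolding eq
    proof (rule coefficient_eq_0[of "vanishing_locus k"])
      show "ev a (\<Sum>x\<in>S - S1. poly x) = 0" if "\<forall>x\<in>vanishing_locus k. a x = 0" for a
        using rest[of a] bracket_vanishing_locus[OF k that] by (simp add: ev_poly)
      show "set_mset (leading_monomial k M E) \<inter> vanishing_locus k = {}"
        by (rule leading_monomial_avoids[OF k, of p q]) (use ME S(2) in \<open>auto simp: S1_def\<close>)
    qed
  qed
  then have "bracket k Suc a * ev a P' = 0" for a by (simp add: rest)
  then have "ev a P' = 0" for a by (rule bracket_cancel)
  then have "(\<lambda>a. ev a P) = (\<lambda>a. \<Sum>x\<in>S1. c x * starred_fun k (fst x) (drop (snd x)) a)"
    by (simp add: ev_P' fun_eq_iff)
  also have "\<dots> \<in> starred_span k p q n"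
    unfolding starred_span_def
  proof (rule span_of_sum, rule fun_space.span_base)
    fix x assume x: "x \<in> S1"
    then have "starred_admissible k p q (fst x) (snd x)" "size (snd x) = Suc n"
      using S(2) by (auto simp: S1_def)
    then have "starred_admissible k p q (fst x) (drop (snd x)) \<and> size (drop (snd x)) = n"
      using remove_minimal_edge[of k p q "fst x" "drop (snd x)"] S1[OF x] by (metis size_add_mset nat.inject)
    then show "starred_fun k (fst x) (drop (snd x)) \<in>
        (\<lambda>(M, E). starred_fun k M E) ` {(M, E). starred_admissible k p q M E \<and> size E = n}"
      by (intro image_eqI[of _ _ "(fst x, drop (snd x))"]) auto
  qed
  finally show ?thesis .
qed

lemma semi_invariant_span_many_covectors:
  assumes k: "0 < k" "k \<le> p" and P: "\<And>N. N \<in> keys P \<Longrightarrow> set_mset N \<subseteq> coord_indices k p q"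
    and inv: "semi_invariant_poly k (int m) P"
  shows "(\<lambda>a. ev a P) \<in> starred_span k p q m"
proof -
  obtain L where L: "(\<lambda>a. bracket k Suc a ^ L * ev a P) \<in> starred_span k p q (m + L)"
    using localized_semi_invariant[OF assms] by blast
  define Q where "Q L = hyper_poly Inl k (replicate_mset L (minimal_edge k)) * P" for L
  have Q: "ev a (Q L) = bracket k Suc a ^ L * ev a P" for a L
  proof -
    have "ev a (hyper_poly Inl k (replicate_mset L (minimal_edge k))) = bracket k Suc a ^ L"
      using ev_starred[of a k "{#}" "replicate_mset L (minimal_edge k)"]
      by (simp add: arcs_poly_def starred_fun_def minimal_bracket)
    then show ?thesis by (simp add: Q_def)
  qed
  have "(\<lambda>a. ev a (Q L)) \<in> starred_span k p q (m + L) \<Longrightarrow> (\<lambda>a. ev a (Q 0)) \<in> starred_span k p q m" for L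
  proof (induction L)
    case (Suc L)
    have "(\<lambda>a. ev a (Q (Suc L))) = (\<lambda>a. bracket k Suc a * ev a (Q L))" by (simp add: Q mult.assoc)
    then have "(\<lambda>a. ev a (Q L)) \<in> starred_span k p q (m + L)"
      using Suc.prems by (intro saturation[OF k(1)]) simp
    then show ?case by (rule Suc.IH)
  qed simp
  from this[of L] show ?thesis using L by (simp add: Q)
qed

text \<open>
  If \<open>p < k\<close>, extra covectors are added and then cut off again.  Cutting off kills the graphs that
  use them and leaves the other graphs unchanged.
\<close>

theorem semi_invariant_span:
  assumes k: "0 < k" and P: "\<And>N. N \<in> keys P \<Longrightarrow> set_mset N \<subseteq> coord_indices k p q"
    and inv: "semi_invariant_poly k (int m) P"
  shows "(\<lambda>a. ev a P) \<in> starred_span k p q m"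
proof -
  define p' where "p' = max p k"
  have "(\<lambda>a. ev a P) \<in> starred_span k p' q m"
  proof (rule semi_invariant_span_many_covectors[OF k _ _ inv])
    show "set_mset N \<subseteq> coord_indices k p' q" if "N \<in> keys P" for N
      using P[OF that] by (fastforce simp: coord_indices_def Plus_def p'_def)
  qed (simp add: p'_def)
  then obtain S c where S: "finite S" "S \<subseteq> {(M, E). starred_admissible k p' q M E \<and> size E = m}"
    and sum: "\<And>a. ev a P = (\<Sum>x\<in>S. c x * (\<lambda>(M, E). starred_fun k M E) x a)"
    unfolding starred_span_def by (rule span_family) blast
  define cut where "cut a x = (case x of Inl y \<Rightarrow> if fst y \<le> p then a x else 0 | Inr y \<Rightarrow> a x)" for a :: coords and x
  have ev_cut: "ev (cut a) P = ev a P" for a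
    unfolding ev_def
  proof (intro sum.cong refl arg_cong2[of _ _ _ _ "(*)"])
    fix N assume "N \<in> keys P"
    then have "image_mset (cut a) N = image_mset a N"
      using P by (intro image_mset_cong) (fastforce simp: cut_def coord_indices_def)
    then show "(\<Prod>x\<in>#N. cut a x) = (\<Prod>x\<in>#N. a x)" by simp
  qed
  have "(\<lambda>a. starred_fun k M E (cut a)) \<in> starred_span k p q m"
    if adm: "starred_admissible k p' q M E" and m: "size E = m" for M E
  proof (cases "(\<forall>x\<in>#M. fst x \<le> p) \<and> (\<forall>I\<in>#E. set I \<subseteq> {..p})")
    case True
    have "bracket k ((!) I) (cut a) = bracket k ((!) I) a" if "I \<in># E" for I a
    proof (rule bracket_cong_coords)
      fix c r assume "c < k" "r < k"
      then have "I ! c \<in> set I" using that adm by (auto simp: starred_admissible_def hyperedges_def)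
      then have "I ! c \<le> p" using True that by auto
      then show "cut a (Inl (I ! c, r)) = a (Inl (I ! c, r))" by (simp add: cut_def)
    qed
    moreover have "pairing k (fst x) (snd x) (cut a) = pairing k (fst x) (snd x) a" if "x \<in># M" for x a
      using True that by (simp add: pairing_def cut_def)
    ultimately have "starred_fun k M E (cut a) = starred_fun k M E a" for a
      unfolding starred_fun_def case_prod_beta
      by (intro arg_cong2[of _ _ _ _ "(*)"] arg_cong[of _ _ prod_mset] image_mset_cong) auto
    moreover have "arc_diagram p q M" "set_mset E \<subseteq> hyperedges p k"
      using adm True by (fastforce simp: starred_admissible_def arc_diagram_def hyperedges_def)+
    ultimately show ?thesis using starred_straightening[of p q M E k] m by simp
  next
    case False
    have "starred_fun k M E (cut a) = 0" for a
    proof (cases "\<forall>x\<in>#M. fst x \<le> p")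
      case True
      then obtain I where I: "I \<in># E" "\<not> set I \<subseteq> {..p}" using False by auto
      have IH: "I \<in> hyperedges p' k" using adm I by (auto simp: starred_admissible_def)
      obtain z where z: "z \<in> set I" "p < z" using I(2) by (auto simp: subset_iff not_le)
      then obtain c where c: "c < k" "p < I ! c"
        using hyperedges_nth(1)[OF IH] by (auto simp: in_set_conv_nth)
      have "(\<Prod>d<k. cut a (Inl (I ! d, \<pi> d))) = 0" for \<pi>
        using c by (intro prod_zero bexI[of _ c]) (auto simp: cut_def)
      then have "bracket k ((!) I) (cut a) = 0"
        unfolding bracket_leibniz by (simp only: mult_zero_right sum.neutral_const)
      then show ?thesis using I(1) by (auto simp: starred_fun_def prod_mset_zero_iff)
    next
      case False
      then obtain x where x: "x \<in># M" "p < fst x" by (auto simp: not_le)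
      then have "pairing k (fst x) (snd x) (cut a) = 0" by (simp add: pairing_def cut_def)
      moreover obtain M0 where "M = add_mset x M0" using x(1) by (metis mset_add)
      ultimately show ?thesis by (simp add: starred_fun_def case_prod_unfold)
    qed
    then have "(\<lambda>a. starred_fun k M E (cut a)) = 0" by (simp add: fun_eq_iff)
    then show ?thesis by (simp add: starred_span_def fun_space.span_zero)
  qed
  then have "(\<lambda>a. \<Sum>x\<in>S. c x * (\<lambda>a. (\<lambda>(M, E). starred_fun k M E) x (cut a)) a) \<in> starred_span k p q m"
    unfolding starred_span_def using S(2) by (intro span_of_sum) auto
  moreover have "(\<lambda>a. ev a P) = (\<lambda>a. \<Sum>x\<in>S. c x * (\<lambda>(M, E). starred_fun k M E) x (cut a))"
    by (metis ev_cut sum)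
  ultimately show ?thesis by simp
qed

section \<open>Exchanging the two sides\<close>

definition swap_coords :: "coords \<Rightarrow> coords" where
  "swap_coords a x = (case x of Inl y \<Rightarrow> a (Inr y) | Inr y \<Rightarrow> a (Inl y))"

lemma swap_coords_simps [simp]:
  "swap_coords a (Inl y) = a (Inr y)" "swap_coords a (Inr y) = a (Inl y)"
  "swap_coords (swap_coords a) = a"
  by (auto simp: swap_coords_def fun_eq_iff split: sum.splits)

definition flip :: "arc multiset \<Rightarrow> arc multiset" where
  "flip M = image_mset prod.swap M"

lemma flip_flip [simp]: "flip (flip M) = M"
  by (simp add: flip_def multiset.map_comp comp_def)

lemma in_flip [simp]: "x \<in># flip M \<longleftrightarrow> prod.swap x \<in># M"
  by (force simp: flip_def)

lemma first_chain_flip: "first_chain_starred (flip M) = flip (first_chain_unstarred M)"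
proof -
  have "(\<lambda>x. case prod.swap x of (i, j) \<Rightarrow> \<not> (\<exists>(i', j')\<in>#flip M. i' < i \<and> j' > j)) =
      (\<lambda>x. case x of (i, j) \<Rightarrow> \<not> (\<exists>(i', j')\<in>#M. i' > i \<and> j' < j))"
    by (fastforce simp: fun_eq_iff flip_def)
  then show ?thesis
    unfolding first_chain_starred_def first_chain_unstarred_def
    by (simp add: flip_def filter_mset_image_mset)
qed

lemma chain_rest_flip: "chain_rest first_chain_starred l (flip M) = flip (chain_rest first_chain_unstarred l M)"
proof (induction l)
  case (Suc l)
  let ?R = "chain_rest first_chain_unstarred l M"
  have "first_chain_unstarred ?R \<subseteq># ?R" by (simp add: first_chain_unstarred_def)
  then have "flip (?R - first_chain_unstarred ?R) = flip ?R - flip (first_chain_unstarred ?R)"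
    unfolding flip_def by (rule image_mset_Diff)
  then show ?case by (simp add: Suc first_chain_flip)
qed simp

lemma nth_chain_flip: "nth_chain first_chain_starred l (flip M) = flip (nth_chain first_chain_unstarred l M)"
  by (simp add: nth_chain_def chain_rest_flip first_chain_flip)

lemma strict_nesting_swap: "strict_nesting (prod.swap ` S) \<longleftrightarrow> strict_nesting S"
  unfolding strict_nesting_def by fastforce

lemma nesting_bound_flip:
  "(\<forall>S. S \<subseteq> set_mset (flip M) \<and> strict_nesting S \<longrightarrow> card S \<le> k) \<longleftrightarrow>
   (\<forall>S. S \<subseteq> set_mset M \<and> strict_nesting S \<longrightarrow> card S \<le> k)"
proof -
  have *: "\<forall>S. S \<subseteq> set_mset (flip M) \<and> strict_nesting S \<longrightarrow> card S \<le> k"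
    if "\<forall>S. S \<subseteq> set_mset M \<and> strict_nesting S \<longrightarrow> card S \<le> k" for M :: "arc multiset"
  proof (intro allI impI)
    fix S assume S: "S \<subseteq> set_mset (flip M) \<and> strict_nesting S"
    then have "prod.swap ` S \<subseteq> set_mset M" by auto
    then have "card (prod.swap ` S) \<le> k" using that S strict_nesting_swap by blast
    then show "card S \<le> k" by (simp add: card_image)
  qed
  show ?thesis using *[of M] *[of "flip M", unfolded flip_flip] by (rule iffI[rotated])
qed

lemma not_topmost_empty: "\<not> topmost {#} T"
  by (simp add: topmost_def)

lemma admissible_starred:
  "Hypergraph M E {#} \<in> admissible_graphs k p q \<longleftrightarrow> starred_admissible k p q M E"
  by (auto simp: admissible_graphs_def starred_admissible_def hyperedge_rule_def not_topmost_empty hyperedge_chain_def)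

text \<open>
  Reversing all arcs turns the chains counted from the inside into the chains counted from the
  outside, and so the rule for unstarred hyperedges into the one for starred hyperedges.
\<close>

lemma admissible_unstarred:
  "Hypergraph M {#} E \<in> admissible_graphs k p q \<longleftrightarrow> starred_admissible k q p (flip M) E"
proof -
  have rule: "(\<forall>(i, j)\<in>#nth_chain first_chain_starred l (flip M). T ! (l - 1) \<le> i) \<longleftrightarrow>
      (\<forall>(i, j)\<in>#nth_chain first_chain_unstarred l M. T ! (l - 1) \<le> j)" for l T
    unfolding nth_chain_flip by (force simp: flip_def)
  have "arc_diagram q p (flip M) \<longleftrightarrow> arc_diagram p q M"
    by (force simp: arc_diagram_def flip_def)
  then show ?thesis
    unfolding admissible_graphs_def starred_admissible_def nesting_bound_flip rule
    by (auto simp: hyperedge_rule_def not_topmost_empty hyperedge_chain_def)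
qed

definition graph_value :: "nat \<Rightarrow> hypergraph \<Rightarrow> coords \<Rightarrow> complex" where
  "graph_value k G a = (\<Prod>(i, j)\<in>#arcs G. pairing k i j a) * (\<Prod>I\<in>#starred G. bracket k ((!) I) a) *
    (\<Prod>J\<in>#unstarred G. bracket k ((!) J) (swap_coords a))"

lemma graph_value_starred: "graph_value k (Hypergraph M E {#}) a = starred_fun k M E a"
  by (simp add: graph_value_def starred_fun_def)

lemma pairing_swap: "pairing k i j (swap_coords a) = pairing k j i a"
  by (simp add: pairing_def mult.commute)

lemma graph_value_unstarred: "graph_value k (Hypergraph M {#} E) a = starred_fun k (flip M) E (swap_coords a)"
  by (simp add: graph_value_def starred_fun_def flip_def multiset.map_comp comp_def pairing_swap case_prod_unfold)

text \<open>
  The exponent of the determinant by which the general linear group acts on the invariant of a graph.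
\<close>

definition graph_weight :: "hypergraph \<Rightarrow> int" where
  "graph_weight G = int (size (starred G)) - int (size (unstarred G))"

definition swap_poly :: "formal_poly \<Rightarrow> formal_poly" where
  "swap_poly P = (\<Sum>N\<in>keys P.
    single (image_mset (\<lambda>x. case x of Inl y \<Rightarrow> Inr y | Inr y \<Rightarrow> Inl y) N) (lookup P N))"

lemma ev_swap_poly: "ev a (swap_poly P) = ev (swap_coords a) P"
proof -
  have "a (case x of Inl y \<Rightarrow> Inr y | Inr y \<Rightarrow> Inl y) = swap_coords a x" for x
    by (simp add: swap_coords_def split: sum.splits)
  then show ?thesis unfolding swap_poly_def ev_sum ev_single
    by (simp add: ev_def[of "swap_coords a"] multiset.map_comp comp_def)
qed

lemma keys_swap_poly:
  assumes "\<And>N. N \<in> keys P \<Longrightarrow> set_mset N \<subseteq> coord_indices k p q" "N \<in> keys (swap_poly P)"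
  shows "set_mset N \<subseteq> coord_indices k q p"
proof -
  obtain N' where N': "N' \<in> keys P" "N = image_mset (\<lambda>x. case x of Inl y \<Rightarrow> Inr y | Inr y \<Rightarrow> Inl y) N'"
    using keys_sumD[OF assms(2)[unfolded swap_poly_def]] by (auto split: if_splits)
  show ?thesis using assms(1)[OF N'(1)]
    by (fastforce simp: N'(2) coord_indices_def split: sum.splits)
qed

lemma entry_det_transpose: "entry_det k (\<lambda>r c. g c r) = entry_det k g"
proof -
  have "mat k k (\<lambda>(r, c). g c r) = transpose_mat (mat k k (\<lambda>(r, c). g r c))" by (rule eq_matI) auto
  then show ?thesis unfolding entry_det_def by (simp add: det_transpose[of _ k])
qed

lemma inverse_pairD:
  assumes "inverse_pair k g h"
  shows "entry_det k g * entry_det k h = 1" "inverse_pair k h g" "inverse_pair k (\<lambda>r c. h c r) (\<lambda>r c. g c r)"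
proof -
  let ?G = "mat k k (\<lambda>(r, c). g r c)" and ?H = "mat k k (\<lambda>(r, c). h r c)"
  have c: "?G \<in> carrier_mat k k" "?H \<in> carrier_mat k k" by auto
  have GH: "?G * ?H = 1\<^sub>m k" using assms by (simp add: inverse_pair_def)
  show "entry_det k g * entry_det k h = 1" using det_mult[OF c] GH by (simp add: entry_det_def)
  show "inverse_pair k h g" unfolding inverse_pair_def by (rule mat_mult_left_right_inverse[OF c GH])
  have "transpose_mat ?H * transpose_mat ?G = 1\<^sub>m k"
    using transpose_mult[OF c] GH by (simp add: transpose_one)
  moreover have "transpose_mat ?H = mat k k (\<lambda>(r, c). h c r)" "transpose_mat ?G = mat k k (\<lambda>(r, c). g c r)"
    by (auto intro!: eq_matI)
  ultimately show "inverse_pair k (\<lambda>r c. h c r) (\<lambda>r c. g c r)" by (simp add: inverse_pair_def)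
qed

lemma swap_mat_act: "swap_coords (mat_act k g h a) = mat_act k (\<lambda>r c. h c r) (\<lambda>r c. g c r) (swap_coords a)"
proof
  fix x show "swap_coords (mat_act k g h a) x = mat_act k (\<lambda>r c. h c r) (\<lambda>r c. g c r) (swap_coords a) x"
  proof (cases x)
    case (Inl y)
    show ?thesis unfolding Inl swap_coords_simps unfolding mat_act_def sum.case swap_coords_simps
      by (rule sum.cong[OF refl]) (rule mult.commute)
  next
    case (Inr y)
    show ?thesis unfolding Inr swap_coords_simps unfolding mat_act_def sum.case swap_coords_simps
      by (rule sum.cong[OF refl]) (rule mult.commute)
  qed
qed

lemma semi_invariant_swap:
  assumes "semi_invariant_poly k m P"
  shows "semi_invariant_poly k (- m) (swap_poly P)"
  unfolding semi_invariant_poly_def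
proof (intro allI impI)
  fix g h a assume gh: "inverse_pair k g h"
  have "entry_det k (\<lambda>r c. h c r) = inverse (entry_det k g)"
    using inverse_unique[OF inverse_pairD(1)[OF gh]] entry_det_transpose[of k h] by metis
  moreover have "ev (mat_act k (\<lambda>r c. h c r) (\<lambda>r c. g c r) (swap_coords a)) P =
      entry_det k (\<lambda>r c. h c r) powi m * ev (swap_coords a) P"
    using assms inverse_pairD(3)[OF gh] unfolding semi_invariant_poly_def by blast
  ultimately show "ev (mat_act k g h a) (swap_poly P) = entry_det k g powi (- m) * ev a (swap_poly P)"
    by (simp add: ev_swap_poly swap_mat_act power_int_minus power_int_inverse)
qed

theorem semi_invariant_graph_span:
  assumes k: "0 < k" and P: "\<And>N. N \<in> keys P \<Longrightarrow> set_mset N \<subseteq> coord_indices k p q"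
    and inv: "semi_invariant_poly k m P"
  shows "(\<lambda>a. ev a P) \<in> fun_space.span (graph_value k ` {G \<in> admissible_graphs k p q. graph_weight G = m})"
proof (cases "0 \<le> m")
  case True
  then obtain n where n: "m = int n" using nonneg_int_cases by blast
  have "(\<lambda>(M, E). starred_fun k M E) ` {(M, E). starred_admissible k p q M E \<and> size E = n} \<subseteq>
      graph_value k ` {G \<in> admissible_graphs k p q. graph_weight G = m}"
  proof clarify
    fix M E assume "starred_admissible k p q M E" "n = size E"
    then show "starred_fun k M E \<in> graph_value k ` {G \<in> admissible_graphs k p q. graph_weight G = m}"
      by (intro image_eqI[of _ _ "Hypergraph M E {#}"])
        (auto simp: graph_value_starred fun_eq_iff admissible_starred graph_weight_def n)
  qed
  from fun_space.span_mono[OF this] show ?thesis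
    using semi_invariant_span[OF k P inv[unfolded n]] unfolding starred_span_def by blast
next
  case False
  then obtain n where n: "m = - int n" using nonpos_int_cases by (metis linorder_le_cases)
  have "(\<lambda>a. ev a (swap_poly P)) \<in> starred_span k q p n"
  proof (rule semi_invariant_span[OF k])
    show "set_mset N \<subseteq> coord_indices k q p" if "N \<in> keys (swap_poly P)" for N
      using P that by (rule keys_swap_poly)
    show "semi_invariant_poly k (int n) (swap_poly P)" using semi_invariant_swap[OF inv] by (simp add: n)
  qed
  then obtain S c where S: "S \<subseteq> {(M, E). starred_admissible k q p M E \<and> size E = n}"
    and sum: "\<And>a. ev a (swap_poly P) = (\<Sum>x\<in>S. c x * (\<lambda>(M, E). starred_fun k M E) x a)"
    unfolding starred_span_def by (rule span_family) blast
  have "(\<lambda>a. ev a P) = (\<lambda>a. \<Sum>x\<in>S. c x * graph_value k (Hypergraph (flip (fst x)) {#} (snd x)) a)"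
  proof
    fix a show "ev a P = (\<Sum>x\<in>S. c x * graph_value k (Hypergraph (flip (fst x)) {#} (snd x)) a)"
      using sum[of "swap_coords a"] by (simp add: ev_swap_poly graph_value_unstarred case_prod_unfold)
  qed
  also have "\<dots> \<in> fun_space.span (graph_value k ` {G \<in> admissible_graphs k p q. graph_weight G = m})"
  proof (rule span_of_sum, rule fun_space.span_base, rule imageI)
    fix x assume "x \<in> S"
    then show "Hypergraph (flip (fst x)) {#} (snd x) \<in> {G \<in> admissible_graphs k p q. graph_weight G = m}"
      using S by (auto simp: admissible_unstarred graph_weight_def n)
  qed
  finally show ?thesis .
qed

definition graph_poly :: "nat \<Rightarrow> hypergraph \<Rightarrow> formal_poly" where
  "graph_poly k G = arcs_poly k (arcs G) * hyper_poly Inl k (starred G) * hyper_poly Inr k (unstarred G)"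

lemma ev_graph_poly: "ev a (graph_poly k G) = graph_value k G a"
proof -
  have "ev a (bracket_poly Inl k I) = bracket k ((!) I) a" for I
    unfolding ev_bracket_poly by (rule bracket_cong_coords) simp
  moreover have "ev a (bracket_poly Inr k I) = bracket k ((!) I) (swap_coords a)" for I
    unfolding ev_bracket_poly by (rule bracket_cong_coords) simp
  ultimately show ?thesis
    by (simp add: graph_poly_def graph_value_def arcs_poly_def hyper_poly_def ev_pairing_poly case_prod_unfold)
qed

lemma keys_hyper_poly:
  assumes "set_mset E \<subseteq> hyperedges n k" "N \<in> keys (hyper_poly e k E)"
  shows "\<exists>N0. N = image_mset e N0 \<and> size N0 = k * size E \<and> set_mset N0 \<subseteq> {1..n} \<times> {..<k}"
  using assms
proof (induction E arbitrary: N)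
  case empty
  then show ?case by (auto simp: hyper_poly_def)
next
  case (add I E)
  obtain N1 N2 where N: "N = N1 + N2" "N1 \<in> keys (bracket_poly e k I)" "N2 \<in> keys (hyper_poly e k E)"
    using add.prems(2) keys_mult[of "bracket_poly e k I" "hyper_poly e k E"] by (auto simp: hyper_poly_def)
  obtain \<pi> where \<pi>: "\<pi> permutes {..<k}" "N1 = image_mset (\<lambda>r. e (I ! \<pi> r, r)) (mset_set {..<k})"
    using keys_sumD[OF N(2)[unfolded bracket_poly_def]] by (auto split: if_splits)
  have "I ! \<pi> r \<in> {1..n}" if "r < k" for r
    using hyperedges_nth(2)[of I n k "\<pi> r"] permutes_in_image[OF \<pi>(1), of r] add.prems(1) that by simp
  then have "set_mset (image_mset (\<lambda>r. (I ! \<pi> r, r)) (mset_set {..<k})) \<subseteq> {1..n} \<times> {..<k}" by auto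
  moreover have "N1 = image_mset e (image_mset (\<lambda>r. (I ! \<pi> r, r)) (mset_set {..<k}))"
    by (simp add: \<pi>(2) multiset.map_comp comp_def)
  moreover obtain N0 where "N2 = image_mset e N0" "size N0 = k * size E" "set_mset N0 \<subseteq> {1..n} \<times> {..<k}"
    using add.IH[OF _ N(3)] add.prems(1) by auto
  ultimately show ?case
    by (intro exI[of _ "image_mset (\<lambda>r. (I ! \<pi> r, r)) (mset_set {..<k}) + N0"]) (simp add: N(1))
qed

definition row_degree :: "coord_index multiset \<Rightarrow> nat" where
  "row_degree N = size (filter_mset isl N)"

lemma row_degree_simps [simp]:
  "row_degree {#} = 0" "row_degree (N + N') = row_degree N + row_degree N'"
  "row_degree (add_mset x N) = (if isl x then 1 else 0) + row_degree N"
  "row_degree (image_mset Inl N0) = size N0" "row_degree (image_mset Inr N0) = 0"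
  by (simp_all add: row_degree_def filter_mset_image_mset)

lemma keys_graph_poly:
  assumes G: "G \<in> admissible_graphs k p q" and N: "N \<in> keys (graph_poly k G)"
  shows "set_mset N \<subseteq> coord_indices k p q" and "size N = total_degree k G"
    and "row_degree N = size (arcs G) + k * size (starred G)"
proof -
  have H: "set_mset (starred G) \<subseteq> hyperedges p k" "set_mset (unstarred G) \<subseteq> hyperedges q k"
    and A: "arc_diagram p q (arcs G)" using G by (auto simp: admissible_graphs_def)
  obtain N1 N2 N3 where N': "N = N1 + N2 + N3" "N1 \<in> keys (arcs_poly k (arcs G))"
    "N2 \<in> keys (hyper_poly Inl k (starred G))" "N3 \<in> keys (hyper_poly Inr k (unstarred G))"
  proof -
    obtain N12 N3 where 1: "N = N12 + N3" "N12 \<in> keys (arcs_poly k (arcs G) * hyper_poly Inl k (starred G))"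
      "N3 \<in> keys (hyper_poly Inr k (unstarred G))"
      using N[unfolded graph_poly_def] keys_mult by blast
    then obtain N1 N2 where "N12 = N1 + N2" "N1 \<in> keys (arcs_poly k (arcs G))"
      "N2 \<in> keys (hyper_poly Inl k (starred G))" using keys_mult by blast
    then show ?thesis using 1 that by blast
  qed
  obtain R where R: "image_mset snd R = arcs G" "\<forall>y\<in>#R. fst y < k" "N1 = colour_monomial R"
    using keys_arcs_poly[OF N'(2)] by auto
  have "size (colour_monomial R) = 2 * size R" "row_degree (colour_monomial R) = size R"
    by (induction R) (auto simp: colour_monomial_def)
  moreover have "size R = size (arcs G)" using R(1) by (metis size_image_mset)
  ultimately have 1: "size N1 = 2 * size (arcs G)" "row_degree N1 = size (arcs G)" by (simp_all add: R(3))
  have "snd y \<in> {1..p} \<times> {1..q}" if "y \<in># R" for y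
  proof -
    have "snd y \<in># arcs G" using that by (simp flip: R(1))
    then show ?thesis using A by (auto simp: arc_diagram_def)
  qed
  then have s1: "set_mset N1 \<subseteq> coord_indices k p q"
    using R(2) by (fastforce simp: R(3) colour_monomial_def coord_indices_def mem_Times_iff)
  obtain N2' where 2: "N2 = image_mset Inl N2'" "size N2' = k * size (starred G)" "set_mset N2' \<subseteq> {1..p} \<times> {..<k}"
    using keys_hyper_poly[OF H(1) N'(3)] by auto
  obtain N3' where 3: "N3 = image_mset Inr N3'" "size N3' = k * size (unstarred G)" "set_mset N3' \<subseteq> {1..q} \<times> {..<k}"
    using keys_hyper_poly[OF H(2) N'(4)] by auto
  show "set_mset N \<subseteq> coord_indices k p q"
    using s1 2(3) 3(3) by (auto simp: N'(1) 2(1) 3(1) coord_indices_def)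
  show "size N = total_degree k G"
    by (simp add: N'(1) 1 2(1,2) 3(1,2) total_degree_def algebra_simps)
  show "row_degree N = size (arcs G) + k * size (starred G)"
    by (simp add: N'(1) 1 2(1,2) 3(1))
qed

text \<open>
  Graphs with unstarred hyperedges are the only ones with a larger degree in the vectors than in
  the covectors, so a linear relation splits into one for each side.
\<close>

theorem graphs_independent:
  assumes k: "0 < k" and S: "finite S" "S \<subseteq> admissible_graphs k p q"
    and zero: "\<And>a. (\<Sum>G\<in>S. c G * graph_value k G a) = 0"
  shows "\<forall>G\<in>S. c G = 0"
proof -
  define S1 where "S1 = {G \<in> S. unstarred G = {#}}"
  define Q where "Q A = (\<Sum>G\<in>A. single {#} (c G) * graph_poly k G)" for A
  have ev_Q: "ev a (Q A) = (\<Sum>G\<in>A. c G * graph_value k G a)" for a A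
    unfolding Q_def ev_sum by (subst ev_mult) (simp add: ev_graph_poly)
  have keys_Q: "\<exists>G\<in>A. N \<in> keys (graph_poly k G)" if "N \<in> keys (Q A)" for N A
    using keys_sumD[OF that[unfolded Q_def]] by (auto simp: in_keys_iff lookup_scale)
  have balance1: "size N \<le> 2 * row_degree N" if N: "N \<in> keys (Q S1)" for N
  proof -
    obtain G where G: "G \<in> S1" "N \<in> keys (graph_poly k G)" using keys_Q[OF N] by auto
    then have "G \<in> admissible_graphs k p q" using S(2) by (auto simp: S1_def)
    then show ?thesis using keys_graph_poly(2,3)[OF _ G(2)] G(1) by (auto simp: S1_def total_degree_def)
  qed
  have balance2: "2 * row_degree N < size N" if N: "N \<in> keys (Q (S - S1))" for N
  proof -
    obtain G where G: "G \<in> S - S1" "N \<in> keys (graph_poly k G)" using keys_Q[OF N] by auto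
    then have adm: "G \<in> admissible_graphs k p q" using S(2) by auto
    then have "starred G = {#}" "unstarred G \<noteq> {#}" using G(1) by (auto simp: S1_def admissible_graphs_def)
    then show ?thesis using keys_graph_poly(2,3)[OF adm G(2)] k by (simp add: total_degree_def nonempty_has_size)
  qed
  have "lookup (Q S1 + Q (S - S1)) N = 0" for N
  proof (rule coefficient_eq_0[of "{}"])
    fix a
    have "(\<Sum>G\<in>S. c G * graph_value k G a) = (\<Sum>G\<in>S - S1. c G * graph_value k G a) + (\<Sum>G\<in>S1. c G * graph_value k G a)"
      by (rule sum.subset_diff) (use S(1) in \<open>auto simp: S1_def\<close>)
    then have "ev a (Q S1 + Q (S - S1)) = (\<Sum>G\<in>S. c G * graph_value k G a)"
      unfolding ev_add ev_Q by (simp only: add.commute)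
    then show "ev a (Q S1 + Q (S - S1)) = 0" by (simp only: zero)
  qed simp
  then have sum0: "lookup (Q S1) N + lookup (Q (S - S1)) N = 0" for N
    by (simp add: lookup_add)
  have l1: "lookup (Q S1) N = 0" for N
    using sum0[of N] balance1[of N] balance2[of N] by (auto simp: in_keys_iff) force
  have l2: "lookup (Q (S - S1)) N = 0" for N using sum0[of N] l1[of N] by simp
  have "Q (S - S1) = 0" by (rule poly_mapping_eqI) (simp add: l2)
  have c1: "\<forall>x\<in>(\<lambda>G. (arcs G, starred G)) ` S1. (\<lambda>(M, E). c (Hypergraph M E {#})) x = 0"
  proof (rule admissible_coefficients_vanish[OF k, of _ p q])
    have un: "Hypergraph (arcs G) (starred G) {#} = G" if "G \<in> S1" for G
      using that by (cases G) (auto simp: S1_def)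
    have inj: "inj_on (\<lambda>G. (arcs G, starred G)) S1"
    proof (rule inj_onI)
      fix G H assume GH: "G \<in> S1" "H \<in> S1" and eq: "(arcs G, starred G) = (arcs H, starred H)"
      have "Hypergraph (arcs G) (starred G) {#} = Hypergraph (arcs H) (starred H) {#}" using eq by simp
      then show "G = H" unfolding un[OF GH(1)] un[OF GH(2)] .
    qed
    show "finite ((\<lambda>G. (arcs G, starred G)) ` S1)" using S(1) by (simp add: S1_def)
    show "starred_admissible k p q M E" if ME: "(M, E) \<in> (\<lambda>G. (arcs G, starred G)) ` S1" for M E
    proof -
      obtain G where G: "G \<in> S1" "M = arcs G" "E = starred G" using ME by auto
      then have "Hypergraph M E {#} \<in> admissible_graphs k p q" using un[OF G(1)] S(2) by (auto simp: S1_def)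
      then show ?thesis by (simp add: admissible_starred)
    qed
    fix M E
    have "(\<Sum>(M', E')\<in>(\<lambda>G. (arcs G, starred G)) ` S1. single {#} ((\<lambda>(M, E). c (Hypergraph M E {#})) (M', E')) *
        (arcs_poly k M' * hyper_poly Inl k E')) = Q S1"
      unfolding Q_def sum.reindex[OF inj]
      by (rule sum.cong) (auto simp: un graph_poly_def S1_def hyper_poly_def)
    then show "lookup (\<Sum>(M', E')\<in>(\<lambda>G. (arcs G, starred G)) ` S1.
        single {#} ((\<lambda>(M, E). c (Hypergraph M E {#})) (M', E')) *
        (arcs_poly k M' * hyper_poly Inl k E')) (leading_monomial k M E) = 0" by (simp add: l1)
  qed
  have c2: "\<forall>x\<in>(\<lambda>G. (flip (arcs G), unstarred G)) ` (S - S1). (\<lambda>(M, E). c (Hypergraph (flip M) {#} E)) x = 0"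
  proof (rule admissible_coefficients_vanish[OF k, of _ q p])
    have un: "Hypergraph (arcs G) {#} (unstarred G) = G" if "G \<in> S - S1" for G
      using that S(2) by (cases G) (auto simp: S1_def admissible_graphs_def)
    have inj: "inj_on (\<lambda>G. (flip (arcs G), unstarred G)) (S - S1)"
    proof (rule inj_onI)
      fix G H assume GH: "G \<in> S - S1" "H \<in> S - S1"
        and eq: "(flip (arcs G), unstarred G) = (flip (arcs H), unstarred H)"
      have "flip (flip (arcs G)) = flip (flip (arcs H))" using eq by (simp only: prod.inject)
      then have "Hypergraph (arcs G) {#} (unstarred G) = Hypergraph (arcs H) {#} (unstarred H)" using eq by simp
      then show "G = H" unfolding un[OF GH(1)] un[OF GH(2)] .
    qed
    show "finite ((\<lambda>G. (flip (arcs G), unstarred G)) ` (S - S1))" using S(1) by simp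
    show "starred_admissible k q p M E" if ME: "(M, E) \<in> (\<lambda>G. (flip (arcs G), unstarred G)) ` (S - S1)" for M E
    proof -
      obtain G where G: "G \<in> S - S1" "M = flip (arcs G)" "E = unstarred G" using ME by auto
      then have "Hypergraph (arcs G) {#} E \<in> admissible_graphs k p q" using un[OF G(1)] S(2) by auto
      then show ?thesis by (simp add: admissible_unstarred G(2))
    qed
    fix M E
    have "ev a (\<Sum>(M', E')\<in>(\<lambda>G. (flip (arcs G), unstarred G)) ` (S - S1).
        single {#} ((\<lambda>(M, E). c (Hypergraph (flip M) {#} E)) (M', E')) *
        (arcs_poly k M' * hyper_poly Inl k E')) = 0" for a
    proof -
      have "ev a (\<Sum>(M', E')\<in>(\<lambda>G. (flip (arcs G), unstarred G)) ` (S - S1).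
        single {#} ((\<lambda>(M, E). c (Hypergraph (flip M) {#} E)) (M', E')) *
        (arcs_poly k M' * hyper_poly Inl k E')) =
        (\<Sum>G\<in>S - S1. c G * starred_fun k (flip (arcs G)) (unstarred G) a)"
        unfolding sum.reindex[OF inj] ev_sum
        by (rule sum.cong) (auto simp: un ev_starred[symmetric] simp del: ev_prod_mset)
      also have "\<dots> = (\<Sum>G\<in>S - S1. c G * graph_value k G (swap_coords a))"
      proof (rule sum.cong[OF refl])
        fix G assume "G \<in> S - S1"
        from graph_value_unstarred[of k "arcs G" "unstarred G" "swap_coords a"]
        show "c G * starred_fun k (flip (arcs G)) (unstarred G) a = c G * graph_value k G (swap_coords a)"
          by (simp add: un[OF \<open>G \<in> S - S1\<close>])
      qed
      also have "\<dots> = 0" unfolding ev_Q[symmetric] by (simp add: \<open>Q (S - S1) = 0\<close>)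
      finally show ?thesis .
    qed
    then show "lookup (\<Sum>(M', E')\<in>(\<lambda>G. (flip (arcs G), unstarred G)) ` (S - S1).
        single {#} ((\<lambda>(M, E). c (Hypergraph (flip M) {#} E)) (M', E')) *
        (arcs_poly k M' * hyper_poly Inl k E')) (leading_monomial k M E) = 0"
      by (intro coefficient_eq_0[of "{}"]) auto
  qed
  show ?thesis
  proof
    fix G assume G: "G \<in> S"
    show "c G = 0"
    proof (cases "G \<in> S1")
      case True
      then have "Hypergraph (arcs G) (starred G) {#} = G" by (cases G) (auto simp: S1_def)
      then show ?thesis using c1 True by force
    next
      case False
      then have "Hypergraph (arcs G) {#} (unstarred G) = G"
        using G S(2) by (cases G) (auto simp: S1_def admissible_graphs_def)
      then show ?thesis using c2 False G by force
    qed
  qed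
qed

section \<open>Invariants of the special linear group\<close>

lemma bracket_mat_act: "bracket k u (mat_act k g h a) = entry_det k g * bracket k u a"
proof -
  let ?A = "mat k k (\<lambda>(r, c). a (Inl (u c, r)))" and ?G = "mat k k (\<lambda>(r, c). g c r)"
  have "mat k k (\<lambda>(r, c). mat_act k g h a (Inl (u c, r))) = ?G * ?A"
    by (rule eq_matI) (simp_all add: mat_act_def scalar_prod_def atLeast0LessThan mult.commute)
  then show ?thesis
    using det_mult[of ?G k ?A] entry_det_transpose[of k g] by (simp add: bracket_def entry_det_def)
qed

lemma sum_delta_left: "r < (k::nat) \<Longrightarrow> (\<Sum>s<k. (if r = s then 1 else 0) * f s) = (f r :: complex)"
proof -
  assume r: "r < k"
  have "(\<Sum>s<k. (if r = s then 1 else 0) * f s) = (\<Sum>s<k. if r = s then f s else 0)"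
    by (rule sum.cong) auto
  then show "(\<Sum>s<k. (if r = s then 1 else 0) * f s) = f r" using r by simp
qed

lemma inverse_pair_entries:
  assumes "inverse_pair k g h" "r < k" "s < k"
  shows "(\<Sum>c<k. g r c * h c s) = (if r = s then 1 else 0)"
proof -
  have "(mat k k (\<lambda>(r, c). g r c) * mat k k (\<lambda>(r, c). h r c)) $$ (r, s) = (1\<^sub>m k :: complex mat) $$ (r, s)"
    using assms(1) by (simp add: inverse_pair_def)
  then show ?thesis using assms(2,3) by (simp add: scalar_prod_def atLeast0LessThan)
qed

lemma inverse_pairI:
  assumes "\<And>r s. r < k \<Longrightarrow> s < k \<Longrightarrow> (\<Sum>c<k. g r c * h c s) = (if r = s then 1 else 0)"
  shows "inverse_pair k g h"
  unfolding inverse_pair_def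
  by (rule eq_matI) (simp_all add: scalar_prod_def atLeast0LessThan assms)

lemma pairing_mat_act:
  assumes "inverse_pair k g h"
  shows "pairing k i j (mat_act k g h a) = pairing k i j a"
proof -
  have "pairing k i j (mat_act k g h a) =
      (\<Sum>c<k. (\<Sum>r<k. a (Inl (i, r)) * g r c) * (\<Sum>s<k. h c s * a (Inr (j, s))))"
    by (simp add: pairing_def mat_act_def)
  also have "\<dots> = (\<Sum>c<k. \<Sum>r<k. \<Sum>s<k. a (Inl (i, r)) * (g r c * h c s * a (Inr (j, s))))"
    by (simp only: sum_product mult.assoc)
  also have "\<dots> = (\<Sum>r<k. \<Sum>c<k. \<Sum>s<k. a (Inl (i, r)) * (g r c * h c s * a (Inr (j, s))))"
    by (rule sum.swap)
  also have "\<dots> = (\<Sum>r<k. \<Sum>s<k. \<Sum>c<k. a (Inl (i, r)) * (g r c * h c s * a (Inr (j, s))))"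
    by (intro sum.cong refl sum.swap)
  also have "\<dots> = (\<Sum>r<k. a (Inl (i, r)) * (\<Sum>s<k. (\<Sum>c<k. g r c * h c s) * a (Inr (j, s))))"
    by (simp only: sum_distrib_left sum_distrib_right)
  also have "\<dots> = (\<Sum>r<k. a (Inl (i, r)) * (\<Sum>s<k. (if r = s then 1 else 0) * a (Inr (j, s))))"
    by (intro sum.cong refl arg_cong2[of _ _ _ _ "(*)"]) (simp_all add: inverse_pair_entries[OF assms])
  also have "\<dots> = pairing k i j a"
    unfolding pairing_def by (intro sum.cong refl) (simp add: sum_delta_left)
  finally show ?thesis .
qed

lemma graph_value_mat_act:
  assumes gh: "inverse_pair k g h"
    and G: "starred G = {#} \<or> unstarred G = {#}"
  shows "graph_value k G (mat_act k g h a) = entry_det k g powi graph_weight G * graph_value k G a"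
proof -
  have const: "(\<Prod>I\<in>#E. d * f I) = d ^ size E * (\<Prod>I\<in>#E. f I)" for E and d :: complex and f :: "nat list \<Rightarrow> complex"
    by (induction E) (auto simp: mult_ac)
  have un: "bracket k u (swap_coords (mat_act k g h a)) = entry_det k h * bracket k u (swap_coords a)" for u
    unfolding swap_mat_act bracket_mat_act using entry_det_transpose[of k h] by simp
  have h: "entry_det k h = inverse (entry_det k g)"
    using inverse_unique[OF inverse_pairD(1)[OF gh]] by simp
  have "entry_det k g ^ size (starred G) * entry_det k h ^ size (unstarred G) = entry_det k g powi graph_weight G"
    using G by (auto simp: graph_weight_def h power_int_minus power_inverse)
  from this[symmetric] show ?thesis
    unfolding graph_value_def un bracket_mat_act pairing_mat_act[OF gh] const by (simp only: mult_ac)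
qed

definition scale_coords :: "complex \<Rightarrow> complex \<Rightarrow> coords \<Rightarrow> coords" where
  "scale_coords s t a x = (case x of Inl y \<Rightarrow> s * a x | Inr y \<Rightarrow> t * a x)"

lemma prod_scale_coords:
  "(\<Prod>x\<in>#N. scale_coords s t a x) = s ^ row_degree N * t ^ (size N - row_degree N) * (\<Prod>x\<in>#N. a x)"
proof (induction N)
  case (add x N)
  have "row_degree N \<le> size N" by (simp add: row_degree_def size_filter_mset_lesseq)
  then show ?case using add by (cases x) (simp_all add: scale_coords_def Suc_diff_le)
qed simp

lemma mat_act_scale_coords: "mat_act k g h (scale_coords s t a) = scale_coords s t (mat_act k g h a)"
proof
  fix x show "mat_act k g h (scale_coords s t a) x = scale_coords s t (mat_act k g h a) x"
    by (cases x) (simp_all add: mat_act_def scale_coords_def sum_distrib_left mult_ac)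
qed

lemma complex_root_exists:
  assumes "0 < k"
  shows "\<exists>s :: complex. s ^ k = z"
proof -
  have "rcis (root k (cmod z)) (Arg z / k) ^ k = rcis (root k (cmod z) ^ k) (of_nat k * (Arg z / k))"
    by (rule DeMoivre2)
  also have "\<dots> = z" using assms by (simp add: real_root_pow_pos2 rcis_cmod_Arg)
  finally show ?thesis by blast
qed

text \<open>
  It suffices to test the primitive root \<open>cis (2 * pi / k)\<close>.
\<close>

lemma root_of_unity_separates:
  assumes "0 < k" and "\<And>z :: complex. z ^ k = 1 \<Longrightarrow> z ^ m = z ^ n"
  shows "int k dvd int m - int n"
proof -
  define t where "t = 2 * pi / real k"
  have "cis t ^ k = 1" using assms(1) by (simp add: DeMoivre t_def)
  then have "cis t ^ m = cis t ^ n" by (rule assms(2))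
  then have eq: "cis (real m * t) = cis (real n * t)" by (simp add: DeMoivre)
  then have "cos (real m * t - real n * t) = cos (real n * t) ^ 2 + sin (real n * t) ^ 2"
    by (simp add: cos_diff complex_eq_iff power2_eq_square)
  then have "cos (real m * t - real n * t) = 1" by simp
  then obtain j :: int where "real m * t - real n * t = real_of_int j * 2 * pi" by (auto simp: cos_one_2pi_int)
  then have "(real m - real n) * t = real_of_int j * 2 * pi" by (simp only: left_diff_distrib)
  then have "(real m - real n) * (2 * pi) = (real_of_int j * real k) * (2 * pi)"
    using assms(1) by (simp add: t_def field_simps)
  then have "real m - real n = real_of_int j * real k"
    using pi_neq_zero by (simp only: mult_cancel_right) simp
  then have "real_of_int (int m - int n) = real_of_int (j * int k)" by simp
  then have "int m - int n = j * int k" by (simp only: of_int_eq_iff)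
  then show ?thesis by simp
qed

text \<open>
  Every invertible matrix is a scalar multiple of one with determinant \<open>1\<close>, and scalars act on
  bihomogeneous polynomials by the power \<open>n - (d - n)\<close>.  Scalars with \<open>k\<close>-th power \<open>1\<close> are special linear, so
  for a nonzero invariant this exponent is a multiple of \<open>k\<close>.
\<close>

lemma special_to_general:
  assumes k: "0 < k" and hom: "\<And>N. N \<in> keys P \<Longrightarrow> size N = d \<and> row_degree N = n"
    and inv: "\<And>g h a. inverse_pair k g h \<Longrightarrow> entry_det k g = 1 \<Longrightarrow> ev (mat_act k g h a) P = ev a P"
  shows "(\<exists>m. semi_invariant_poly k m P) \<or> (\<forall>a. ev a P = 0)"
proof (cases "\<forall>a. ev a P = 0")
  case False
  then obtain a0 where a0: "ev a0 P \<noteq> 0" by auto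
  have scaled: "ev (scale_coords s t a) P = s ^ n * t ^ (d - n) * ev a P" for s t a
    unfolding ev_def sum_distrib_left by (rule sum.cong) (use hom in \<open>auto simp: prod_scale_coords\<close>)
  have entry_det_scale: "entry_det k (\<lambda>r c. s * g r c) = s ^ k * entry_det k g" for s g
  proof -
    have "mat k k (\<lambda>(r, c). s * g r c) = s \<cdot>\<^sub>m mat k k (\<lambda>(r, c). g r c)" by (rule eq_matI) auto
    then show ?thesis by (simp add: entry_det_def)
  qed
  have pair_scale: "inverse_pair k (\<lambda>r c. s * g r c) (\<lambda>r c. t * h r c)" if "inverse_pair k g h" "s * t = 1" for s t g h
  proof (rule inverse_pairI)
    fix r c assume rc: "r < k" "c < k"
    have "(\<Sum>i<k. s * g r i * (t * h i c)) = s * t * (\<Sum>i<k. g r i * h i c)"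
      by (simp add: sum_distrib_left mult_ac)
    then show "(\<Sum>i<k. s * g r i * (t * h i c)) = (if r = c then 1 else 0)"
      using inverse_pair_entries[OF that(1) rc] that(2) by simp
  qed
  have act_scale: "mat_act k (\<lambda>r c. s * g r c) (\<lambda>r c. t * h r c) a = mat_act k g h (scale_coords s t a)" for s t g h a
  proof
    fix x show "mat_act k (\<lambda>r c. s * g r c) (\<lambda>r c. t * h r c) a x = mat_act k g h (scale_coords s t a) x"
      by (cases x) (simp_all add: mat_act_def scale_coords_def mult_ac)
  qed
  have "z ^ n = z ^ (d - n)" if z: "z ^ k = 1" for z :: complex
  proof -
    let ?one = "\<lambda>r c. if r = c then 1 else 0 :: complex"
    have z0: "z \<noteq> 0" using z k by (auto simp: power_0_left)
    have one: "inverse_pair k ?one ?one"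
      by (rule inverse_pairI) (simp add: sum_delta_left)
    have f1: "entry_det k ?one = 1"
    proof -
      have "mat k k (\<lambda>(r, c). ?one r c) = 1\<^sub>m k" by (rule eq_matI) auto
      then show ?thesis by (simp add: entry_det_def)
    qed
    have "mat_act k ?one ?one (scale_coords z (1 / z) a0) = mat_act k (\<lambda>r c. z * ?one r c) (\<lambda>r c. 1 / z * ?one r c) a0"
      by (rule act_scale[symmetric])
    then have "ev (mat_act k ?one ?one (scale_coords z (1 / z) a0)) P = ev a0 P"
      using inv[OF pair_scale[OF one, of z "1 / z"], of a0] z0 z by (simp only: entry_det_scale f1) simp
    moreover have "ev (mat_act k ?one ?one (scale_coords z (1 / z) a0)) P = ev (scale_coords z (1 / z) a0) P"
      by (rule inv[OF one f1])
    ultimately have "z ^ n * (1 / z) ^ (d - n) * ev a0 P = ev a0 P" by (simp add: scaled)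
    then have "z ^ n * (1 / z) ^ (d - n) = 1" using a0 by simp
    then show ?thesis using z0 by (simp add: power_one_over field_simps)
  qed
  then obtain m where m: "int n - int (d - n) = int k * m"
    using root_of_unity_separates[OF k, of n "d - n"] unfolding dvd_def by blast
  have "semi_invariant_poly k m P"
    unfolding semi_invariant_poly_def
  proof (intro allI impI)
    fix g h a assume gh: "inverse_pair k g h"
    obtain s where s: "s ^ k = entry_det k g" using complex_root_exists[OF k] by blast
    have f0: "entry_det k g \<noteq> 0" using inverse_pairD(1)[OF gh] by auto
    then have s0: "s \<noteq> 0" using s k by (auto simp: power_0_left)
    let ?g = "\<lambda>r c. 1 / s * g r c" and ?h = "\<lambda>r c. s * h r c"
    have "mat_act k g h a = mat_act k ?g ?h (scale_coords s (1 / s) a)"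
      unfolding act_scale[of "1 / s" g s h "scale_coords s (1 / s) a"]
      using s0 by (intro arg_cong[of _ _ "mat_act k g h"] ext) (simp add: scale_coords_def split: sum.splits)
    moreover have "inverse_pair k ?g ?h" using pair_scale[OF gh, of "1 / s" s] s0 by simp
    moreover have "entry_det k ?g = 1" unfolding entry_det_scale s[symmetric] using s0 by (simp add: power_one_over)
    ultimately have "ev (mat_act k g h a) P = s ^ n * (1 / s) ^ (d - n) * ev a P"
      using inv[of ?g ?h] by (simp only: scaled)
    also have "s ^ n * (1 / s) ^ (d - n) = s powi (int n - int (d - n))"
      using s0 by (simp add: power_int_diff power_one_over)
    also have "\<dots> = entry_det k g powi m" unfolding m s[symmetric] by (simp add: power_int_mult)
    finally show "ev (mat_act k g h a) P = entry_det k g powi m * ev a P" .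
  qed
  then show ?thesis by blast
qed simp

text \<open>
  The parts of fixed degree in the covectors are again invariant, because scaling the covectors
  commutes with the action.  Comparing the behaviour under scaling all coordinates then removes the
  graphs of the wrong total degree.
\<close>

theorem special_invariant_graph_span:
  assumes k: "0 < k" and P: "\<And>N. N \<in> keys P \<Longrightarrow> set_mset N \<subseteq> coord_indices k p q \<and> size N = d"
    and inv: "\<And>g h a. inverse_pair k g h \<Longrightarrow> entry_det k g = 1 \<Longrightarrow> ev (mat_act k g h a) P = ev a P"
  shows "(\<lambda>a. ev a P) \<in> fun_space.span (graph_value k ` {G \<in> admissible_graphs k p q. total_degree k G = d})"
proof -
  define part where "part n = (\<Sum>N | N \<in> keys P \<and> row_degree N = n.
    single N (lookup P N))" for n
  have ev_part: "ev a (part n) = (\<Sum>N | N \<in> keys P \<and> row_degree N = n. lookup P N * (\<Prod>x\<in>#N. a x))" for a n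
    by (simp add: part_def)
  have keys_part: "N \<in> keys P \<and> row_degree N = n" if "N \<in> keys (part n)" for N n
    using keys_sumD[OF that[unfolded part_def]] by (auto split: if_splits)
  have inv_part: "ev (mat_act k g h a) (part n) = ev a (part n)" if gh: "inverse_pair k g h" "entry_det k g = 1" for g h a n
  proof -
    have "(\<Sum>N\<in>keys P. s ^ row_degree N * (lookup P N * (\<Prod>x\<in>#N. mat_act k g h a x) -
        lookup P N * (\<Prod>x\<in>#N. a x))) = 0" for s
    proof -
      have "ev (scale_coords s 1 (mat_act k g h a)) P = ev (scale_coords s 1 a) P"
        using inv[OF gh, of "scale_coords s 1 a"] by (simp add: mat_act_scale_coords)
      then show ?thesis
        by (simp add: ev_def prod_scale_coords right_diff_distrib sum_subtractf mult.left_commute)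
    qed
    from power_sum_coefficients[OF finite_keys this, of n]
    show ?thesis by (simp add: ev_part sum_subtractf)
  qed
  have in_span: "(\<lambda>a. ev a (part n)) \<in> fun_space.span (graph_value k ` admissible_graphs k p q)" for n
  proof -
    have "(\<exists>m. semi_invariant_poly k m (part n)) \<or> (\<forall>a. ev a (part n) = 0)"
      by (rule special_to_general[OF k, of _ d n]) (use keys_part P inv_part in auto)
    then show ?thesis
    proof
      assume "\<exists>m. semi_invariant_poly k m (part n)"
      then obtain m where m: "semi_invariant_poly k m (part n)" ..
      have "(\<lambda>a. ev a (part n)) \<in> fun_space.span (graph_value k ` {G \<in> admissible_graphs k p q. graph_weight G = m})"
        by (rule semi_invariant_graph_span[OF k _ m]) (use keys_part P in blast)
      moreover have "fun_space.span (graph_value k ` {G \<in> admissible_graphs k p q. graph_weight G = m}) \<subseteq>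
          fun_space.span (graph_value k ` admissible_graphs k p q)" by (intro fun_space.span_mono image_mono) auto
      ultimately show ?thesis by blast
    next
      assume "\<forall>a. ev a (part n) = 0"
      then have "(\<lambda>a. ev a (part n)) = 0" by (simp add: fun_eq_iff)
      then show ?thesis by (simp add: fun_space.span_zero)
    qed
  qed
  have "ev a P = (\<Sum>n\<in>row_degree ` keys P. 1 * ev a (part n))" for a
    unfolding ev_part mult_1 unfolding ev_def[of a P] by (rule sum.image_gen) simp
  then have "(\<lambda>a. ev a P) \<in> fun_space.span (graph_value k ` admissible_graphs k p q)"
    using span_of_sum[of "row_degree ` keys P" "\<lambda>n a. ev a (part n)" _ "\<lambda>_. 1"] in_span by presburger
  then obtain S c where S: "finite S" "S \<subseteq> admissible_graphs k p q"
    and sum: "\<And>a. ev a P = (\<Sum>G\<in>S. c G * graph_value k G a)"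
    by (rule span_family) blast
  have hom: "ev (scale_coords t t a) Q = t ^ e * ev a Q" if "\<And>N. N \<in> keys Q \<Longrightarrow> size N = e" for t a Q e
  proof -
    have "row_degree N \<le> size N" for N by (simp add: row_degree_def size_filter_mset_lesseq)
    then have "(\<Prod>x\<in>#N. scale_coords t t a x) = t ^ size N * (\<Prod>x\<in>#N. a x)" for N
      by (simp add: prod_scale_coords flip: power_add)
    then show ?thesis unfolding ev_def sum_distrib_left by (intro sum.cong refl) (simp add: that mult_ac)
  qed
  have homG: "graph_value k G (scale_coords t t a) = t ^ total_degree k G * graph_value k G a" if "G \<in> S" for G t a
    unfolding ev_graph_poly[symmetric] using keys_graph_poly(2)[of G k p q] that S(2) by (intro hom) auto
  have "ev a P = (\<Sum>G | G \<in> S \<and> total_degree k G = d. c G * graph_value k G a)" for a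
  proof -
    \<comment> \<open>The index \<open>None\<close> stands for the function itself, moved to the other side of the equation.\<close>
    define K where "K = insert None (Some ` S)"
    define e where "e x = (case x of None \<Rightarrow> d | Some G \<Rightarrow> total_degree k G)" for x
    define v where "v x = (case x of None \<Rightarrow> - ev a P | Some G \<Rightarrow> c G * graph_value k G a)" for x
    have "(\<Sum>x\<in>K. t ^ e x * v x) = 0" for t
    proof -
      have "(\<Sum>x\<in>K. t ^ e x * v x) = t ^ d * (- ev a P) + (\<Sum>G\<in>S. t ^ total_degree k G * (c G * graph_value k G a))"
        using S(1) by (simp add: K_def e_def v_def sum.reindex)
      also have "(\<Sum>G\<in>S. t ^ total_degree k G * (c G * graph_value k G a)) = ev (scale_coords t t a) P"
        unfolding sum by (rule sum.cong) (auto simp: homG)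
      also have "\<dots> = t ^ d * ev a P" using P by (intro hom) auto
      finally show ?thesis by simp
    qed
    from power_sum_coefficients[OF _ this, of d] have 0: "(\<Sum>x | x \<in> K \<and> e x = d. v x) = 0"
      using S(1) by (simp add: K_def)
    have "{x. x \<in> K \<and> e x = d} = insert None (Some ` {G \<in> S. total_degree k G = d})"
    proof (rule Set.set_eqI)
      fix x show "x \<in> {x. x \<in> K \<and> e x = d} \<longleftrightarrow> x \<in> insert None (Some ` {G \<in> S. total_degree k G = d})"
        by (cases x) (auto simp: K_def e_def)
    qed
    with 0 show ?thesis using S(1) by (simp add: sum.reindex v_def)
  qed
  then have "(\<lambda>a. ev a P) = (\<lambda>a. \<Sum>G | G \<in> S \<and> total_degree k G = d. c G * graph_value k G a)" by (rule ext)
  also have "\<dots> \<in> fun_space.span (graph_value k ` {G \<in> admissible_graphs k p q. total_degree k G = d})"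
    by (intro span_of_sum fun_space.span_base imageI) (use S(2) in auto)
  finally show ?thesis .
qed

section \<open>From matrices to linear maps\<close>

locale based_space =
  fixes scale :: "complex \<Rightarrow> 'v::ab_group_add \<Rightarrow> 'v" and b :: "nat \<Rightarrow> 'v" and k :: nat
  assumes basis: "finite_dimensional_vector_space scale (b ` {..<k})"
    and inj: "inj_on b {..<k}"
begin

abbreviation coord :: "nat \<Rightarrow> 'v \<Rightarrow> complex" where
  "coord \<equiv> dual_basis scale b k"

abbreviation crd :: "'v point \<Rightarrow> coords" where
  "crd w \<equiv> \<lambda>x. coord_fun scale b k x w"

lemma vs: "vector_space scale"
  using basis by (simp add: finite_dimensional_vector_space_def)

lemma basis_expand: "(\<Sum>r<k. scale (coord r v) (b r)) = v"
proof -
  interpret V: finite_dimensional_vector_space scale "b ` {..<k}" by (rule basis)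
  have "(\<Sum>u\<in>b ` {..<k}. scale (V.representation (b ` {..<k}) v u) u) = v"
    by (rule V.sum_representation_eq) (auto simp: V.independent_Basis V.span_Basis)
  then show ?thesis by (simp add: sum.reindex[OF inj] dual_basis_def)
qed

lemma coord_add: "coord r (u + v) = coord r u + coord r v"
proof -
  interpret V: finite_dimensional_vector_space scale "b ` {..<k}" by (rule basis)
  show ?thesis unfolding dual_basis_def
    by (subst V.representation_add) (auto simp: V.independent_Basis V.span_Basis)
qed

lemma coord_scale: "coord r (scale c v) = c * coord r v"
proof -
  interpret V: finite_dimensional_vector_space scale "b ` {..<k}" by (rule basis)
  show ?thesis unfolding dual_basis_def
    by (subst V.representation_scale) (auto simp: V.independent_Basis V.span_Basis)
qed

lemma coord_basis: "r < k \<Longrightarrow> s < k \<Longrightarrow> coord r (b s) = (if r = s then 1 else 0)"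
proof -
  interpret V: finite_dimensional_vector_space scale "b ` {..<k}" by (rule basis)
  assume rs: "r < k" "s < k"
  have "V.representation (b ` {..<k}) (b s) = (\<lambda>v. if v = b s then 1 else 0)"
    by (rule V.representation_basis) (use rs in \<open>auto simp: V.independent_Basis\<close>)
  then show ?thesis using inj rs by (auto simp: dual_basis_def inj_on_def)
qed

lemma coord_sum: "coord r (\<Sum>x\<in>A. f x) = (\<Sum>x\<in>A. coord r (f x))"
proof (induction A rule: infinite_finite_induct)
  have "coord r 0 = 0" using coord_add[of r 0 0] by simp
  then show "\<And>A. infinite A \<Longrightarrow> coord r (\<Sum>x\<in>A. f x) = (\<Sum>x\<in>A. coord r (f x))"
    and "coord r (\<Sum>x\<in>{}. f x) = (\<Sum>x\<in>{}. coord r (f x))" by simp_all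
qed (simp add: coord_add)

lemma coord_combination:
  assumes "r < k"
  shows "coord r (\<Sum>s<k. scale (c s) (b s)) = c r"
proof -
  have "coord r (\<Sum>s<k. scale (c s) (b s)) = (\<Sum>s<k. if r = s then c s else 0)"
    unfolding coord_sum coord_scale by (rule sum.cong) (use assms in \<open>auto simp: coord_basis\<close>)
  then show ?thesis using assms by simp
qed

lemma linear_expand:
  assumes "Vector_Spaces.linear scale s2 f"
  shows "f v = (\<Sum>r<k. s2 (coord r v) (f (b r)))"
proof -
  interpret L: Vector_Spaces.linear scale s2 f by (rule assms)
  have "f v = f (\<Sum>r<k. scale (coord r v) (b r))" by (simp only: basis_expand)
  then show ?thesis by (simp only: L.sum L.scale)
qed

lemma coord_linear:
  assumes "Vector_Spaces.linear scale scale f"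
  shows "coord r (f v) = (\<Sum>c<k. coord r (f (b c)) * coord c v)"
  by (subst linear_expand[OF assms]) (simp add: coord_sum coord_scale mult.commute)

lemma contraction_pairing:
  assumes "w \<in> config_space scale p q" "i \<in> {1..p}"
  shows "contraction i j w = pairing k i j (crd w)"
proof -
  have "Vector_Spaces.linear scale (*) (fst w i)"
    using assms by (auto simp: config_space_def dual_space_def)
  from linear_expand[OF this, of "snd w j"] show ?thesis
    by (simp add: contraction_def pairing_def mult.commute)
qed

lemma graph_fun_graph_value:
  assumes "arc_diagram p q (arcs G)"
  shows "graph_fun scale b k p q G = on_set (config_space scale p q) (\<lambda>w. graph_value k G (crd w))"
proof
  fix w
  have "(\<Prod>(i, j)\<in>#arcs G. contraction i j w) = (\<Prod>(i, j)\<in>#arcs G. pairing k i j (crd w))"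
    if w: "w \<in> config_space scale p q"
  proof -
    have "image_mset (\<lambda>(i, j). contraction i j w) (arcs G) = image_mset (\<lambda>(i, j). pairing k i j (crd w)) (arcs G)"
      using contraction_pairing[OF w] assms by (intro image_mset_cong) (auto simp: arc_diagram_def)
    then show ?thesis by simp
  qed
  moreover have "det_starred b k I w = bracket k ((!) I) (crd w)" for I
    by (simp add: det_starred_def bracket_def)
  moreover have "det_unstarred scale b k I w = bracket k ((!) I) (swap_coords (crd w))" for I
    by (simp add: det_unstarred_def bracket_def)
  ultimately show "graph_fun scale b k p q G w = on_set (config_space scale p q) (\<lambda>w. graph_value k G (crd w)) w"
    by (simp add: graph_fun_def on_set_def graph_value_def)
qed

lemma itself_vs: "vector_space ((*) :: complex \<Rightarrow> complex \<Rightarrow> complex)"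
  by unfold_locales (simp_all add: algebra_simps)

lemma config_surjective: "\<exists>w\<in>config_space scale p q. \<forall>x\<in>coord_indices k p q. crd w x = a x"
proof -
  define w where "w = ((\<lambda>i\<in>{1..p}. \<lambda>v. \<Sum>r<k. coord r v * a (Inl (i, r))),
    (\<lambda>j\<in>{1..q}. \<Sum>r<k. scale (a (Inr (j, r))) (b r)))"
  have "Vector_Spaces.linear scale (*) (\<lambda>v. \<Sum>r<k. coord r v * a (Inl (i, r)))" for i
    unfolding Vector_Spaces.linear_iff
    using vs itself_vs by (simp add: coord_add coord_scale sum.distrib distrib_right sum_distrib_left mult.assoc)
  then have "w \<in> config_space scale p q" by (auto simp: w_def config_space_def dual_space_def)
  moreover have "crd w x = a x" if x: "x \<in> coord_indices k p q" for x
  proof (cases x)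
    case (Inl y)
    then have y: "fst y \<in> {1..p}" "snd y < k" using x by (auto simp: coord_indices_def)
    then have "crd w x = (\<Sum>r<k. coord r (b (snd y)) * a (Inl (fst y, r)))"
      by (cases y) (simp add: Inl w_def)
    also have "\<dots> = (\<Sum>r<k. if r = snd y then a (Inl (fst y, r)) else 0)"
      by (rule sum.cong) (use y in \<open>auto simp: coord_basis\<close>)
    finally show ?thesis using y by (simp add: Inl)
  next
    case (Inr y)
    then have y: "fst y \<in> {1..q}" "snd y < k" using x by (auto simp: coord_indices_def)
    then show ?thesis
      using coord_combination[of "snd y" "\<lambda>r. a (Inr (fst y, r))"] by (cases y) (simp add: Inr w_def)
  qed
  ultimately show ?thesis by blast
qed

lemma GL_inverse:
  assumes "h \<in> GL_group scale"
  shows "Vector_Spaces.linear scale scale h" "Vector_Spaces.linear scale scale ((inv_into UNIV h))"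
    "h ((inv_into UNIV h) v) = v" "(inv_into UNIV h) (h v) = v" "inv_into UNIV (inv_into UNIV h) = h"
proof -
  have h: "Vector_Spaces.linear scale scale h" "bij h" using assms by (auto simp: GL_group_def)
  show "Vector_Spaces.linear scale scale h" by (rule h(1))
  have 1: "h ((inv_into UNIV h) v) = v" for v using h(2) by (simp add: bij_is_surj surj_f_inv_f)
  then show "h ((inv_into UNIV h) v) = v" .
  have 2: "(inv_into UNIV h) (h v) = v" for v using h(2) by (simp add: bij_is_inj inv_f_f)
  then show "(inv_into UNIV h) (h v) = v" .
  show "inv_into UNIV (inv_into UNIV h) = h" using h(2) by (rule inv_inv_eq)
  have "h (x + y) = h x + h y" "h (scale c x) = scale c (h x)" for x y c
    using h(1) by (auto simp: Vector_Spaces.linear_iff)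
  then have "(inv_into UNIV h) (x + y) = (inv_into UNIV h) x + (inv_into UNIV h) y" "(inv_into UNIV h) (scale c x) = scale c ((inv_into UNIV h) x)" for x y c
    using 2[of "(inv_into UNIV h) x + (inv_into UNIV h) y"] 2[of "scale c ((inv_into UNIV h) x)"] by (simp_all add: 1)
  then show "Vector_Spaces.linear scale scale ((inv_into UNIV h))" using vs by (simp add: Vector_Spaces.linear_iff)
qed

lemma GL_matrix:
  assumes h: "h \<in> GL_group scale"
  defines "g \<equiv> \<lambda>r c. coord r (h (b c))" and "g' \<equiv> \<lambda>r c. coord r ((inv_into UNIV h) (b c))"
  shows "inverse_pair k g g'" and "lin_det scale b k h = entry_det k g"
    and "w \<in> config_space scale p q \<Longrightarrow> act p q ((inv_into UNIV h)) w \<in> config_space scale p q"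
    and "w \<in> config_space scale p q \<Longrightarrow> x \<in> coord_indices k p q \<Longrightarrow>
      crd (act p q ((inv_into UNIV h)) w) x = mat_act k g g' (crd w) x"
proof -
  note GL = GL_inverse[OF h]
  show "inverse_pair k g g'"
  proof (rule inverse_pairI)
    fix r s assume rs: "r < k" "s < k"
    have "(\<Sum>c<k. g r c * g' c s) = coord r (h ((inv_into UNIV h) (b s)))"
      unfolding g_def g'_def by (rule coord_linear[OF GL(1), symmetric])
    then show "(\<Sum>c<k. g r c * g' c s) = (if r = s then 1 else 0)"
      by (simp add: GL(3) coord_basis rs)
  qed
  show "lin_det scale b k h = entry_det k g" by (simp add: lin_det_def entry_det_def g_def)
  assume w: "w \<in> config_space scale p q"
  have lin: "Vector_Spaces.linear scale (*) (fst w i)" if "i \<in> {1..p}" for i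
    using w that by (auto simp: config_space_def dual_space_def)
  have "Vector_Spaces.linear scale (*) (fst w i \<circ> h)" if "i \<in> {1..p}" for i
    using lin[OF that] GL(1) by (auto simp: Vector_Spaces.linear_iff)
  then show "act p q ((inv_into UNIV h)) w \<in> config_space scale p q"
    by (auto simp: act_def GL(5) config_space_def dual_space_def)
  assume x: "x \<in> coord_indices k p q"
  show "crd (act p q ((inv_into UNIV h)) w) x = mat_act k g g' (crd w) x"
  proof (cases x)
    case (Inl y)
    then have y: "fst y \<in> {1..p}" using x by (auto simp: coord_indices_def)
    have "crd (act p q ((inv_into UNIV h)) w) x = fst w (fst y) (h (b (snd y)))"
      using y by (cases y) (simp add: Inl act_def GL(5))
    also have "\<dots> = (\<Sum>r<k. coord r (h (b (snd y))) * fst w (fst y) (b r))"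
      by (rule linear_expand[OF lin[OF y]])
    finally show ?thesis by (simp add: Inl mat_act_def g_def mult.commute)
  next
    case (Inr y)
    then have y: "fst y \<in> {1..q}" using x by (auto simp: coord_indices_def)
    have "crd (act p q ((inv_into UNIV h)) w) x = coord (snd y) ((inv_into UNIV h) (snd w (fst y)))"
      using y by (cases y) (simp add: Inr act_def)
    also have "\<dots> = (\<Sum>c<k. coord (snd y) ((inv_into UNIV h) (b c)) * coord c (snd w (fst y)))"
      by (rule coord_linear[OF GL(2)])
    finally show ?thesis by (simp add: Inr mat_act_def g'_def)
  qed
qed

lemma matrix_GL:
  assumes gg: "inverse_pair k g g'"
  obtains h where "h \<in> GL_group scale"
    "\<And>r c. r < k \<Longrightarrow> c < k \<Longrightarrow> coord r (h (b c)) = g r c"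
    "\<And>r c. r < k \<Longrightarrow> c < k \<Longrightarrow> coord r ((inv_into UNIV h) (b c)) = g' r c"
proof -
  define L where "L m v = (\<Sum>r<k. scale (\<Sum>s<k. m r s * coord s v) (b r))" for m :: "nat \<Rightarrow> nat \<Rightarrow> complex" and v
  have coord_L: "coord r (L m v) = (\<Sum>s<k. m r s * coord s v)" if "r < k" for r m v
    unfolding L_def by (rule coord_combination[OF that])
  have L_basis: "coord r (L m (b c)) = m r c" if "r < k" "c < k" for r c m
  proof -
    have "coord r (L m (b c)) = (\<Sum>s<k. if s = c then m r s else 0)"
      unfolding coord_L[OF that(1)] by (rule sum.cong) (use that in \<open>auto simp: coord_basis\<close>)
    then show ?thesis using that by simp
  qed
  have LL: "L m (L n v) = v" if mn: "inverse_pair k m n" for m n v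
  proof -
    have "coord r (L m (L n v)) = coord r v" if r: "r < k" for r
    proof -
      have "coord r (L m (L n v)) = (\<Sum>s<k. m r s * (\<Sum>c<k. n s c * coord c v))"
        unfolding coord_L[OF r] by (rule sum.cong) (auto simp: coord_L)
      also have "\<dots> = (\<Sum>c<k. (\<Sum>s<k. m r s * n s c) * coord c v)"
        unfolding sum_distrib_left sum_distrib_right by (subst sum.swap) (simp only: mult.assoc)
      also have "\<dots> = (\<Sum>c<k. (if r = c then 1 else 0) * coord c v)"
        by (rule sum.cong) (auto simp: inverse_pair_entries[OF mn r])
      finally show ?thesis by (simp only: sum_delta_left[OF r])
    qed
    then have "(\<Sum>r<k. scale (coord r (L m (L n v))) (b r)) = (\<Sum>r<k. scale (coord r v) (b r))" by simp
    then show ?thesis by (simp only: basis_expand)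
  qed
  interpret V: vector_space scale by (rule vs)
  have "Vector_Spaces.linear scale scale (L g)"
    unfolding Vector_Spaces.linear_iff
  proof (intro conjI allI)
    show "L g (u + v) = L g u + L g v" for u v
      by (simp add: L_def coord_add distrib_left sum.distrib V.scale_left_distrib)
    show "L g (scale c v) = scale c (L g v)" for c v
      by (simp add: L_def coord_scale V.scale_sum_right sum_distrib_left mult.left_commute)
  qed (rule vs)+
  moreover have inv: "L g (L g' v) = v" "L g' (L g v) = v" for v
    using LL[OF gg] LL[OF inverse_pairD(2)[OF gg]] by auto
  then have "bij (L g)" by (metis bijI')
  ultimately have "L g \<in> GL_group scale" by (simp add: GL_group_def)
  moreover have "inv_into UNIV (L g) = L g'" using inv by (intro inv_equality)
  ultimately show ?thesis using L_basis by (intro that[of "L g"]) auto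
qed

lemma mat_act_cong:
  assumes "\<And>r c. r < k \<Longrightarrow> c < k \<Longrightarrow> g r c = m r c" "\<And>r c. r < k \<Longrightarrow> c < k \<Longrightarrow> g' r c = m' r c"
    and "\<And>x. x \<in> coord_indices k p q \<Longrightarrow> a x = a' x" and "x \<in> coord_indices k p q"
  shows "mat_act k g g' a x = mat_act k m m' a' x"
proof (cases x)
  case (Inl y)
  then show ?thesis using assms(4) unfolding mat_act_def Inl sum.case
    by (intro sum.cong refl arg_cong2[of _ _ _ _ "(*)"] assms(1,3)) (auto simp: coord_indices_def)
next
  case (Inr y)
  then show ?thesis using assms(4) unfolding mat_act_def Inr sum.case
    by (intro sum.cong refl arg_cong2[of _ _ _ _ "(*)"] assms(2,3)) (auto simp: coord_indices_def)
qed

lemma ev_cong: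
  assumes "\<And>N. N \<in> keys P \<Longrightarrow> set_mset N \<subseteq> A" "\<And>x. x \<in> A \<Longrightarrow> a x = a' x"
  shows "ev a P = ev a' P"
  unfolding ev_def
proof (intro sum.cong refl arg_cong2[of _ _ _ _ "(*)"])
  fix N assume "N \<in> keys P"
  then have "image_mset a N = image_mset a' N" using assms by (intro image_mset_cong) blast
  then show "(\<Prod>x\<in>#N. a x) = (\<Prod>x\<in>#N. a' x)" by simp
qed

text \<open>
  The predicate \<open>\<Phi>\<close> selects the subgroup by a condition on the determinant, and \<open>\<chi>\<close> is the character as
  a function of the determinant.  This covers both the general and the special linear group.
\<close>

lemma invariance_in_coordinates:
  fixes \<Phi> :: "complex \<Rightarrow> bool" and \<chi> :: "complex \<Rightarrow> complex"
  assumes P: "\<And>N. N \<in> keys P \<Longrightarrow> set_mset N \<subseteq> coord_indices k p q"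
  defines "f \<equiv> on_set (config_space scale p q) (\<lambda>w. ev (crd w) P)"
  shows "(\<forall>h\<in>GL_group scale. \<Phi> (lin_det scale b k h) \<longrightarrow>
      (\<forall>w\<in>config_space scale p q. fun_act p q h f w = \<chi> (lin_det scale b k h) * f w)) \<longleftrightarrow>
    (\<forall>g g' a. inverse_pair k g g' \<longrightarrow> \<Phi> (entry_det k g) \<longrightarrow> ev (mat_act k g g' a) P = \<chi> (entry_det k g) * ev a P)"
proof (intro iffI allI ballI impI)
  fix g g' a
  assume inv: "\<forall>h\<in>GL_group scale. \<Phi> (lin_det scale b k h) \<longrightarrow>
      (\<forall>w\<in>config_space scale p q. fun_act p q h f w = \<chi> (lin_det scale b k h) * f w)"
    and gg: "inverse_pair k g g'" and \<Phi>: "\<Phi> (entry_det k g)"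
  obtain h where h: "h \<in> GL_group scale"
    and e: "\<And>r c. r < k \<Longrightarrow> c < k \<Longrightarrow> coord r (h (b c)) = g r c"
    and e': "\<And>r c. r < k \<Longrightarrow> c < k \<Longrightarrow> coord r ((inv_into UNIV h) (b c)) = g' r c"
    using matrix_GL[OF gg] by blast
  have "mat k k (\<lambda>(r, c). coord r (h (b c))) = mat k k (\<lambda>(r, c). g r c)" by (rule eq_matI) (auto simp: e)
  then have d: "lin_det scale b k h = entry_det k g" by (simp add: lin_det_def entry_det_def)
  obtain w where w: "w \<in> config_space scale p q" and wa: "\<And>x. x \<in> coord_indices k p q \<Longrightarrow> crd w x = a x"
    using config_surjective[of p q a] by blast
  have "fun_act p q h f w = \<chi> (entry_det k g) * f w" using inv h w \<Phi> d by auto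
  then have "ev (crd (act p q ((inv_into UNIV h)) w)) P = \<chi> (entry_det k g) * ev (crd w) P"
    using w GL_matrix(3)[OF h w] by (simp add: fun_act_def f_def on_set_def)
  moreover have "ev (crd (act p q ((inv_into UNIV h)) w)) P = ev (mat_act k g g' a) P"
  proof (rule ev_cong[OF P])
    fix x assume x: "x \<in> coord_indices k p q"
    show "crd (act p q ((inv_into UNIV h)) w) x = mat_act k g g' a x"
      unfolding GL_matrix(4)[OF h w x] using x by (intro mat_act_cong e e' wa)
  qed
  moreover have "ev (crd w) P = ev a P" by (rule ev_cong[OF P wa])
  ultimately show "ev (mat_act k g g' a) P = \<chi> (entry_det k g) * ev a P" by simp
next
  fix h w
  assume inv: "\<forall>g g' a. inverse_pair k g g' \<longrightarrow> \<Phi> (entry_det k g) \<longrightarrow> ev (mat_act k g g' a) P = \<chi> (entry_det k g) * ev a P"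
    and h: "h \<in> GL_group scale" "\<Phi> (lin_det scale b k h)" and w: "w \<in> config_space scale p q"
  note m = GL_matrix[OF h(1)]
  have "ev (crd (act p q ((inv_into UNIV h)) w)) P = ev (mat_act k (\<lambda>r c. coord r (h (b c))) (\<lambda>r c. coord r ((inv_into UNIV h) (b c))) (crd w)) P"
    by (rule ev_cong[OF P m(4)[OF w]])
  also have "\<dots> = \<chi> (lin_det scale b k h) * ev (crd w) P"
    unfolding m(2) using inv m(1) h(2)[unfolded m(2)] by blast
  finally show "fun_act p q h f w = \<chi> (lin_det scale b k h) * f w"
    using w m(3)[OF w] by (simp add: fun_act_def f_def on_set_def)
qed

lemma span_monomial_funs:
  "fun_space.span {monomial_fun scale b k p q N | N. N \<in> \<N>} =
    {on_set (config_space scale p q) (\<lambda>w. ev (crd w) P) | P. keys P \<subseteq> \<N>}"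
proof (intro equalityI subsetI)
  fix f assume "f \<in> fun_space.span {monomial_fun scale b k p q N | N. N \<in> \<N>}"
  then have "f \<in> fun_space.span (monomial_fun scale b k p q ` \<N>)" by (simp only: setcompr_eq_image Collect_mem_eq)
  then obtain S c where S: "finite S" "S \<subseteq> \<N>" and f: "\<And>w. f w = (\<Sum>N\<in>S. c N * monomial_fun scale b k p q N w)"
    by (rule span_family) (rule that)
  define P where "P = (\<Sum>N\<in>S. single N (c N))"
  have "keys P \<subseteq> \<N>"
  proof
    fix N assume N: "N \<in> keys P"
    obtain M where "M \<in> S" "N \<in> keys (single M (c M))"
      using keys_sumD[OF N[unfolded P_def]] by blast
    then show "N \<in> \<N>" using S(2) by (auto split: if_splits)
  qed
  moreover have "f = on_set (config_space scale p q) (\<lambda>w. ev (crd w) P)"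
    by (auto simp: fun_eq_iff f monomial_fun_def on_set_def P_def)
  ultimately show "f \<in> {on_set (config_space scale p q) (\<lambda>w. ev (crd w) P) | P. keys P \<subseteq> \<N>}" by blast
next
  fix f assume "f \<in> {on_set (config_space scale p q) (\<lambda>w. ev (crd w) P) | P. keys P \<subseteq> \<N>}"
  then obtain P where P: "keys P \<subseteq> \<N>" "f = on_set (config_space scale p q) (\<lambda>w. ev (crd w) P)" by blast
  have "f = (\<lambda>w. \<Sum>N\<in>keys P. lookup P N * monomial_fun scale b k p q N w)"
    by (auto simp: P(2) fun_eq_iff monomial_fun_def on_set_def ev_def)
  also have "\<dots> \<in> fun_space.span {monomial_fun scale b k p q N | N. N \<in> \<N>}"
    by (intro span_of_sum fun_space.span_base) (use P(1) in auto)
  finally show "f \<in> fun_space.span {monomial_fun scale b k p q N | N. N \<in> \<N>}" .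
qed

section \<open>The bases of graphs\<close>

lemma graph_fun_family:
  fixes \<Phi> :: "complex \<Rightarrow> bool" and \<chi> :: "complex \<Rightarrow> complex"
  assumes k: "0 < k"
    and \<N>: "\<And>N. N \<in> \<N> \<Longrightarrow> set_mset N \<subseteq> coord_indices k p q"
    and \<Gamma>: "\<Gamma> \<subseteq> admissible_graphs k p q" "\<And>G. G \<in> \<Gamma> \<Longrightarrow> keys (graph_poly k G) \<subseteq> \<N>"
    and inv: "\<And>G g g' a. G \<in> \<Gamma> \<Longrightarrow> inverse_pair k g g' \<Longrightarrow> \<Phi> (entry_det k g) \<Longrightarrow>
      graph_value k G (mat_act k g g' a) = \<chi> (entry_det k g) * graph_value k G a"
    and span: "\<And>P. keys P \<subseteq> \<N> \<Longrightarrow>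
      (\<And>g g' a. inverse_pair k g g' \<Longrightarrow> \<Phi> (entry_det k g) \<Longrightarrow> ev (mat_act k g g' a) P = \<chi> (entry_det k g) * ev a P) \<Longrightarrow>
      (\<lambda>a. ev a P) \<in> fun_space.span (graph_value k ` \<Gamma>)"
    and H: "H = {h \<in> GL_group scale. \<Phi> (lin_det scale b k h)}"
  shows "is_basis_family (graph_fun scale b k p q) \<Gamma>
    (semi_invariants scale p q (fun_space.span {monomial_fun scale b k p q N | N. N \<in> \<N>}) H
      (\<lambda>h. \<chi> (lin_det scale b k h)))"
proof -
  let ?W = "config_space scale p q" and ?F = "graph_fun scale b k p q"
  have gf: "?F G = on_set ?W (\<lambda>w. graph_value k G (crd w))" if "G \<in> \<Gamma>" for G
    using that \<Gamma>(1) by (intro graph_fun_graph_value) (auto simp: admissible_graphs_def)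
  have graph_value_cong: "graph_value k G a = graph_value k G a'"
    if G: "G \<in> \<Gamma>" and a: "\<And>x. x \<in> coord_indices k p q \<Longrightarrow> a x = a' x" for G a a'
    unfolding ev_graph_poly[symmetric]
  proof (rule ev_cong[OF _ a])
    show "set_mset N \<subseteq> coord_indices k p q" if "N \<in> keys (graph_poly k G)" for N
      using \<Gamma>(2)[OF G] \<N> that by blast
  qed
  have indep: "\<forall>G\<in>S. c G = 0"
    if S: "finite S" "S \<subseteq> \<Gamma>" and zero: "\<And>w. (\<Sum>G\<in>S. c G * ?F G w) = 0" for S c
  proof (rule graphs_independent[OF k S(1)])
    show "S \<subseteq> admissible_graphs k p q" using S(2) \<Gamma>(1) by blast
    fix a
    obtain w where w: "w \<in> ?W" and wa: "\<And>x. x \<in> coord_indices k p q \<Longrightarrow> crd w x = a x"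
      using config_surjective[of p q a] by blast
    have "(\<Sum>G\<in>S. c G * graph_value k G a) = (\<Sum>G\<in>S. c G * ?F G w)"
    proof (rule sum.cong[OF refl])
      fix G assume "G \<in> S"
      then have G: "G \<in> \<Gamma>" using S(2) by blast
      show "c G * graph_value k G a = c G * ?F G w"
        using graph_value_cong[OF G wa] w by (simp add: gf[OF G] on_set_def)
    qed
    then show "(\<Sum>G\<in>S. c G * graph_value k G a) = 0" by (simp add: zero)
  qed
  have inj: "inj_on ?F \<Gamma>"
  proof (rule inj_onI, rule ccontr)
    fix G G' assume G: "G \<in> \<Gamma>" "G' \<in> \<Gamma>" "?F G = ?F G'" "G \<noteq> G'"
    have "\<forall>X\<in>{G, G'}. (if X = G then 1 else -1 :: complex) = 0"
      by (rule indep) (use G in auto)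
    then show False by simp
  qed
  have independent: "fun_space.independent (?F ` \<Gamma>)"
    unfolding fun_space.independent_explicit_module
  proof (intro allI impI)
    fix t u v assume t: "finite t" "t \<subseteq> ?F ` \<Gamma>" "(\<Sum>v\<in>t. fun_scale (u v) v) = 0" "v \<in> t"
    obtain S where S: "S \<subseteq> \<Gamma>" "t = ?F ` S" using t(2) by (meson subset_imageE)
    have injS: "inj_on ?F S" using inj S(1) by (rule inj_on_subset)
    then have fin: "finite S" using t(1) S(2) by (simp add: finite_image_iff)
    have "(\<Sum>G\<in>S. u (?F G) * ?F G w) = 0" for w
    proof -
      have "(\<Sum>G\<in>S. u (?F G) * ?F G w) = (\<Sum>v\<in>t. fun_scale (u v) v) w"
        unfolding S(2) sum.reindex[OF injS] using fin by (induction S) (auto simp: fun_scale_def)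
      then show ?thesis by (simp add: t(3))
    qed
    then have "\<forall>G\<in>S. u (?F G) = 0" by (rule indep[OF fin S(1)])
    then show "u v = 0" using t(4) S(2) by auto
  qed
  have mem: "f \<in> semi_invariants scale p q (fun_space.span {monomial_fun scale b k p q N | N. N \<in> \<N>}) H
        (\<lambda>h. \<chi> (lin_det scale b k h)) \<longleftrightarrow>
      (\<exists>P. keys P \<subseteq> \<N> \<and> f = on_set ?W (\<lambda>w. ev (crd w) P) \<and>
        (\<forall>g g' a. inverse_pair k g g' \<longrightarrow> \<Phi> (entry_det k g) \<longrightarrow> ev (mat_act k g g' a) P = \<chi> (entry_det k g) * ev a P))" for f
  proof -
    have "(\<forall>h\<in>H. \<forall>w\<in>?W. fun_act p q h f w = \<chi> (lin_det scale b k h) * f w) \<longleftrightarrow>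
        (\<forall>g g' a. inverse_pair k g g' \<longrightarrow> \<Phi> (entry_det k g) \<longrightarrow> ev (mat_act k g g' a) P = \<chi> (entry_det k g) * ev a P)"
      if P: "keys P \<subseteq> \<N>" "f = on_set ?W (\<lambda>w. ev (crd w) P)" for P
    proof -
      have vars: "set_mset N \<subseteq> coord_indices k p q" if "N \<in> keys P" for N
        using P(1) \<N> that by blast
      have "(\<forall>h\<in>H. X h) \<longleftrightarrow> (\<forall>h\<in>GL_group scale. \<Phi> (lin_det scale b k h) \<longrightarrow> X h)" for X
        unfolding H by blast
      then show ?thesis
        unfolding P(2) using invariance_in_coordinates[where P = P and \<Phi> = \<Phi> and \<chi> = \<chi>, OF vars]
        by (simp only:)
    qed
    then show ?thesis unfolding semi_invariants_def span_monomial_funs by blast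
  qed
  have "fun_space.span (?F ` \<Gamma>) = semi_invariants scale p q (fun_space.span {monomial_fun scale b k p q N | N. N \<in> \<N>}) H
      (\<lambda>h. \<chi> (lin_det scale b k h))"
  proof (intro equalityI subsetI)
    fix f assume "f \<in> fun_space.span (?F ` \<Gamma>)"
    then obtain S c where S: "finite S" "S \<subseteq> \<Gamma>" and f: "\<And>w. f w = (\<Sum>G\<in>S. c G * ?F G w)"
      by (rule span_family) (rule that)
    define P where "P = (\<Sum>G\<in>S. single {#} (c G) * graph_poly k G)"
    have ev_P: "ev a P = (\<Sum>G\<in>S. c G * graph_value k G a)" for a
      unfolding P_def ev_sum by (subst ev_mult) (simp add: ev_graph_poly)
    have "keys P \<subseteq> \<N>"
    proof
      fix N assume N: "N \<in> keys P"
      obtain G where "G \<in> S" "N \<in> keys (single {#} (c G) * graph_poly k G)"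
        using keys_sumD[OF N[unfolded P_def]] by blast
      moreover from this have "N \<in> keys (graph_poly k G)" by (auto simp: in_keys_iff lookup_scale)
      ultimately show "N \<in> \<N>" using \<Gamma>(2)[of G] S(2) by blast
    qed
    moreover have "f = on_set ?W (\<lambda>w. ev (crd w) P)"
    proof
      fix w
      have "?F G w = (if w \<in> ?W then graph_value k G (crd w) else 0)" if "G \<in> S" for G
        using gf[of G] S(2) that by (auto simp: on_set_def)
      then show "f w = on_set ?W (\<lambda>w. ev (crd w) P) w"
        by (simp add: f on_set_def ev_P)
    qed
    moreover have "ev (mat_act k g g' a) P = \<chi> (entry_det k g) * ev a P"
      if "inverse_pair k g g'" "\<Phi> (entry_det k g)" for g g' a
      unfolding ev_P sum_distrib_left
      by (rule sum.cong[OF refl]) (use inv[OF _ that] S(2) in auto)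
    ultimately show "f \<in> semi_invariants scale p q (fun_space.span {monomial_fun scale b k p q N | N. N \<in> \<N>}) H
        (\<lambda>h. \<chi> (lin_det scale b k h))" unfolding mem by blast
  next
    fix f assume "f \<in> semi_invariants scale p q (fun_space.span {monomial_fun scale b k p q N | N. N \<in> \<N>}) H
        (\<lambda>h. \<chi> (lin_det scale b k h))"
    then obtain P where P: "keys P \<subseteq> \<N>" "f = on_set ?W (\<lambda>w. ev (crd w) P)"
      and invP: "\<And>g g' a. inverse_pair k g g' \<Longrightarrow> \<Phi> (entry_det k g) \<Longrightarrow> ev (mat_act k g g' a) P = \<chi> (entry_det k g) * ev a P"
      unfolding mem by blast
    have "(\<lambda>a. ev a P) \<in> fun_space.span (graph_value k ` \<Gamma>)"
      by (rule span[OF P(1)]) (rule invP)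
    then obtain S c where S: "finite S" "S \<subseteq> \<Gamma>" and c: "\<And>a. ev a P = (\<Sum>G\<in>S. c G * graph_value k G a)"
      by (rule span_family) (rule that)
    have "f = (\<lambda>w. \<Sum>G\<in>S. c G * ?F G w)"
    proof
      fix w
      have "?F G w = (if w \<in> ?W then graph_value k G (crd w) else 0)" if "G \<in> S" for G
        using gf[of G] S(2) that by (auto simp: on_set_def)
      then show "f w = (\<Sum>G\<in>S. c G * ?F G w)" by (simp add: P(2) on_set_def c)
    qed
    also have "\<dots> \<in> fun_space.span (?F ` \<Gamma>)"
      by (intro span_of_sum fun_space.span_base) (use S(2) in auto)
    finally show "f \<in> fun_space.span (?F ` \<Gamma>)" .
  qed
  then show ?thesis using inj independent by (simp add: is_basis_family_def)
qed

lemma general_linear_basis: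
  assumes k: "0 < k"
  shows "is_basis_family (graph_fun scale b k p q) {G \<in> admissible_graphs k p q. graph_weight G = m}
    (semi_invariants scale p q (poly_funs scale b k p q) (GL_group scale) (\<lambda>h. lin_det scale b k h powi m))"
proof -
  have "is_basis_family (graph_fun scale b k p q) {G \<in> admissible_graphs k p q. graph_weight G = m}
    (semi_invariants scale p q (fun_space.span {monomial_fun scale b k p q N | N. N \<in> {N. set_mset N \<subseteq> coord_indices k p q}})
      (GL_group scale) (\<lambda>h. (\<lambda>x. x powi m) (lin_det scale b k h)))"
  proof (rule graph_fun_family[OF k, where \<Phi> = "\<lambda>_. True"])
    fix P assume P: "keys P \<subseteq> {N. set_mset N \<subseteq> coord_indices k p q}"
      and inv: "\<And>g g' a. inverse_pair k g g' \<Longrightarrow> True \<Longrightarrow> ev (mat_act k g g' a) P = entry_det k g powi m * ev a P"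
    show "(\<lambda>a. ev a P) \<in> fun_space.span (graph_value k ` {G \<in> admissible_graphs k p q. graph_weight G = m})"
      by (rule semi_invariant_graph_span[OF k]) (use P inv in \<open>auto simp: semi_invariant_poly_def\<close>)
  next
    fix G g g' a assume "G \<in> {G \<in> admissible_graphs k p q. graph_weight G = m}" "inverse_pair k g g'"
    then show "graph_value k G (mat_act k g g' a) = entry_det k g powi m * graph_value k G a"
      using graph_value_mat_act[of k g g' G a] by (auto simp: admissible_graphs_def)
  next
    fix G assume G: "G \<in> {G \<in> admissible_graphs k p q. graph_weight G = m}"
    show "keys (graph_poly k G) \<subseteq> {N. set_mset N \<subseteq> coord_indices k p q}"
    proof (rule subsetI, rule CollectI)
      fix N assume "N \<in> keys (graph_poly k G)"
      then show "set_mset N \<subseteq> coord_indices k p q" using keys_graph_poly(1) G by blast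
    qed
  qed auto
  then show ?thesis by (simp add: poly_funs_def)
qed

lemma special_linear_basis:
  assumes k: "0 < k"
  shows "is_basis_family (graph_fun scale b k p q) {G \<in> admissible_graphs k p q. total_degree k G = d}
    (semi_invariants scale p q (hom_poly_funs scale b k p q d) (SL_group scale b k) (\<lambda>_. 1))"
proof -
  have "is_basis_family (graph_fun scale b k p q) {G \<in> admissible_graphs k p q. total_degree k G = d}
    (semi_invariants scale p q
      (fun_space.span {monomial_fun scale b k p q N | N. N \<in> {N. set_mset N \<subseteq> coord_indices k p q \<and> size N = d}})
      (SL_group scale b k) (\<lambda>h. (\<lambda>x. 1) (lin_det scale b k h)))"
  proof (rule graph_fun_family[OF k, where \<Phi> = "\<lambda>x. x = 1"])
    fix P assume P: "keys P \<subseteq> {N. set_mset N \<subseteq> coord_indices k p q \<and> size N = d}"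
      and inv: "\<And>g g' a. inverse_pair k g g' \<Longrightarrow> entry_det k g = 1 \<Longrightarrow> ev (mat_act k g g' a) P = 1 * ev a P"
    show "(\<lambda>a. ev a P) \<in> fun_space.span (graph_value k ` {G \<in> admissible_graphs k p q. total_degree k G = d})"
      by (rule special_invariant_graph_span[OF k]) (use P inv in auto)
  next
    fix G g g' a assume "G \<in> {G \<in> admissible_graphs k p q. total_degree k G = d}" "inverse_pair k g g'" "entry_det k g = 1"
    then show "graph_value k G (mat_act k g g' a) = 1 * graph_value k G a"
      using graph_value_mat_act[of k g g' G a] by (auto simp: admissible_graphs_def)
  next
    fix G assume G: "G \<in> {G \<in> admissible_graphs k p q. total_degree k G = d}"
    show "keys (graph_poly k G) \<subseteq> {N. set_mset N \<subseteq> coord_indices k p q \<and> size N = d}"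
    proof (rule subsetI, rule CollectI, rule conjI)
      fix N assume N: "N \<in> keys (graph_poly k G)"
      show "set_mset N \<subseteq> coord_indices k p q" using keys_graph_poly(1) G N by blast
      show "size N = d" using keys_graph_poly(2)[OF _ N] G by blast
    qed
  qed (auto simp: SL_group_def)
  then show ?thesis by (simp add: hom_poly_funs_def)
qed

end

theorem proposition4p2p1:
  fixes scale :: "complex \<Rightarrow> 'v::ab_group_add \<Rightarrow> 'v"
    and b :: "nat \<Rightarrow> 'v"
    and k p q :: nat
  assumes "k \<ge> 1"
    and "finite_dimensional_vector_space scale (b ` {..<k})"
    and "inj_on b {..<k}"
    and "vector_space.dim scale (UNIV :: 'v set) = k"
  shows
    "(\<forall>d. is_basis_family (graph_fun scale b k p q)
        {G \<in> admissible_graphs k p q. total_degree k G = d}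
        (semi_invariants scale p q (hom_poly_funs scale b k p q d)
          (SL_group scale b k) (\<lambda>_. 1))) \<and>
     (\<forall>G \<in> admissible_graphs k p q.
        graph_fun scale b k p q G
          \<in> semi_invariants scale p q (poly_funs scale b k p q) (SL_group scale b k) (\<lambda>_. 1) \<and>
        (\<forall>w \<in> config_space scale p q.
          graph_fun scale b k p q G w =
            (\<Prod>(i, j)\<in>#arcs G. contraction i j w) *
            (\<Prod>I\<in>#starred G. det_starred b k I w) *
            (\<Prod>J\<in>#unstarred G. det_unstarred scale b k J w))) \<and>
     (\<forall>m. is_basis_family (graph_fun scale b k p q)
        {G \<in> admissible_graphs k p q. size (starred G) = m \<and> unstarred G = {#}}
        (semi_invariants scale p q (poly_funs scale b k p q)
          (GL_group scale) (\<lambda>h. lin_det scale b k h powi (int m)))) \<and>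
     (\<forall>m. is_basis_family (graph_fun scale b k p q)
        {G \<in> admissible_graphs k p q. size (unstarred G) = m \<and> starred G = {#}}
        (semi_invariants scale p q (poly_funs scale b k p q)
          (GL_group scale) (\<lambda>h. lin_det scale b k h powi (- int m))))"
proof -
  interpret based_space scale b k by (rule based_space.intro[OF assms(2,3)])
  have k: "0 < k" using assms(1) by simp
  have SL: "graph_fun scale b k p q G
      \<in> semi_invariants scale p q (poly_funs scale b k p q) (SL_group scale b k) (\<lambda>_. 1)"
    if G: "G \<in> admissible_graphs k p q" for G
  proof -
    have "graph_fun scale b k p q G \<in> fun_space.span (graph_fun scale b k p q `
        {G' \<in> admissible_graphs k p q. graph_weight G' = graph_weight G})"
      by (rule fun_space.span_base, rule imageI) (use G in simp)
    also have "\<dots> = semi_invariants scale p q (poly_funs scale b k p q)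
        (GL_group scale) (\<lambda>h. lin_det scale b k h powi graph_weight G)"
      using general_linear_basis[OF k, of p q "graph_weight G"] by (simp only: is_basis_family_def)
    finally show ?thesis by (auto simp: semi_invariants_def SL_group_def)
  qed
  have starred: "{G \<in> admissible_graphs k p q. size (starred G) = m \<and> unstarred G = {#}} =
      {G \<in> admissible_graphs k p q. graph_weight G = int m}" for m
    by (auto simp: graph_weight_def admissible_graphs_def)
  have unstarred: "{G \<in> admissible_graphs k p q. size (unstarred G) = m \<and> starred G = {#}} =
      {G \<in> admissible_graphs k p q. graph_weight G = - int m}" for m
    by (auto simp: graph_weight_def admissible_graphs_def)
      (subst size_eq_0_iff_empty[symmetric], linarith)
  show ?thesis
    unfolding starred unstarred
  proof (intro conjI allI ballI)
    fix G w assume "w \<in> config_space scale p q"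
    then show "graph_fun scale b k p q G w =
        (\<Prod>(i, j)\<in>#arcs G. contraction i j w) *
        (\<Prod>I\<in>#starred G. det_starred b k I w) *
        (\<Prod>J\<in>#unstarred G. det_unstarred scale b k J w)"
      by (simp add: graph_fun_def on_set_def)
  qed (rule special_linear_basis[OF k] general_linear_basis[OF k] SL, assumption?)+
qed

end
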